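(* Let $X_j=\sum_{k=0}^\infty a_k\zeta_{j-k}$, $j\in\mathbb{Z}$, be a linear process with real coefficients satisfying $\sum_{k=0}^\infty a_k^2<\infty$ and i.i.d. real random variables $\zeta_j$, $j\in\mathbb{Z}$, with $E\zeta_0=0$, $E\zeta_0^2=1$ and $E\zeta_0^4<\infty$. Assume that, for some $|d|<1/2$, the spectral density is $f_X(u)=|u|^{-2d}g(u)$, $|u|\le\pi$, where $g$ is continuous on $\Pi=[-\pi,\pi]$ and $0<C_1\le g(u)\le C_2<\infty$, $u\in\Pi$, for some constants $C_1,C_2$. Let $b_{n,j}$ be a triangular array of real weights. Below $C$ denotes a constant not depending on $n$. (i) Then $$E(Q_{n,X}-EQ_{n,X})^2\le C B_{f,n}^2 .$$ (ii) In addition, $$E\Bigl(Q_{n,X}-\sum_{j=1}^{\nu}b_{n,j}f_{X,j}\Bigr)^2\le C B_{f,n}^2$$ in each of the following three cases: (c1) $d=0$ and $g\in\Lambda_\beta[\Pi]$, $1/2<\beta\le1$; (c2) $d\neq0$ and $g\in\Lambda_\beta[\Pi]$, $1/2<\beta\le1$; (c3) $f_X$ has a derivative satisfying $|\dot f_X(u)|\le Cu^{-1-2d}$, $0<u\le\pi$. Moreover, in case (c1), $$EQ_{n,X}-\sum_{j=1}^{\nu}b_{n,j}f_{X,j}=o(B_{f,n})\qquad(n\to\infty).$$ If the weights satisfy $$\frac{\max_{j=1,\ldots,\nu}|b_{n,j}f_{X,j}|}{\left(\sum_{j=1}^{\nu}(b_{n,j}f_{X,j})^2\right)^{1/2}}\to0\qquad(n\to\infty),$$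 then this last relation holds also in cases (c2) and (c3).
   Context: $[\cdot]$ denotes integer part, $\nu=[n/2]-1$, and $u_j=2\pi j/n$. The spectral density is $f_X(u)=|A_X(u)|^2/(2\pi)$, where $A_X(u)=\sum_{k=0}^\infty e^{-\mathrm{i}ku}a_k$ (an $L^2(\Pi)$ series; pointwise conditions refer to a fixed version), and $f_{X,j}=f_X(u_j)$. The periodogram is $I_X(u_j)=(2\pi n)^{-1}\bigl|\sum_{t=1}^n e^{\mathrm{i}tu_j}X_t\bigr|^2$. Define $Q_{n,X}=\sum_{j=1}^{\nu}b_{n,j}I_X(u_j)$ and $B_{f,n}=\bigl(\sum_{j=1}^{\nu}(b_{n,j}f_{X,j})^2\bigr)^{1/2}$. For $\beta\in(0,1]$, $\Lambda_\beta[\Pi]$ is the class of Lipschitz functions on $\Pi$ with parameter $\beta$, i.e. $|h(u)-h(v)|\le C|u-v|^\beta$ for all $u,v\in\Pi$ and some $C<\infty$. *)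

theory Defs
  imports "HOL-Probability.Probability" "HOL-Library.Landau_Symbols"
begin

text \<open>Mean-square convergence. The nonnegative integral is used because a Bochner integral
  would be 0 for an integrand that fails to be integrable.\<close>

definition tendsto_L2 ::
  "'a measure \<Rightarrow> (nat \<Rightarrow> 'a \<Rightarrow> 'b::real_normed_vector) \<Rightarrow> ('a \<Rightarrow> 'b) \<Rightarrow> bool"
  where "tendsto_L2 M F f \<longleftrightarrow>
    (\<forall>N. F N \<in> borel_measurable M) \<and> f \<in> borel_measurable M \<and>
    (\<lambda>N. \<integral>\<^sup>+ x. ennreal ((norm (F N x - f x))\<^sup>2) \<partial>M) \<longlonglongrightarrow> 0"

definition iid_sequence :: "'a measure \<Rightarrow> (int \<Rightarrow> 'a \<Rightarrow> real) \<Rightarrow> bool"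
  where "iid_sequence M \<zeta> \<longleftrightarrow>
    prob_space.indep_vars M (\<lambda>_. borel) \<zeta> UNIV \<and>
    (\<forall>j. distr M borel (\<zeta> j) = distr M borel (\<zeta> 0))"

text \<open>The series defining a linear process converges in mean square; \<open>X j\<close> may be any
  version of its sum.\<close>

definition linear_process ::
  "'a measure \<Rightarrow> (nat \<Rightarrow> real) \<Rightarrow> (int \<Rightarrow> 'a \<Rightarrow> real) \<Rightarrow> (int \<Rightarrow> 'a \<Rightarrow> real) \<Rightarrow> bool"
  where "linear_process M a \<zeta> X \<longleftrightarrow>
    (\<forall>j. tendsto_L2 M (\<lambda>N \<omega>. \<Sum>k<N. a k * \<zeta> (j - int k) \<omega>) (X j))"

text \<open>\<open>A\<close> is a version on \<open>[-\<pi>, \<pi>]\<close> of the \<open>L\<^sup>2\<close> sum of the series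
  \<open>\<Sum>k. e\<^bsup>-iku\<^esup> a\<^sub>k\<close>.\<close>

definition transfer_function :: "(nat \<Rightarrow> real) \<Rightarrow> (real \<Rightarrow> complex) \<Rightarrow> bool"
  where "transfer_function a A \<longleftrightarrow>
    tendsto_L2 (lebesgue_on {-pi..pi})
      (\<lambda>N u. \<Sum>k<N. exp (- \<i> * of_nat k * of_real u) * of_real (a k)) A"

definition spectral_density :: "(real \<Rightarrow> complex) \<Rightarrow> real \<Rightarrow> real"
  where "spectral_density A u = (cmod (A u))\<^sup>2 / (2 * pi)"

definition Lipschitz_class :: "real \<Rightarrow> (real \<Rightarrow> real) set"
  where "Lipschitz_class \<beta> =
    {h. \<exists>C. \<forall>u\<in>{-pi..pi}. \<forall>v\<in>{-pi..pi}. \<bar>h u - h v\<bar> \<le> C * \<bar>u - v\<bar> powr \<beta>}"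

text \<open>For \<open>n < 4\<close> the truncated value is 0; sums over \<open>{1..nu n}\<close> are then empty, as they are
  for the integer \<open>\<lfloor>n/2\<rfloor> - 1 \<le> 0\<close>.\<close>

definition nu :: "nat \<Rightarrow> nat"
  where "nu n = n div 2 - 1"

definition fourier_freq :: "nat \<Rightarrow> nat \<Rightarrow> real"
  where "fourier_freq n j = 2 * pi * real j / real n"

definition periodogram :: "(int \<Rightarrow> 'a \<Rightarrow> real) \<Rightarrow> nat \<Rightarrow> real \<Rightarrow> 'a \<Rightarrow> real"
  where "periodogram X n u \<omega> =
    (cmod (\<Sum>t=1..n. exp (\<i> * of_nat t * of_real u) * of_real (X (int t) \<omega>)))\<^sup>2
      / (2 * pi * real n)"

definition weighted_periodogram ::
  "(int \<Rightarrow> 'a \<Rightarrow> real) \<Rightarrow> (nat \<Rightarrow> nat \<Rightarrow> real) \<Rightarrow> nat \<Rightarrow> 'a \<Rightarrow> real"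
  where "weighted_periodogram X b n \<omega> =
    (\<Sum>j=1..nu n. b n j * periodogram X n (fourier_freq n j) \<omega>)"

definition weighted_spectrum :: "(real \<Rightarrow> real) \<Rightarrow> (nat \<Rightarrow> nat \<Rightarrow> real) \<Rightarrow> nat \<Rightarrow> real"
  where "weighted_spectrum f b n = (\<Sum>j=1..nu n. b n j * f (fourier_freq n j))"

definition B_norm :: "(real \<Rightarrow> real) \<Rightarrow> (nat \<Rightarrow> nat \<Rightarrow> real) \<Rightarrow> nat \<Rightarrow> real"
  where "B_norm f b n = sqrt (\<Sum>j=1..nu n. (b n j * f (fourier_freq n j))\<^sup>2)"

text \<open>At \<open>u = \<pi>\<close> the derivative is one-sided.\<close>

definition derivative_condition :: "real \<Rightarrow> (real \<Rightarrow> real) \<Rightarrow> bool"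
  where "derivative_condition d f \<longleftrightarrow>
    (\<exists>f' C. \<forall>u\<in>{0<..pi}.
      (f has_real_derivative f' u) (at u within {-pi..pi}) \<and>
      \<bar>f' u\<bar> \<le> C * u powr (- 1 - 2 * d))"

end

(*
  The periodogram ordinate I(u_j) is the squared modulus of the normalized Fourier coefficient
  w_j = sum_s alpha_j(s) zeta_s, and <alpha_j, alpha_k> = int f phi_j conj(phi_k) with the
  orthonormal Dirichlet-type kernels phi_j.  For an i.i.d. quadratic form the variance is bounded
  by the squared Hilbert-Schmidt norm, here sum_{j,k} b_j b_k |<alpha_j, alpha_k>|^2.  This sum is
  at most a constant times B^2 because of the operator inequality

    int f |sum_j c_j phi_j|^2 <= C sum_j |c_j|^2 f(u_j),

  a weighted Marcinkiewicz-Zygmund inequality, where only the two-sided bound on g matters.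
  It follows from orthonormality (the case d = 0) together with Schur's test for a positive kernel
  that dominates the error of replacing |u|^(-d) by u_j^(-d).

  For (ii), |phi_j|^2 is a Fejer kernel centred at -u_j.  The smoothness of g, respectively of f,
  gives |E I(u_j) - f(u_j)| <= C j^(-beta) f(u_j) with beta > 1/2, and C n^(-beta) f(u_j) in case
  (c1).  These rates are square summable in j, and Cauchy-Schwarz concludes.
*)

theory Submission
  imports Defs
begin


section \<open>Variance of quadratic forms in independent variables\<close>

text \<open>Three obstacles shape the proof. The process is given only as a mean-square limit, while
  the variance of a quadratic form is computed for finitely many variables. The series is therefore
  cut at N, and N tends to infinity with n fixed. The quadratic forms are shown to converge in L1,
  which carries expectations over exactly and variances as an upper bound; an upper bound is all
  that is claimed. Next, the weights have arbitrary signs, so nothing is monotone in them; the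
  Hilbert-Schmidt norm together with two uses of the operator inequality turns the products b_j b_k
  into squares. Finally, the rate j^(-\<beta>) is square summable but does not become small with n:
  a single low frequency may carry all the weight, and the bound for its relative bias stays fixed.
  The condition on the maximum makes any fixed number of low frequencies negligible. In case (c1)
  the rate n^(-\<beta>), taken over at most n frequencies, has l2 norm at most n^(1/2 - \<beta>) up
  to a constant, which tends to 0. First moments of Fejer kernels carry a logarithm, so all
  exponents are kept below 1.\<close>

definition square_integrable :: "'a measure \<Rightarrow> ('a \<Rightarrow> 'b::{banach, second_countable_topology}) \<Rightarrow> bool"
  where "square_integrable M f \<longleftrightarrow> f \<in> borel_measurable M \<and> integrable M (\<lambda>x. (norm (f x))\<^sup>2)"

lemma norm_add_power2_le: "(norm (x + y :: 'b::real_normed_vector))\<^sup>2 \<le> 2 * (norm x)\<^sup>2 + 2 * (norm y)\<^sup>2"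
proof -
  have "(norm (x + y))\<^sup>2 \<le> (norm x + norm y)\<^sup>2"
    by (intro power_mono norm_triangle_ineq) auto
  also have "\<dots> \<le> 2 * (norm x)\<^sup>2 + 2 * (norm y)\<^sup>2"
    using sum_squares_bound[of "norm x" "norm y"] by (simp add: power2_sum)
  finally show ?thesis .
qed

lemma square_integrable_add:
  assumes "square_integrable M f" "square_integrable M g"
  shows "square_integrable M (\<lambda>x. f x + g x)"
  unfolding square_integrable_def
proof (intro conjI)
  show "(\<lambda>x. f x + g x) \<in> borel_measurable M"
    using assms by (auto simp: square_integrable_def)
  show "integrable M (\<lambda>x. (norm (f x + g x))\<^sup>2)"
    by (rule Bochner_Integration.integrable_bound[of M "\<lambda>x. 2 * (norm (f x))\<^sup>2 + 2 * (norm (g x))\<^sup>2"])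
      (use assms norm_add_power2_le in \<open>auto simp: square_integrable_def\<close>)
qed

lemma square_integrable_mult_left:
  fixes f :: "'a \<Rightarrow> 'b::{banach, second_countable_topology, real_normed_div_algebra}"
  assumes "square_integrable M f"
  shows "square_integrable M (\<lambda>x. c * f x)"
  using assms by (auto simp: square_integrable_def norm_mult power_mult_distrib)

lemma square_integrable_sum:
  assumes "\<And>i. i \<in> I \<Longrightarrow> square_integrable M (f i)"
  shows "square_integrable M (\<lambda>x. \<Sum>i\<in>I. f i x)"
  using assms
proof (induction I rule: infinite_finite_induct)
  case (insert x F)
  then show ?case by (simp add: square_integrable_add)
qed (auto simp: square_integrable_def)

lemma (in finite_measure) square_integrable_const: "square_integrable M (\<lambda>_. c)"
  by (auto simp: square_integrable_def)

lemma integrable_mult_square_integrable: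
  fixes f g :: "'a \<Rightarrow> real"
  assumes "square_integrable M f" "square_integrable M g"
  shows "integrable M (\<lambda>x. f x * g x)"
proof (rule Bochner_Integration.integrable_bound[of M "\<lambda>x. (f x)\<^sup>2 + (g x)\<^sup>2"])
  have "\<bar>a * b\<bar> \<le> a\<^sup>2 + b\<^sup>2" for a b :: real
  proof -
    have "2 * (\<bar>a\<bar> * \<bar>b\<bar>) \<le> a\<^sup>2 + b\<^sup>2"
      using sum_squares_bound[of "\<bar>a\<bar>" "\<bar>b\<bar>"] by simp
    moreover have "0 \<le> \<bar>a\<bar> * \<bar>b\<bar>" by simp
    ultimately show ?thesis unfolding abs_mult by linarith
  qed
  then show "AE x in M. norm (f x * g x) \<le> norm ((f x)\<^sup>2 + (g x)\<^sup>2)" by auto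
qed (use assms in \<open>auto simp: square_integrable_def\<close>)

lemma (in finite_measure) integrable_square_integrable:
  fixes f :: "'a \<Rightarrow> real"
  assumes "square_integrable M f"
  shows "integrable M f"
proof (rule square_integrable_imp_integrable)
  show "f \<in> borel_measurable M" "integrable M (\<lambda>x. (f x)\<^sup>2)"
    using assms by (simp_all add: square_integrable_def)
qed

text \<open>In the induction for \<open>variance_quadratic_form\<close> every mixed term is a
  function of the variables indexed by \<open>F\<close> times a function of the one new variable.
  The first factor is written as \<open>G\<close> of the restricted family so that independence of
  the two blocks applies; the term vanishes as soon as either factor is centred.\<close>

lemma (in prob_space) expectation_mult_indep:
  fixes Z :: "'i \<Rightarrow> 'a \<Rightarrow> real"
  assumes indep: "indep_vars (\<lambda>_. borel) Z UNIV" and "x \<notin> F"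
    and G: "G \<in> borel_measurable (PiM F (\<lambda>_. borel))"
    and h: "h \<in> borel_measurable borel"
    and "integrable M (\<lambda>\<omega>. G (restrict (\<lambda>i. Z i \<omega>) F))" "integrable M (\<lambda>\<omega>. h (Z x \<omega>))"
  shows "expectation (\<lambda>\<omega>. G (restrict (\<lambda>i. Z i \<omega>) F) * h (Z x \<omega>) :: real) =
      expectation (\<lambda>\<omega>. G (restrict (\<lambda>i. Z i \<omega>) F)) * expectation (\<lambda>\<omega>. h (Z x \<omega>))"
    and "integrable M (\<lambda>\<omega>. G (restrict (\<lambda>i. Z i \<omega>) F) * h (Z x \<omega>) :: real)"
proof -
  have "indep_var (PiM F (\<lambda>_. borel)) (\<lambda>\<omega>. restrict (\<lambda>i. Z i \<omega>) F)
      (PiM {x} (\<lambda>_. borel)) (\<lambda>\<omega>. restrict (\<lambda>i. Z i \<omega>) {x})"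
    using assms by (intro indep_var_restrict[OF indep]) auto
  moreover have "(\<lambda>z. h (z x)) \<in> borel_measurable (PiM {x} (\<lambda>_. borel))"
    using h by measurable
  ultimately have "indep_var borel (G \<circ> (\<lambda>\<omega>. restrict (\<lambda>i. Z i \<omega>) F))
      borel ((\<lambda>z. h (z x)) \<circ> (\<lambda>\<omega>. restrict (\<lambda>i. Z i \<omega>) {x}))"
    using G by (intro indep_var_compose) auto
  then have iv: "indep_var borel (\<lambda>\<omega>. G (restrict (\<lambda>i. Z i \<omega>) F)) borel (\<lambda>\<omega>. h (Z x \<omega>))"
    by (simp add: o_def)
  show "expectation (\<lambda>\<omega>. G (restrict (\<lambda>i. Z i \<omega>) F) * h (Z x \<omega>)) =
      expectation (\<lambda>\<omega>. G (restrict (\<lambda>i. Z i \<omega>) F)) * expectation (\<lambda>\<omega>. h (Z x \<omega>))"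
    by (rule indep_var_lebesgue_integral[OF iv]) (use assms in auto)
  show "integrable M (\<lambda>\<omega>. G (restrict (\<lambda>i. Z i \<omega>) F) * h (Z x \<omega>))"
    by (rule indep_var_integrable[OF iv]) (use assms in auto)
qed

locale standardized_noise = prob_space M for M :: "'a measure" +
  fixes Z :: "'i \<Rightarrow> 'a \<Rightarrow> real" and m4 :: real
  assumes indep: "indep_vars (\<lambda>_. borel) Z UNIV"
    and mean: "expectation (Z i) = 0"
    and variance1: "expectation (\<lambda>\<omega>. (Z i \<omega>)\<^sup>2) = 1"
    and integrable4: "integrable M (\<lambda>\<omega>. Z i \<omega> ^ 4)"
    and moment4: "expectation (\<lambda>\<omega>. Z i \<omega> ^ 4) = m4"
begin

lemma measurable_noise [measurable]: "Z i \<in> borel_measurable M"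
  using indep by (auto simp: indep_vars_def)

lemma square_integrable_noise_mult: "square_integrable M (\<lambda>\<omega>. Z s \<omega> * Z t \<omega>)"
  unfolding square_integrable_def
proof
  show "integrable M (\<lambda>\<omega>. (norm (Z s \<omega> * Z t \<omega>))\<^sup>2)"
  proof (rule Bochner_Integration.integrable_bound[of M "\<lambda>\<omega>. Z s \<omega> ^ 4 + Z t \<omega> ^ 4"])
    have "(a * b)\<^sup>2 \<le> a ^ 4 + b ^ 4" for a b :: real
    proof -
      have "2 * (a\<^sup>2 * b\<^sup>2) \<le> (a\<^sup>2)\<^sup>2 + (b\<^sup>2)\<^sup>2"
        using sum_squares_bound[of "a\<^sup>2" "b\<^sup>2"] by simp
      moreover have "0 \<le> a\<^sup>2 * b\<^sup>2" by simp
      moreover have "(a\<^sup>2)\<^sup>2 = a ^ 4" "(b\<^sup>2)\<^sup>2 = b ^ 4" by (simp_all flip: power_mult)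
      ultimately show ?thesis unfolding power_mult_distrib by linarith
    qed
    then show "AE \<omega> in M. norm ((norm (Z s \<omega> * Z t \<omega>))\<^sup>2) \<le> norm (Z s \<omega> ^ 4 + Z t \<omega> ^ 4)"
      by (auto intro: order_trans)
  qed (use integrable4 in auto)
qed auto

lemma square_integrable_noise: "square_integrable M (Z s)"
  using integrable_square_integrable[OF square_integrable_noise_mult[of s s]]
  by (auto simp: square_integrable_def power2_eq_square)

lemma integrable_noise: "integrable M (Z s)"
  by (rule integrable_square_integrable[OF square_integrable_noise])

lemma m4_nonneg: "0 \<le> m4"
  unfolding moment4[of undefined, symmetric] by (intro integral_nonneg_AE) auto

lemma expectation_noise_mult: "expectation (\<lambda>\<omega>. Z s \<omega> * Z t \<omega>) = (if s = t then 1 else 0)"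
proof (cases "s = t")
  case True
  then show ?thesis using variance1[of t] by (simp add: power2_eq_square)
next
  case False
  have "expectation (\<lambda>\<omega>. (\<lambda>z. z s) (restrict (\<lambda>i. Z i \<omega>) {s}) * id (Z t \<omega>)) =
    expectation (\<lambda>\<omega>. (\<lambda>z. z s) (restrict (\<lambda>i. Z i \<omega>) {s})) * expectation (\<lambda>\<omega>. id (Z t \<omega>))"
    by (rule expectation_mult_indep[OF indep]) (use False integrable_noise in auto)
  then show ?thesis using False by (simp add: mean)
qed

lemma square_integrable_linear_form: "square_integrable M (\<lambda>\<omega>. \<Sum>s\<in>F. c s * Z s \<omega>)"
  by (intro square_integrable_sum square_integrable_mult_left square_integrable_noise)

lemma square_integrable_quadratic_form:
  "square_integrable M (\<lambda>\<omega>. \<Sum>s\<in>F. \<Sum>t\<in>F. c s t * (Z s \<omega> * Z t \<omega>))"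
  by (intro square_integrable_sum square_integrable_mult_left square_integrable_noise_mult)

lemma expectation_linear_form_square:
  assumes "finite F"
  shows "expectation (\<lambda>\<omega>. (\<Sum>s\<in>F. c s * Z s \<omega>)\<^sup>2) = (\<Sum>s\<in>F. (c s)\<^sup>2)"
proof -
  have "expectation (\<lambda>\<omega>. (\<Sum>s\<in>F. c s * Z s \<omega>)\<^sup>2) =
      expectation (\<lambda>\<omega>. \<Sum>s\<in>F. \<Sum>t\<in>F. (c s * c t) * (Z s \<omega> * Z t \<omega>))"
    by (simp add: power2_eq_square sum_product mult_ac)
  also have "\<dots> = (\<Sum>s\<in>F. \<Sum>t\<in>F. (c s * c t) * expectation (\<lambda>\<omega>. Z s \<omega> * Z t \<omega>))"
    using integrable_square_integrable[OF square_integrable_noise_mult]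
    by (simp add: Bochner_Integration.integral_sum)
  also have "\<dots> = (\<Sum>s\<in>F. (c s)\<^sup>2)"
    using assms by (simp add: expectation_noise_mult power2_eq_square if_distrib[of "\<lambda>x. _ * x"] sum.delta
      cong: if_cong)
  finally show ?thesis .
qed

lemma expectation_quadratic_form:
  assumes "finite F"
  shows "expectation (\<lambda>\<omega>. \<Sum>s\<in>F. \<Sum>t\<in>F. c s t * (Z s \<omega> * Z t \<omega>)) = (\<Sum>s\<in>F. c s s)"
proof -
  have "expectation (\<lambda>\<omega>. \<Sum>s\<in>F. \<Sum>t\<in>F. c s t * (Z s \<omega> * Z t \<omega>)) =
     (\<Sum>s\<in>F. \<Sum>t\<in>F. c s t * expectation (\<lambda>\<omega>. Z s \<omega> * Z t \<omega>))"
    using integrable_square_integrable[OF square_integrable_noise_mult]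
    by (simp add: Bochner_Integration.integral_sum)
  also have "\<dots> = (\<Sum>s\<in>F. c s s)"
    using assms by (simp add: expectation_noise_mult if_distrib[of "\<lambda>x. _ * x"] sum.delta cong: if_cong)
  finally show ?thesis .
qed

text \<open>Induction on \<open>F\<close>. A new index \<open>x\<close> adds
  \<open>2 * (L * Z x) + c x x * ((Z x)\<^sup>2 - 1)\<close>, which is orthogonal to the old centred
  form and whose two parts are orthogonal to each other, so second moments simply add. The new
  off-diagonal entries cost 4 for each symmetric pair of squares, the new diagonal entry costs
  \<open>m4 - 1\<close>; the constant \<open>m4 + 2\<close> covers both, since
  \<open>4 \<le> 2 * (m4 + 2)\<close>.\<close>

lemma variance_quadratic_form:
  assumes "finite F" and sym: "\<And>s t. c s t = c t s"
  shows "expectation (\<lambda>\<omega>. ((\<Sum>s\<in>F. \<Sum>t\<in>F. c s t * (Z s \<omega> * Z t \<omega>)) - (\<Sum>s\<in>F. c s s))\<^sup>2)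
    \<le> (m4 + 2) * (\<Sum>s\<in>F. \<Sum>t\<in>F. (c s t)\<^sup>2)"
  using assms(1)
proof (induction F)
  case empty
  then show ?case by simp
next
  case (insert x F)
  define Y where "Y \<omega> = (\<Sum>s\<in>F. \<Sum>t\<in>F. c s t * (Z s \<omega> * Z t \<omega>)) - (\<Sum>s\<in>F. c s s)" for \<omega>
  define L where "L \<omega> = (\<Sum>s\<in>F. c s x * Z s \<omega>)" for \<omega>
  have Y2: "square_integrable M Y"
    unfolding Y_def diff_conv_add_uminus
    by (intro square_integrable_add square_integrable_quadratic_form square_integrable_const)
  have L2: "square_integrable M L"
    unfolding L_def by (rule square_integrable_linear_form)
  have Zx2: "square_integrable M (\<lambda>\<omega>. (Z x \<omega>)\<^sup>2 - 1)"
    using square_integrable_add[OF square_integrable_noise_mult[of x x] square_integrable_const[of "-1"]]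
    by (simp add: power2_eq_square)
  define GY where "GY z = (\<Sum>s\<in>F. \<Sum>t\<in>F. c s t * (z s * z t)) - (\<Sum>s\<in>F. c s s)" for z :: "'i \<Rightarrow> real"
  define GL where "GL z = (\<Sum>s\<in>F. c s x * z s)" for z :: "'i \<Rightarrow> real"
  have [measurable]: "GY \<in> borel_measurable (PiM F (\<lambda>_. borel))" "GL \<in> borel_measurable (PiM F (\<lambda>_. borel))"
    unfolding GY_def GL_def by measurable
  have GY: "GY (restrict (\<lambda>i. Z i \<omega>) F) = Y \<omega>" and GL: "GL (restrict (\<lambda>i. Z i \<omega>) F) = L \<omega>" for \<omega>
    by (auto simp: GY_def GL_def Y_def L_def)
  note ind = expectation_mult_indep[OF indep insert.hyps(2)]
  have iY: "integrable M Y" and iL: "integrable M L"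
    using Y2 L2 by (auto intro: integrable_square_integrable)
  have EY: "expectation Y = 0"
    using integrable_square_integrable[OF square_integrable_quadratic_form[where F=F and c=c]]
      expectation_quadratic_form[OF \<open>finite F\<close>, of c]
    unfolding Y_def by (simp add: prob_space)
  have EL: "expectation L = 0"
    unfolding L_def using integrable_noise by (simp add: mean)
  have i3: "integrable M (\<lambda>\<omega>. Z x \<omega> * ((Z x \<omega>)\<^sup>2 - 1))"
    by (rule integrable_mult_square_integrable[OF square_integrable_noise Zx2])
  have iYL: "integrable M (\<lambda>\<omega>. Y \<omega> * L \<omega>)"
    by (rule integrable_mult_square_integrable[OF Y2 L2])
  have iL2: "integrable M (\<lambda>\<omega>. (L \<omega>)\<^sup>2)" and iZ2: "integrable M (\<lambda>\<omega>. (Z x \<omega>)\<^sup>2)"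
     and iY2: "integrable M (\<lambda>\<omega>. (Y \<omega>)\<^sup>2)" and iZx2: "integrable M (\<lambda>\<omega>. ((Z x \<omega>)\<^sup>2 - 1)\<^sup>2)"
    using L2 square_integrable_noise[of x] Y2 Zx2 by (auto simp: square_integrable_def)
  have e1: "expectation (\<lambda>\<omega>. (Y \<omega> * L \<omega>) * Z x \<omega>) = 0" "integrable M (\<lambda>\<omega>. (Y \<omega> * L \<omega>) * Z x \<omega>)"
    using ind[of "\<lambda>z. GY z * GL z" id] iYL integrable_noise[of x] by (auto simp: GY GL mean)
  have e2: "expectation (\<lambda>\<omega>. Y \<omega> * ((Z x \<omega>)\<^sup>2 - 1)) = 0" "integrable M (\<lambda>\<omega>. Y \<omega> * ((Z x \<omega>)\<^sup>2 - 1))"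
    using ind[of GY "\<lambda>z. z\<^sup>2 - 1"] iY integrable_square_integrable[OF Zx2] by (auto simp: GY EY)
  \<comment> \<open>The third moment of \<open>Z x\<close> enters only here, where it is multiplied
    by \<open>expectation L = 0\<close>.\<close>
  have e3: "expectation (\<lambda>\<omega>. L \<omega> * (Z x \<omega> * ((Z x \<omega>)\<^sup>2 - 1))) = 0"
      "integrable M (\<lambda>\<omega>. L \<omega> * (Z x \<omega> * ((Z x \<omega>)\<^sup>2 - 1)))"
    using ind[of GL "\<lambda>z. z * (z\<^sup>2 - 1)"] iL i3 by (auto simp: GL EL)
  have e4: "expectation (\<lambda>\<omega>. (L \<omega>)\<^sup>2 * (Z x \<omega>)\<^sup>2) = (\<Sum>s\<in>F. (c s x)\<^sup>2)"
      "integrable M (\<lambda>\<omega>. (L \<omega>)\<^sup>2 * (Z x \<omega>)\<^sup>2)"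
    using ind[of "\<lambda>z. (GL z)\<^sup>2" "\<lambda>z. z\<^sup>2"] iL2 iZ2 expectation_linear_form_square[OF \<open>finite F\<close>, of "\<lambda>s. c s x"]
    by (auto simp: GL variance1 L_def)
  have e5: "expectation (\<lambda>\<omega>. ((Z x \<omega>)\<^sup>2 - 1)\<^sup>2) = m4 - 1"
  proof -
    have "expectation (\<lambda>\<omega>. ((Z x \<omega>)\<^sup>2 - 1)\<^sup>2) = expectation (\<lambda>\<omega>. Z x \<omega> ^ 4 - 2 * (Z x \<omega>)\<^sup>2 + 1)"
      by (intro Bochner_Integration.integral_cong refl) (simp add: power2_diff flip: power_mult)
    also have "\<dots> = m4 - 1"
      using integrable4[of x] iZ2 moment4[of x] variance1[of x] by (simp add: prob_space)
    finally show ?thesis .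
  qed
  have split: "(\<Sum>s\<in>insert x F. \<Sum>t\<in>insert x F. c s t * (Z s \<omega> * Z t \<omega>)) - (\<Sum>s\<in>insert x F. c s s)
      = Y \<omega> + 2 * (L \<omega> * Z x \<omega>) + c x x * ((Z x \<omega>)\<^sup>2 - 1)" for \<omega>
  proof -
    have "(\<Sum>s\<in>F. c s x * (Z s \<omega> * Z x \<omega>)) = L \<omega> * Z x \<omega>"
      by (simp add: L_def sum_distrib_right mult.assoc)
    moreover have "(\<Sum>t\<in>F. c x t * (Z x \<omega> * Z t \<omega>)) = (\<Sum>s\<in>F. c s x * (Z s \<omega> * Z x \<omega>))"
      by (intro sum.cong refl) (simp add: sym[of x] mult_ac)
    ultimately show ?thesis
      using insert.hyps by (simp add: Y_def sum.distrib algebra_simps power2_eq_square)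
  qed
  have "expectation (\<lambda>\<omega>. ((\<Sum>s\<in>insert x F. \<Sum>t\<in>insert x F. c s t * (Z s \<omega> * Z t \<omega>)) - (\<Sum>s\<in>insert x F. c s s))\<^sup>2)
    = expectation (\<lambda>\<omega>. (Y \<omega>)\<^sup>2 + 4 * ((L \<omega>)\<^sup>2 * (Z x \<omega>)\<^sup>2) + (c x x)\<^sup>2 * ((Z x \<omega>)\<^sup>2 - 1)\<^sup>2
       + 4 * ((Y \<omega> * L \<omega>) * Z x \<omega>) + (2 * c x x) * (Y \<omega> * ((Z x \<omega>)\<^sup>2 - 1))
       + (4 * c x x) * (L \<omega> * (Z x \<omega> * ((Z x \<omega>)\<^sup>2 - 1))))"
    unfolding split by (intro Bochner_Integration.integral_cong refl) (simp add: power2_eq_square algebra_simps)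
  also have "\<dots> = expectation (\<lambda>\<omega>. (Y \<omega>)\<^sup>2) + 4 * (\<Sum>s\<in>F. (c s x)\<^sup>2) + (c x x)\<^sup>2 * (m4 - 1)"
    using e1 e2 e3 e4 e5 iY2 iZx2 by simp
  also have "\<dots> \<le> (m4 + 2) * (\<Sum>s\<in>F. \<Sum>t\<in>F. (c s t)\<^sup>2) + 4 * (\<Sum>s\<in>F. (c s x)\<^sup>2) + (c x x)\<^sup>2 * (m4 - 1)"
    using insert.IH unfolding Y_def by simp
  also have "\<dots> \<le> (m4 + 2) * (\<Sum>s\<in>F. \<Sum>t\<in>F. (c s t)\<^sup>2) + (m4 + 2) * (2 * (\<Sum>s\<in>F. (c s x)\<^sup>2)) + (m4 + 2) * (c x x)\<^sup>2"
  proof -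
    have "4 * (\<Sum>s\<in>F. (c s x)\<^sup>2) \<le> (m4 + 2) * (2 * (\<Sum>s\<in>F. (c s x)\<^sup>2))"
      using mult_right_mono[of 2 "m4 + 2" "2 * (\<Sum>s\<in>F. (c s x)\<^sup>2)"] m4_nonneg by (simp add: sum_nonneg)
    moreover have "(c x x)\<^sup>2 * (m4 - 1) \<le> (m4 + 2) * (c x x)\<^sup>2"
      by (simp add: algebra_simps)
    ultimately show ?thesis by linarith
  qed
  also have "\<dots> = (m4 + 2) * (\<Sum>s\<in>insert x F. \<Sum>t\<in>insert x F. (c s t)\<^sup>2)"
  proof -
    have "(\<Sum>t\<in>F. (c x t)\<^sup>2) = (\<Sum>s\<in>F. (c s x)\<^sup>2)"
      by (intro sum.cong refl) (simp add: sym[of x])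
    then show ?thesis
      using insert.hyps by (simp add: sum.distrib algebra_simps)
  qed
  finally show ?case .
qed

end


section \<open>Mean-square limits\<close>

text \<open>Young's inequality for the mixed term \<open>2 * r * s\<close>. The free parameter
  \<open>e\<close> leaves an arbitrarily small multiple of the fixed
  \<open>(norm y)\<^sup>2\<close>, while the large factor falls on the difference, which tends to 0
  in the application.\<close>

lemma abs_norm_power2_diff_le:
  fixes x y :: "'b::real_normed_vector"
  assumes "0 < e"
  shows "\<bar>(norm x)\<^sup>2 - (norm y)\<^sup>2\<bar> \<le> (1 + 1 / e) * (norm (x - y))\<^sup>2 + e * (norm y)\<^sup>2"
proof -
  have d: "norm x \<le> norm (x - y) + norm y" "norm y \<le> norm (x - y) + norm x"
    using norm_triangle_ineq[of "x - y" y] norm_triangle_ineq[of "y - x" x] by (auto simp: norm_minus_commute)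
  define r s where "r = norm (x - y)" and "s = norm y"
  have "2 * r * s \<le> (1 / e) * r\<^sup>2 + e * s\<^sup>2"
  proof -
    have "0 \<le> (r / sqrt e - sqrt e * s)\<^sup>2" by simp
    also have "\<dots> = (1 / e) * r\<^sup>2 + e * s\<^sup>2 - 2 * r * s"
      using assms by (simp add: power2_diff power_divide power_mult_distrib)
    finally show ?thesis by simp
  qed
  moreover have "(norm x)\<^sup>2 \<le> (r + s)\<^sup>2" unfolding r_def s_def by (intro power_mono d) auto
  \<comment> \<open>The reverse triangle inequality can be squared only for
    \<open>r \<le> s\<close>; otherwise \<open>s * s \<le> r * s\<close> already suffices.\<close>
  moreover have "s\<^sup>2 - (norm x)\<^sup>2 \<le> r\<^sup>2 + 2 * r * s"
  proof (cases "r \<le> s")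
    case True
    have "(s - r)\<^sup>2 \<le> (norm x)\<^sup>2"
      using True d by (intro power_mono) (auto simp: r_def s_def)
    then have "s\<^sup>2 + r\<^sup>2 - 2 * r * s \<le> (norm x)\<^sup>2" by (simp add: power2_diff mult_ac)
    moreover have "0 \<le> r\<^sup>2" by simp
    ultimately show ?thesis by linarith
  next
    case False
    then have "s * s \<le> r * s" by (intro mult_right_mono) (auto simp: s_def)
    moreover have "0 \<le> (norm x)\<^sup>2" "0 \<le> r\<^sup>2" "0 \<le> r * s" by (auto simp: r_def s_def)
    ultimately show ?thesis unfolding power2_eq_square by linarith
  qed
  ultimately show ?thesis
    by (simp add: power2_sum algebra_simps r_def s_def abs_le_iff)
qed

text \<open>Nonnegative integrals tending to 0 are eventually finite, and one finite term makes the
  limit square integrable. From then on Bochner integrals can replace the nonnegative ones.\<close>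

lemma tendsto_L2_square_integrable_diff:
  assumes "tendsto_L2 M F f" "\<And>N. square_integrable M (F N)"
  shows "square_integrable M f" "square_integrable M (\<lambda>x. F N x - f x)"
    "(\<lambda>N. LINT x|M. (norm (F N x - f x))\<^sup>2) \<longlonglongrightarrow> 0"
proof -
  have [measurable]: "F N \<in> borel_measurable M" "f \<in> borel_measurable M" for N
    using assms(1) by (auto simp: tendsto_L2_def)
  have lim: "(\<lambda>N. \<integral>\<^sup>+ x. ennreal ((norm (F N x - f x))\<^sup>2) \<partial>M) \<longlonglongrightarrow> 0"
    using assms(1) by (auto simp: tendsto_L2_def)
  then have "eventually (\<lambda>N. (\<integral>\<^sup>+ x. ennreal ((norm (F N x - f x))\<^sup>2) \<partial>M) < 1) sequentially"
    by (rule order_tendstoD) auto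
  then obtain N0 where "(\<integral>\<^sup>+ x. ennreal ((norm (F N0 x - f x))\<^sup>2) \<partial>M) < 1"
    by (auto simp: eventually_sequentially)
  then have "integrable M (\<lambda>x. (norm (F N0 x - f x))\<^sup>2)"
    by (intro integrableI_bounded) (auto intro: less_trans[OF _ ennreal_less_top[of 1]] simp: top.not_eq_extremum)
  then have D0: "square_integrable M (\<lambda>x. F N0 x - f x)"
    by (auto simp: square_integrable_def)
  have neg: "square_integrable M (\<lambda>x. - h x)" if "square_integrable M h" for h :: "'a \<Rightarrow> 'b"
    using that by (auto simp: square_integrable_def)
  show f: "square_integrable M f"
    using square_integrable_add[OF assms(2)[of N0] neg[OF D0]] by simp
  show D: "square_integrable M (\<lambda>x. F N x - f x)" for N
    using square_integrable_add[OF assms(2)[of N] neg[OF f]] by simp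
  have "(\<integral>\<^sup>+ x. ennreal ((norm (F N x - f x))\<^sup>2) \<partial>M) = ennreal (LINT x|M. (norm (F N x - f x))\<^sup>2)" for N
    using D[of N] by (intro nn_integral_eq_integral) (auto simp: square_integrable_def)
  then have "(\<lambda>N. ennreal (LINT x|M. (norm (F N x - f x))\<^sup>2)) \<longlonglongrightarrow> ennreal 0"
    using lim by simp
  then show "(\<lambda>N. LINT x|M. (norm (F N x - f x))\<^sup>2) \<longlonglongrightarrow> 0"
    by (subst (asm) tendsto_ennreal_iff) auto
qed

lemma tendsto_L2_norm_power2:
  assumes "tendsto_L2 M F f" "\<And>N. square_integrable M (F N)"
  shows "(\<lambda>N. LINT x|M. \<bar>(norm (F N x))\<^sup>2 - (norm (f x))\<^sup>2\<bar>) \<longlonglongrightarrow> 0"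
proof -
  note lim = tendsto_L2_square_integrable_diff[OF assms]
  define D where "D N = (LINT x|M. (norm (F N x - f x))\<^sup>2)" for N
  define K where "K = (LINT x|M. (norm (f x))\<^sup>2)"
  have K: "0 \<le> K" unfolding K_def by simp
  have bound: "(LINT x|M. \<bar>(norm (F N x))\<^sup>2 - (norm (f x))\<^sup>2\<bar>) \<le> (1 + 1 / e) * D N + e * K" if "0 < e" for N e
  proof -
    have "(LINT x|M. \<bar>(norm (F N x))\<^sup>2 - (norm (f x))\<^sup>2\<bar>) \<le>
      (LINT x|M. (1 + 1 / e) * (norm (F N x - f x))\<^sup>2 + e * (norm (f x))\<^sup>2)"
      using lim(1) lim(2)[of N] assms(2)[of N] abs_norm_power2_diff_le[OF that]
      by (intro integral_mono) (auto simp: square_integrable_def)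
    also have "\<dots> = (1 + 1 / e) * D N + e * K"
      unfolding D_def K_def using lim(1) lim(2)[of N] by (auto simp: square_integrable_def)
    finally show ?thesis .
  qed
  show ?thesis
  proof (rule LIMSEQ_I)
    fix r :: real assume r: "0 < r"
    \<comment> \<open>The parameter is fixed first, so that the contribution of the limit stays
      below \<open>r / 2\<close>; only then is \<open>N\<close> chosen. The denominator has
      \<open>K + 1\<close> because \<open>K\<close> may be 0.\<close>
    define e where "e = r / (2 * (K + 1))"
    have e: "0 < e" "e * K < r / 2"
      using r K by (auto simp: e_def field_simps)
    have "(\<lambda>N. (1 + 1 / e) * D N) \<longlonglongrightarrow> (1 + 1 / e) * 0"
      using lim(3) unfolding D_def by (intro tendsto_intros)
    then have "eventually (\<lambda>N. (1 + 1 / e) * D N < r / 2) sequentially"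
      by (rule order_tendstoD) (use r in auto)
    then obtain N0 where "\<And>N. N \<ge> N0 \<Longrightarrow> (1 + 1 / e) * D N < r / 2"
      by (auto simp: eventually_sequentially)
    then have "(LINT x|M. \<bar>(norm (F N x))\<^sup>2 - (norm (f x))\<^sup>2\<bar>) < r" if "N \<ge> N0" for N
      using bound[OF e(1), of N] e(2) that by (smt (verit) field_sum_of_halves)
    then have "norm ((LINT x|M. \<bar>(norm (F N x))\<^sup>2 - (norm (f x))\<^sup>2\<bar>) - 0) < r" if "N \<ge> N0" for N
      using that by simp
    then show "\<exists>no. \<forall>N\<ge>no. norm ((LINT x|M. \<bar>(norm (F N x))\<^sup>2 - (norm (f x))\<^sup>2\<bar>) - 0) < r"
      by blast
  qed
qed

lemma tendsto_integral_L1: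
  fixes u :: "nat \<Rightarrow> 'a \<Rightarrow> real"
  assumes "\<And>N. integrable M (u N)" "integrable M f" "(\<lambda>N. LINT x|M. \<bar>u N x - f x\<bar>) \<longlonglongrightarrow> 0"
  shows "(\<lambda>N. LINT x|M. u N x) \<longlonglongrightarrow> (LINT x|M. f x)"
proof (rule Lim_null[THEN iffD2], rule Lim_null_comparison[OF _ assms(3)], rule always_eventually, rule allI)
  fix N
  have "norm ((LINT x|M. u N x) - (LINT x|M. f x)) = norm (LINT x|M. u N x - f x)"
    using assms by simp
  also have "\<dots> \<le> (LINT x|M. norm (u N x - f x))"
    by (rule integral_norm_bound)
  finally show "norm ((LINT x|M. u N x) - (LINT x|M. f x)) \<le> (LINT x|M. \<bar>u N x - f x\<bar>)" by simp
qed

lemma tendsto_L2_add: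
  assumes "tendsto_L2 M F f" "tendsto_L2 M G g"
  shows "tendsto_L2 M (\<lambda>N x. F N x + G N x) (\<lambda>x. f x + g x :: 'b::{banach, second_countable_topology})"
  unfolding tendsto_L2_def
proof (intro conjI allI)
  have [measurable]: "F N \<in> borel_measurable M" "f \<in> borel_measurable M"
    "G N \<in> borel_measurable M" "g \<in> borel_measurable M" for N
    using assms by (auto simp: tendsto_L2_def)
  show "(\<lambda>x. F N x + G N x) \<in> borel_measurable M" "(\<lambda>x. f x + g x) \<in> borel_measurable M" for N
    by measurable
  have "(\<lambda>N. 2 * (\<integral>\<^sup>+ x. ennreal ((norm (F N x - f x))\<^sup>2) \<partial>M) + 2 * (\<integral>\<^sup>+ x. ennreal ((norm (G N x - g x))\<^sup>2) \<partial>M))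
      \<longlonglongrightarrow> 2 * 0 + 2 * 0"
    using assms by (intro tendsto_add ennreal_tendsto_cmult) (auto simp: tendsto_L2_def)
  then have *: "(\<lambda>N. 2 * (\<integral>\<^sup>+ x. ennreal ((norm (F N x - f x))\<^sup>2) \<partial>M) + 2 * (\<integral>\<^sup>+ x. ennreal ((norm (G N x - g x))\<^sup>2) \<partial>M))
      \<longlonglongrightarrow> 0" by simp
  show "(\<lambda>N. \<integral>\<^sup>+ x. ennreal ((norm (F N x + G N x - (f x + g x)))\<^sup>2) \<partial>M) \<longlonglongrightarrow> 0"
  proof (rule tendsto_sandwich[OF _ _ tendsto_const *]; intro always_eventually allI)
    fix N
    have "(\<integral>\<^sup>+ x. ennreal ((norm (F N x + G N x - (f x + g x)))\<^sup>2) \<partial>M) \<le>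
      (\<integral>\<^sup>+ x. 2 * ennreal ((norm (F N x - f x))\<^sup>2) + 2 * ennreal ((norm (G N x - g x))\<^sup>2) \<partial>M)"
    proof (rule nn_integral_mono)
      fix x
      have "(norm (F N x + G N x - (f x + g x)))\<^sup>2 \<le> 2 * (norm (F N x - f x))\<^sup>2 + 2 * (norm (G N x - g x))\<^sup>2"
        using norm_add_power2_le[of "F N x - f x" "G N x - g x"] by (simp add: algebra_simps)
      then have "ennreal ((norm (F N x + G N x - (f x + g x)))\<^sup>2) \<le> ennreal (2 * (norm (F N x - f x))\<^sup>2 + 2 * (norm (G N x - g x))\<^sup>2)"
        by (rule ennreal_leI)
      also have "\<dots> = 2 * ennreal ((norm (F N x - f x))\<^sup>2) + 2 * ennreal ((norm (G N x - g x))\<^sup>2)"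
        by (simp add: ennreal_mult)
      finally show "ennreal ((norm (F N x + G N x - (f x + g x)))\<^sup>2) \<le> \<dots>" .
    qed
    then show "(\<integral>\<^sup>+ x. ennreal ((norm (F N x + G N x - (f x + g x)))\<^sup>2) \<partial>M) \<le>
       2 * (\<integral>\<^sup>+ x. ennreal ((norm (F N x - f x))\<^sup>2) \<partial>M) + 2 * (\<integral>\<^sup>+ x. ennreal ((norm (G N x - g x))\<^sup>2) \<partial>M)"
      by (simp add: nn_integral_add nn_integral_cmult)
  qed simp
qed

lemma tendsto_L2_mult_of_real:
  fixes c :: complex and f :: "'a \<Rightarrow> real"
  assumes "tendsto_L2 M F f"
  shows "tendsto_L2 M (\<lambda>N x. c * of_real (F N x)) (\<lambda>x. c * of_real (f x))"
  unfolding tendsto_L2_def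
proof (intro conjI allI)
  have [measurable]: "F N \<in> borel_measurable M" "f \<in> borel_measurable M" for N
    using assms by (auto simp: tendsto_L2_def)
  show "(\<lambda>x. c * of_real (F N x)) \<in> borel_measurable M" "(\<lambda>x. c * of_real (f x)) \<in> borel_measurable M" for N
    by measurable
  have "(\<lambda>N. ennreal ((cmod c)\<^sup>2) * (\<integral>\<^sup>+ x. ennreal ((norm (F N x - f x))\<^sup>2) \<partial>M)) \<longlonglongrightarrow> ennreal ((cmod c)\<^sup>2) * 0"
    using assms by (intro ennreal_tendsto_cmult) (auto simp: tendsto_L2_def)
  moreover have "(\<integral>\<^sup>+ x. ennreal ((norm (c * of_real (F N x) - c * of_real (f x)))\<^sup>2) \<partial>M) =
      ennreal ((cmod c)\<^sup>2) * (\<integral>\<^sup>+ x. ennreal ((norm (F N x - f x))\<^sup>2) \<partial>M)" for N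
  proof -
    have "ennreal ((norm (c * of_real (F N x) - c * of_real (f x)))\<^sup>2) =
        ennreal ((cmod c)\<^sup>2) * ennreal ((norm (F N x - f x))\<^sup>2)" for x
      by (simp add: norm_mult power_mult_distrib ennreal_mult flip: right_diff_distrib of_real_diff)
    then show ?thesis by (simp add: nn_integral_cmult)
  qed
  ultimately show "(\<lambda>N. \<integral>\<^sup>+ x. ennreal ((norm (c * of_real (F N x) - c * of_real (f x)))\<^sup>2) \<partial>M) \<longlonglongrightarrow> 0"
    by simp
qed

lemma tendsto_L2_sum:
  assumes "\<And>i. i \<in> I \<Longrightarrow> tendsto_L2 M (F i) (f i :: 'a \<Rightarrow> 'b::{banach, second_countable_topology})"
  shows "tendsto_L2 M (\<lambda>N x. \<Sum>i\<in>I. F i N x) (\<lambda>x. \<Sum>i\<in>I. f i x)"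
  using assms
proof (induction I rule: infinite_finite_induct)
  case (insert x F)
  then show ?case by (simp add: tendsto_L2_add)
qed (auto simp: tendsto_L2_def)

text \<open>Fatou along an almost surely convergent subsequence.\<close>

lemma L1_limit_second_moment:
  fixes Y :: "nat \<Rightarrow> 'a \<Rightarrow> real"
  assumes Y: "\<And>N. integrable M (Y N)" "integrable M y"
    and lim: "(\<lambda>N. LINT x|M. \<bar>Y N x - y x\<bar>) \<longlonglongrightarrow> 0"
    and sq: "\<And>N. integrable M (\<lambda>x. (Y N x)\<^sup>2)"
    and bound: "\<And>N. (LINT x|M. (Y N x)\<^sup>2) \<le> V N" and V: "V \<longlonglongrightarrow> v"
  shows "integrable M (\<lambda>x. (y x)\<^sup>2)" "(LINT x|M. (y x)\<^sup>2) \<le> v"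
proof -
  obtain r :: "nat \<Rightarrow> nat" where r: "strict_mono r" and ae: "AE x in M. (\<lambda>N. Y (r N) x - y x) \<longlonglongrightarrow> 0"
    using tendsto_L1_AE_subseq[of M "\<lambda>N x. Y N x - y x"] Y lim by auto
  have [measurable]: "Y N \<in> borel_measurable M" "y \<in> borel_measurable M" for N
    using Y by auto
  have "(\<integral>\<^sup>+ x. ennreal ((y x)\<^sup>2) \<partial>M) = (\<integral>\<^sup>+ x. liminf (\<lambda>N. ennreal ((Y (r N) x)\<^sup>2)) \<partial>M)"
  proof (rule nn_integral_cong_AE, use ae in eventually_elim)
    case (elim x)
    then have "(\<lambda>N. Y (r N) x) \<longlonglongrightarrow> y x" by (rule Lim_null[THEN iffD2])
    then have "(\<lambda>N. ennreal ((Y (r N) x)\<^sup>2)) \<longlonglongrightarrow> ennreal ((y x)\<^sup>2)"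
      by (intro tendsto_ennrealI tendsto_intros)
    then show ?case using lim_imp_Liminf[OF sequentially_bot] by metis
  qed
  also have "\<dots> \<le> liminf (\<lambda>N. \<integral>\<^sup>+ x. ennreal ((Y (r N) x)\<^sup>2) \<partial>M)"
    by (rule nn_integral_liminf) measurable
  also have "\<dots> \<le> liminf (\<lambda>N. ennreal (V (r N)))"
  proof (rule Liminf_mono, intro always_eventually allI)
    fix N
    show "(\<integral>\<^sup>+ x. ennreal ((Y (r N) x)\<^sup>2) \<partial>M) \<le> ennreal (V (r N))"
      using sq bound by (subst nn_integral_eq_integral) (auto intro: ennreal_leI)
  qed
  also have "\<dots> = ennreal v"
    using V r by (intro lim_imp_Liminf tendsto_ennrealI) (auto intro: LIMSEQ_subseq_LIMSEQ[unfolded o_def])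
  finally have le: "(\<integral>\<^sup>+ x. ennreal ((y x)\<^sup>2) \<partial>M) \<le> ennreal v" .
  show int: "integrable M (\<lambda>x. (y x)\<^sup>2)"
    using le by (intro integrableI_bounded) (auto intro: le_less_trans)
  have "0 \<le> (LINT x|M. (Y N x)\<^sup>2)" for N by simp
  then have "0 \<le> V N" for N using bound[of N] by (meson order_trans)
  then have "0 \<le> v" using V by (intro LIMSEQ_le_const) auto
  then show "(LINT x|M. (y x)\<^sup>2) \<le> v"
    using le int by (subst (asm) nn_integral_eq_integral) auto
qed


section \<open>Kernels of the discrete Fourier transform\<close>

abbreviation circle_measure :: "real measure"
  where "circle_measure \<equiv> lebesgue_on {-pi..pi}"

lemma integrable_circle_continuous:
  fixes f :: "real \<Rightarrow> 'b::euclidean_space"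
  assumes "continuous_on {-pi..pi} f"
  shows "integrable circle_measure f"
  using assms by (rule continuous_imp_integrable_real)

lemma finite_measure_circle: "finite_measure circle_measure"
  by (rule finite_measure_lebesgue_on) auto

lemma integral_cis:
  "(LINT u|circle_measure. cis (of_int m * u)) = (if m = 0 then 2 * pi else 0)"
proof -
  have cont: "continuous_on {-pi..pi} (\<lambda>u. cis (of_int m * u))"
    by (intro continuous_intros)
  have eq: "(LINT u|circle_measure. cis (of_int m * u)) = integral {-pi..pi} (\<lambda>u. cis (of_int m * u))"
    by (rule lebesgue_integral_eq_integral) (auto intro: integrable_circle_continuous cont)
  show ?thesis
  proof (cases "m = 0")
    case True
    then show ?thesis unfolding eq by (simp add: scaleR_conv_of_real)
  next
    case False
    define G where "G u = cis (of_int m * u) / (\<i> * of_int m)" for u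
    have "(G has_vector_derivative cis (of_int m * x)) (at x within {-pi..pi})" for x
    proof -
      have "((\<lambda>u. exp (\<i> * (of_int m * of_real u)) / (\<i> * of_int m)) has_vector_derivative
          exp (\<i> * (of_int m * of_real x))) (at x within {-pi..pi})"
        using False
        by (auto intro!: derivative_eq_intros has_vector_derivative_real_field simp: algebra_simps)
      then show ?thesis
        by (simp add: G_def[abs_def] cis_conv_exp)
    qed
    then have "((\<lambda>u. cis (of_int m * u)) has_integral (G pi - G (-pi))) {-pi..pi}"
      by (intro fundamental_theorem_of_calculus) auto
    moreover have "G pi = G (-pi)"
    proof -
      have "sin (of_int m * pi) = 0" by (simp add: sin_zero_iff_int2)
      then have "cis (of_int m * pi) = cis (- (of_int m * pi))" by (simp add: complex_eq_iff)
      then show ?thesis by (simp add: G_def)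
    qed
    ultimately show ?thesis using False unfolding eq by (simp add: integral_unique)
  qed
qed

lemma mult_cis_mult_cnj: "(x * cis a) * cnj (y * cis b) = (x * cnj y) * cis (a - b)"
proof -
  have "cis a * cnj (cis b) = cis (a - b)"
    by (simp add: cis_cnj cis_mult)
  then show ?thesis by (metis complex_cnj_mult mult.assoc mult.left_commute)
qed

lemma parseval_trig:
  fixes p q :: "int \<Rightarrow> complex"
  assumes "finite F"
  shows "(LINT u|circle_measure. (\<Sum>s\<in>F. p s * cis (of_int s * u)) * cnj (\<Sum>s\<in>F. q s * cis (of_int s * u)))
    = 2 * pi * (\<Sum>s\<in>F. p s * cnj (q s))"
proof -
  have "(LINT u|circle_measure. (\<Sum>s\<in>F. p s * cis (of_int s * u)) * cnj (\<Sum>s\<in>F. q s * cis (of_int s * u)))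
    = (LINT u|circle_measure. (\<Sum>s\<in>F. \<Sum>t\<in>F. (p s * cnj (q t)) * cis (of_int (s - t) * u)))"
    unfolding cnj_sum sum_product mult_cis_mult_cnj by (simp add: left_diff_distrib)
  also have "\<dots> = (\<Sum>s\<in>F. \<Sum>t\<in>F. (p s * cnj (q t)) * (LINT u|circle_measure. cis (of_int (s - t) * u)))"
    by (simp add: Bochner_Integration.integral_sum integrable_circle_continuous continuous_intros
        del: of_int_diff)
  also have "\<dots> = (\<Sum>s\<in>F. \<Sum>t\<in>F. if s = t then 2 * pi * (p s * cnj (q s)) else 0)"
    unfolding integral_cis by (intro sum.cong refl) auto
  also have "\<dots> = 2 * pi * (\<Sum>s\<in>F. p s * cnj (q s))"
    using assms by (simp add: sum_distrib_left)
  finally show ?thesis .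
qed

lemma sum_swap3: "(\<Sum>t\<in>T. \<Sum>j\<in>J. \<Sum>k\<in>K. g t j k) = (\<Sum>j\<in>J. \<Sum>k\<in>K. \<Sum>t\<in>T. g t j k)"
  by (rule trans[OF sum.swap]) (intro sum.cong refl sum.swap)

text \<open>The phase is \<open>fourier_freq n j + u\<close>, with a plus sign, because then
  multiplication by the transfer function gives the Fourier series of the coefficients of the
  innovations (see \<open>gram_dft_coeff\<close>). The divisor makes the kernels orthonormal for
  unnormalized Lebesgue measure on the circle and matches the normalization of the
  periodogram.\<close>

definition dft_kernel :: "nat \<Rightarrow> nat \<Rightarrow> real \<Rightarrow> complex"
  where "dft_kernel n j u = (\<Sum>t=1..n. cis (real t * (fourier_freq n j + u))) / sqrt (2 * pi * real n)"

lemma continuous_dft_kernel: "continuous_on S (dft_kernel n j)"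
  unfolding dft_kernel_def[abs_def] divide_inverse by (intro continuous_intros)

lemma dft_kernel_measurable [measurable]: "dft_kernel n j \<in> borel_measurable circle_measure"
  by (intro borel_measurable_integrable integrable_circle_continuous continuous_dft_kernel)

lemma nu_bound: "j \<in> {1..nu n} \<Longrightarrow> 2 * j < n"
  by (auto simp: nu_def)

lemma fourier_freq_bounds:
  assumes "j \<in> {1..nu n}"
  shows "0 < fourier_freq n j" "fourier_freq n j < pi"
proof -
  have "2 * j < n" "1 \<le> j" using nu_bound[OF assms] assms by auto
  then have "2 * real j < real n" "0 < real j"
    by linarith+
  then show "0 < fourier_freq n j" "fourier_freq n j < pi"
    by (auto simp: fourier_freq_def field_simps)
qed

lemma sum_cis_fourier_freq_diff:
  assumes "j \<in> {1..nu n}" "k \<in> {1..nu n}"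
  shows "(\<Sum>t=1..n. cis (real t * (fourier_freq n j - fourier_freq n k))) = (if j = k then of_nat n else 0)"
proof (cases "j = k")
  case True
  then show ?thesis by simp
next
  case False
  define z where "z = cis (fourier_freq n j - fourier_freq n k)"
  have n: "n > 0" using nu_bound[OF assms(1)] by simp
  have "fourier_freq n j - fourier_freq n k = 2 * pi * ((real j - real k) / real n)"
    by (simp add: fourier_freq_def algebra_simps diff_divide_distrib)
  then have *: "real n * (fourier_freq n j - fourier_freq n k) = 2 * pi * of_int (int j - int k)"
    using n by simp
  have "z ^ n = cis (2 * pi * of_int (int j - int k))"
    by (simp only: z_def Complex.DeMoivre *)
  also have "\<dots> = 1" by (rule cis_multiple_2pi) (auto simp del: of_int_diff)
  finally have zn: "z ^ n = 1" .
  have z1: "z \<noteq> 1"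
  proof
    assume "z = 1"
    then have "cos (fourier_freq n j - fourier_freq n k) = 1"
      by (simp add: z_def complex_eq_iff)
    then obtain m :: int where m: "fourier_freq n j - fourier_freq n k = m * 2 * pi"
      by (auto simp: cos_one_2pi_int)
    have "\<bar>fourier_freq n j - fourier_freq n k\<bar> < 2 * pi"
      using fourier_freq_bounds[OF assms(1)] fourier_freq_bounds[OF assms(2)] by linarith
    then have "\<bar>real_of_int m\<bar> < 1" by (simp add: m abs_mult)
    then have "m = 0" by linarith
    then show False using m n False by (simp add: fourier_freq_def)
  qed
  have "(\<Sum>t=1..n. cis (real t * (fourier_freq n j - fourier_freq n k))) = (\<Sum>t=1..n. z ^ t)"
    by (simp add: z_def Complex.DeMoivre)
  also have "\<dots> = z * (\<Sum>t<n. z ^ t)"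
    by (simp add: sum_distrib_left sum.shift_bounds_cl_Suc_ivl sum.atLeast1_atMost_eq)
  also have "\<dots> = 0" using geometric_sum[OF z1, of n] zn by simp
  finally show ?thesis using False by simp
qed

text \<open>A combination of kernels is a trigonometric polynomial with frequencies 1 to n. Parseval
  turns the integral into a sum over t of exponentials at differences of Fourier frequencies, which
  collapses by the discrete orthogonality \<open>sum_cis_fourier_freq_diff\<close>.\<close>

lemma dft_kernel_orthonormal:
  fixes c :: "nat \<Rightarrow> complex"
  shows "(LINT u|circle_measure. (cmod (\<Sum>j\<in>{1..nu n}. c j * dft_kernel n j u))\<^sup>2) = (\<Sum>j\<in>{1..nu n}. (cmod (c j))\<^sup>2)"
proof (cases "n = 0")
  case True
  then show ?thesis by (simp add: nu_def)
next
  case False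
  define J where "J = {1..nu n}"
  define P where "P s = (\<Sum>j\<in>J. c j * cis (of_int s * fourier_freq n j)) / sqrt (2 * pi * real n)" for s :: int
  have P: "(\<Sum>j\<in>J. c j * dft_kernel n j u) = (\<Sum>s\<in>int ` {1..n}. P s * cis (of_int s * u))" for u
  proof -
    have "(\<Sum>j\<in>J. c j * dft_kernel n j u) =
       (\<Sum>j\<in>J. \<Sum>t=1..n. c j * cis (real t * fourier_freq n j) / sqrt (2 * pi * real n) * cis (real t * u))"
      by (simp add: dft_kernel_def sum_divide_distrib sum_distrib_left distrib_left mult_ac flip: cis_mult)
    also have "\<dots> = (\<Sum>t=1..n. P (int t) * cis (real t * u))"
      by (subst sum.swap) (simp add: P_def sum_distrib_right sum_divide_distrib)
    finally show ?thesis by (simp add: sum.reindex)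
  qed
  have "complex_of_real (LINT u|circle_measure. (cmod (\<Sum>j\<in>J. c j * dft_kernel n j u))\<^sup>2)
     = (LINT u|circle_measure. (\<Sum>s\<in>int ` {1..n}. P s * cis (of_int s * u)) * cnj (\<Sum>s\<in>int ` {1..n}. P s * cis (of_int s * u)))"
    unfolding P by (simp only: complex_norm_square flip: integral_complex_of_real)
  also have "\<dots> = 2 * pi * (\<Sum>t=1..n. P (int t) * cnj (P (int t)))"
    by (subst parseval_trig) (auto simp: sum.reindex)
  also have "\<dots> = (\<Sum>t=1..n. \<Sum>j\<in>J. \<Sum>k\<in>J. c j * cnj (c k) * cis (real t * (fourier_freq n j - fourier_freq n k)) / n)"
  proof -
    have "2 * pi * (P (int t) * cnj (P (int t))) =
        (\<Sum>j\<in>J. \<Sum>k\<in>J. c j * cnj (c k) * cis (real t * (fourier_freq n j - fourier_freq n k)) / n)" for t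
    proof -
      have "complex_of_real (sqrt (2 * pi * real n)) * complex_of_real (sqrt (2 * pi * real n)) = 2 * pi * n"
        by (simp flip: of_real_mult)
      then have "2 * pi * (P (int t) * cnj (P (int t))) =
          (\<Sum>j\<in>J. c j * cis (real t * fourier_freq n j)) * cnj (\<Sum>j\<in>J. c j * cis (real t * fourier_freq n j)) / n"
        unfolding P_def by (simp add: field_simps)
      also have "\<dots> = (\<Sum>j\<in>J. \<Sum>k\<in>J. c j * cnj (c k) * cis (real t * (fourier_freq n j - fourier_freq n k)) / n)"
        unfolding cnj_sum sum_product sum_divide_distrib mult_cis_mult_cnj by (simp add: right_diff_distrib)
      finally show ?thesis .
    qed
    then show ?thesis by (simp add: sum_distrib_left)
  qed
  also have "\<dots> = (\<Sum>j\<in>J. \<Sum>k\<in>J. c j * cnj (c k) * (\<Sum>t=1..n. cis (real t * (fourier_freq n j - fourier_freq n k))) / n)"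
    by (subst sum_swap3) (simp add: sum_distrib_left sum_divide_distrib)
  also have "\<dots> = (\<Sum>j\<in>J. \<Sum>k\<in>J. if j = k then c j * cnj (c j) else 0)"
    using False by (intro sum.cong refl) (simp add: sum_cis_fourier_freq_diff J_def del: One_nat_def)
  also have "\<dots> = (\<Sum>j\<in>J. c j * cnj (c j))"
    by (simp add: J_def)
  also have "\<dots> = complex_of_real (\<Sum>j\<in>J. (cmod (c j))\<^sup>2)"
    by (simp add: complex_norm_square del: of_real_power)
  finally show ?thesis unfolding of_real_eq_iff J_def .
qed

lemma dft_kernel_norm:
  assumes "j \<in> {1..nu n}"
  shows "(LINT u|circle_measure. (cmod (dft_kernel n j u))\<^sup>2) = 1"
proof -
  have "(\<Sum>i\<in>{1..nu n}. (if i = j then 1 else 0) * dft_kernel n i u) = dft_kernel n j u" for u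
    using assms by (subst sum.cong[OF refl, of _ _ "\<lambda>i. if i = j then dft_kernel n j u else 0"]) auto
  moreover have "(\<Sum>i\<in>{1..nu n}. (cmod (if i = j then 1 else 0))\<^sup>2) = 1"
    using assms by (subst sum.cong[OF refl, of _ _ "\<lambda>i. if i = j then 1 else 0"]) auto
  ultimately show ?thesis
    using dft_kernel_orthonormal[where n=n and c="\<lambda>i. if i = j then 1 else 0"] by simp
qed

section \<open>Pointwise size of the kernels\<close>

lemma cmod_sum_cis_le: "cmod (\<Sum>t=1..n. cis (real t * v)) * \<bar>sin (v / 2)\<bar> \<le> 1"
proof -
  \<comment> \<open>Multiplication by \<open>cis v - 1\<close>, of modulus
    \<open>2 * \<bar>sin (v / 2)\<bar>\<close>, makes the geometric sum telescope. The product form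
    remains valid where the sine vanishes.\<close>
  have "(\<Sum>t=1..n. cis (real t * v)) * (cis v - 1) = cis v * (cis (real n * v) - 1)"
  proof (induction n)
    case (Suc n)
    then show ?case
      by (simp add: distrib_right algebra_simps cis_mult)
  qed simp
  then have "cmod (\<Sum>t=1..n. cis (real t * v)) * cmod (cis v - 1) = cmod (cis (real n * v) - 1)"
    by (metis mult_1 norm_cis norm_mult)
  also have "\<dots> \<le> 2"
    using norm_triangle_ineq4[of "cis (real n * v)" 1] by simp
  finally show ?thesis
    using dist_exp_i_1[of v] by (simp add: cis_conv_exp)
qed

text \<open>Concavity of the sine: it lies above its chord over [0, pi / 2].\<close>

lemma jordan_sin_le:
  assumes "0 \<le> x" "x \<le> pi / 2"
  shows "2 * x / pi \<le> sin x"
proof -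
  have "convex_on {0..pi} (\<lambda>x. - sin x)"
  proof (rule f''_ge0_imp_convex)
    show "((\<lambda>x. - sin x) has_real_derivative (- cos x)) (at x)" for x
      by (auto intro!: derivative_eq_intros)
    show "((\<lambda>x. - cos x) has_real_derivative (sin x)) (at x)" for x
      by (auto intro!: derivative_eq_intros)
    show "0 \<le> sin x" if "x \<in> {0..pi}" for x
      using that by (auto intro: sin_ge_zero)
  qed auto
  then have "- sin ((1 - 2 * x / pi) *\<^sub>R 0 + (2 * x / pi) *\<^sub>R (pi / 2)) \<le>
      (1 - 2 * x / pi) * (- sin 0) + (2 * x / pi) * (- sin (pi / 2))"
    using assms by (intro convex_onD) (auto simp: field_simps)
  then show ?thesis by (simp add: sin_pi_half)
qed

text \<open>The sine vanishes only where \<open>v + u\<close> is a multiple of 2 pi, hence near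
  \<open>u = - v\<close>. The distance to these points is at least
  \<open>\<bar>v - \<bar>u\<bar>\<bar>\<close>; this weaker bound has a second zero at
  \<open>u = v\<close>, but it is even in \<open>u\<close>, so that all later integrals can be
  folded onto [0, pi].\<close>

lemma abs_sin_half_sum_ge:
  assumes "0 < v" "v < pi" "\<bar>u\<bar> \<le> pi"
  shows "\<bar>v - \<bar>u\<bar>\<bar> / pi \<le> \<bar>sin ((v + u) / 2)\<bar>"
proof (cases "u \<ge> 0")
  case True
  show ?thesis
  proof (cases "(v + u) / 2 \<le> pi / 2")
    case True
    have "\<bar>v - \<bar>u\<bar>\<bar> / pi \<le> (v + u) / pi"
      using assms \<open>u \<ge> 0\<close> by (intro divide_right_mono) auto
    also have "(v + u) / pi = 2 * ((v + u) / 2) / pi" by (simp add: field_simps)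
    also have "\<dots> \<le> sin ((v + u) / 2)"
      using True assms \<open>u \<ge> 0\<close> by (intro jordan_sin_le) auto
    finally show ?thesis by linarith
  next
    case False
    have "\<bar>v - \<bar>u\<bar>\<bar> / pi \<le> (2 * pi - v - u) / pi"
      using assms \<open>u \<ge> 0\<close> by (intro divide_right_mono) auto
    also have "(2 * pi - v - u) / pi = 2 * (pi - (v + u) / 2) / pi"
      by (simp add: field_simps)
    also have "\<dots> \<le> sin (pi - (v + u) / 2)"
      using False assms \<open>u \<ge> 0\<close> by (intro jordan_sin_le) (auto simp: field_simps)
    finally show ?thesis by simp
  qed
next
  case False
  have "\<bar>v - \<bar>u\<bar>\<bar> / pi = 2 * \<bar>(v + u) / 2\<bar> / pi" using False by simp
  also have "\<dots> \<le> sin \<bar>(v + u) / 2\<bar>"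
    using assms False by (intro jordan_sin_le) auto
  also have "\<dots> \<le> \<bar>sin ((v + u) / 2)\<bar>" by (cases "0 \<le> v + u") (auto simp: abs_if)
  finally show ?thesis .
qed

lemma cmod_dft_kernel_mult_le:
  assumes "j \<in> {1..nu n}" "\<bar>u\<bar> \<le> pi"
  shows "cmod (dft_kernel n j u) * \<bar>fourier_freq n j - \<bar>u\<bar>\<bar> \<le> sqrt (pi / (2 * real n))"
proof -
  define v where "v = fourier_freq n j"
  have n: "n > 0" using nu_bound[OF assms(1)] by simp
  have v: "0 < v" "v < pi" using fourier_freq_bounds[OF assms(1)] by (auto simp: v_def)
  define D where "D = cmod (\<Sum>t=1..n. cis (real t * (v + u)))"
  have "D * (\<bar>v - \<bar>u\<bar>\<bar> / pi) \<le> D * \<bar>sin ((v + u) / 2)\<bar>"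
    using v assms by (intro mult_left_mono abs_sin_half_sum_ge) (auto simp: D_def)
  also have "\<dots> \<le> 1" unfolding D_def by (rule cmod_sum_cis_le)
  finally have "D * \<bar>v - \<bar>u\<bar>\<bar> \<le> pi" by (simp add: field_simps)
  then have "D * \<bar>v - \<bar>u\<bar>\<bar> / sqrt (2 * pi * n) \<le> pi / sqrt (2 * pi * n)"
    by (intro divide_right_mono) auto
  also have "pi / sqrt (2 * pi * n) = sqrt (pi / (2 * n))"
    using n by (simp add: real_sqrt_mult real_sqrt_divide field_simps)
  finally show ?thesis by (simp add: dft_kernel_def D_def v_def norm_divide)
qed

lemma cmod_dft_kernel_le: "cmod (dft_kernel n j u) \<le> sqrt (n / (2 * pi))"
proof (cases "n = 0")
  case False
  have "cmod (\<Sum>t=1..n. cis (real t * (fourier_freq n j + u))) \<le> n"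
    using norm_sum[of "\<lambda>t. cis (real t * (fourier_freq n j + u))" "{1..n}"] by simp
  then have "cmod (dft_kernel n j u) \<le> n / sqrt (2 * pi * n)"
    by (simp add: dft_kernel_def norm_divide divide_right_mono)
  also have "\<dots> = sqrt (n / (2 * pi))"
    using False by (simp add: real_sqrt_mult real_sqrt_divide field_simps)
  finally show ?thesis .
qed (simp add: dft_kernel_def)

text \<open>Merges the trivial bound at the peak with the decay away from it into one integrable
  majorant. The constant 4 is the square of 1/2 + 3/2, the numbers in \<open>s1\<close> and
  \<open>s2\<close>.\<close>

lemma cmod_dft_kernel_power2_le:
  assumes "j \<in> {1..nu n}" "\<bar>u\<bar> \<le> pi"
  shows "(cmod (dft_kernel n j u))\<^sup>2 \<le> 4 * n / (1 + n * \<bar>\<bar>u\<bar> - fourier_freq n j\<bar>)\<^sup>2"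
proof -
  define w where "w = \<bar>\<bar>u\<bar> - fourier_freq n j\<bar>"
  have n: "real n > 0" using nu_bound[OF assms(1)] by simp
  have w: "0 \<le> w" by (simp add: w_def)
  have s1: "sqrt (n / (2 * pi)) \<le> sqrt n * (1 / 2)"
    using n pi_gt3 by (intro real_le_lsqrt) (auto simp: power_mult_distrib field_simps power2_eq_square)
  have s2: "n * sqrt (pi / (2 * n)) \<le> sqrt n * (3 / 2)"
  proof -
    have "n * sqrt (pi / (2 * n)) = sqrt n * sqrt (pi / 2)"
      using n by (simp add: real_sqrt_divide real_sqrt_mult field_simps)
    moreover have "sqrt (pi / 2) \<le> 3 / 2"
      using pi_less_4 by (intro real_le_lsqrt) (auto simp: power2_eq_square)
    ultimately show ?thesis using n by simp
  qed
  have "cmod (dft_kernel n j u) * (1 + n * w) = cmod (dft_kernel n j u) + n * (cmod (dft_kernel n j u) * w)"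
    by (simp add: algebra_simps)
  also have "\<dots> \<le> sqrt (n / (2 * pi)) + n * sqrt (pi / (2 * n))"
    using cmod_dft_kernel_mult_le[OF assms] cmod_dft_kernel_le[of n j u] n
    by (intro add_mono mult_left_mono) (auto simp: w_def abs_minus_commute)
  also have "\<dots> \<le> 2 * sqrt n" using s1 s2 by simp
  finally have "cmod (dft_kernel n j u) * (1 + n * w) \<le> 2 * sqrt n" .
  then have "(cmod (dft_kernel n j u) * (1 + n * w))\<^sup>2 \<le> (2 * sqrt n)\<^sup>2"
    using n w by (intro power_mono) auto
  then have "(cmod (dft_kernel n j u))\<^sup>2 * (1 + n * w)\<^sup>2 \<le> 4 * n"
    using n by (simp add: power_mult_distrib)
  moreover have "0 < (1 + n * w)\<^sup>2"
    using n w by (intro zero_less_power add_pos_nonneg) auto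
  ultimately show ?thesis
    unfolding w_def[symmetric] by (simp only: pos_le_divide_eq)
qed


section \<open>Weighted operator inequality\<close>

lemma powr_square:
  fixes x a :: real
  shows "(x powr a)\<^sup>2 = x powr (2 * a)"
  by (simp add: power2_eq_square flip: powr_add)

text \<open>Serves both signs of the exponent. Since
  \<open>r \<le> r powr \<bar>e\<bar> \<le> 1\<close>, the distance of
  \<open>r powr \<bar>e\<bar>\<close> to 1 is at most \<open>1 - r\<close>; for negative
  \<open>e\<close> the factor \<open>r powr (- \<bar>e\<bar>)\<close> is pulled out first.\<close>

lemma powr_minus_one_le:
  fixes r e :: real
  assumes "0 < r" "r \<le> 1" "\<bar>e\<bar> \<le> 1"
  shows "\<bar>r powr e - 1\<bar> \<le> r powr (- \<bar>e\<bar>) * (1 - r)"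
proof -
  have r: "r \<le> r powr \<bar>e\<bar>" "r powr \<bar>e\<bar> \<le> 1"
    using assms powr_mono'[of "\<bar>e\<bar>" 1 r] powr_le1[of "\<bar>e\<bar>" r] by auto
  have inv: "r powr (- \<bar>e\<bar>) * r powr \<bar>e\<bar> = 1"
    using assms by (simp flip: powr_add)
  have ge1: "1 \<le> r powr (- \<bar>e\<bar>)"
    using powr_mono'[of "- \<bar>e\<bar>" 0 r] assms by simp
  have "r powr (- \<bar>e\<bar>) - 1 = r powr (- \<bar>e\<bar>) * (1 - r powr \<bar>e\<bar>)"
    using inv by (simp add: right_diff_distrib)
  also have "\<dots> \<le> r powr (- \<bar>e\<bar>) * (1 - r)"
    using r by (intro mult_left_mono) auto
  finally have *: "r powr (- \<bar>e\<bar>) - 1 \<le> r powr (- \<bar>e\<bar>) * (1 - r)" .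
  have **: "1 - r powr \<bar>e\<bar> \<le> r powr (- \<bar>e\<bar>) * (1 - r)"
  proof -
    have "1 - r powr \<bar>e\<bar> \<le> 1 * (1 - r)" using r by simp
    also have "\<dots> \<le> r powr (- \<bar>e\<bar>) * (1 - r)" using ge1 assms by (intro mult_right_mono) auto
    finally show ?thesis .
  qed
  show ?thesis
  proof (cases "e \<ge> 0")
    case True
    then show ?thesis using r ** by simp
  next
    case False
    then show ?thesis using ge1 * by simp
  qed
qed

text \<open>For positive arguments and \<open>\<delta> \<le> 1 / 2\<close> this equals
  \<open>(max u v / min u v) powr \<delta> / max u v\<close>, a kernel of Hilbert type, homogeneous
  of degree -1. As a minimum of two products it is visibly symmetric and, for \<delta> in [0, 1],
  nonincreasing in each argument.\<close>

definition schur_kernel :: "real \<Rightarrow> real \<Rightarrow> real \<Rightarrow> real"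
  where "schur_kernel \<delta> u v = min (u powr (- \<delta>) * v powr (\<delta> - 1)) (u powr (\<delta> - 1) * v powr (- \<delta>))"

lemma schur_kernel_commute: "schur_kernel \<delta> u v = schur_kernel \<delta> v u"
  by (simp add: schur_kernel_def min.commute mult.commute)

lemma schur_kernel_nonneg: "0 \<le> schur_kernel \<delta> u v"
  by (simp add: schur_kernel_def)

lemma schur_kernel_eq:
  assumes "0 < u" "u \<le> v" "\<delta> \<le> 1 / 2"
  shows "schur_kernel \<delta> u v = u powr (- \<delta>) * v powr (\<delta> - 1)"
proof -
  have split: "x powr (- \<delta>) = x powr (\<delta> - 1) * x powr (1 - 2 * \<delta>)" for x
    by (simp flip: powr_add)
  have "u powr (1 - 2 * \<delta>) \<le> v powr (1 - 2 * \<delta>)"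
    using assms by (intro powr_mono2) auto
  then have "u powr (\<delta> - 1) * v powr (\<delta> - 1) * u powr (1 - 2 * \<delta>) \<le> u powr (\<delta> - 1) * v powr (\<delta> - 1) * v powr (1 - 2 * \<delta>)"
    by (intro mult_left_mono) auto
  then have "u powr (- \<delta>) * v powr (\<delta> - 1) \<le> u powr (\<delta> - 1) * v powr (- \<delta>)"
    unfolding split[of u] split[of v] by (simp only: mult_ac)
  then show ?thesis by (simp add: schur_kernel_def)
qed

text \<open>Relative error of replacing the power at \<open>u\<close> by the power at
  \<open>v\<close>. The factor \<open>\<bar>u - v\<bar>\<close> is kept apart because it absorbs the
  decay of the kernel in \<open>cmod_dft_kernel_mult_le\<close>; what remains is a positive kernel
  without a singularity on the diagonal.\<close>

lemma powr_quotient_minus_one_le: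
  fixes u v d :: real
  assumes "0 < u" "0 < v" "\<bar>d\<bar> \<le> 1 / 2"
  shows "\<bar>(u / v) powr (- d) - 1\<bar> \<le> schur_kernel \<bar>d\<bar> u v * \<bar>u - v\<bar>"
proof (cases "u \<le> v")
  case True
  have "\<bar>(u / v) powr (- d) - 1\<bar> \<le> (u / v) powr (- \<bar>d\<bar>) * (1 - u / v)"
    using powr_minus_one_le[of "u / v" "- d"] assms True by simp
  also have "\<dots> = u powr (- \<bar>d\<bar>) * v powr (\<bar>d\<bar> - 1) * \<bar>u - v\<bar>"
    using assms True by (simp add: powr_divide powr_diff powr_minus field_simps)
  finally show ?thesis using assms True by (simp add: schur_kernel_eq)
next
  case False
  have "(u / v) powr (- d) = (v / u) powr d"
    using assms by (simp add: powr_divide powr_minus field_simps)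
  then have "\<bar>(u / v) powr (- d) - 1\<bar> \<le> (v / u) powr (- \<bar>d\<bar>) * (1 - v / u)"
    using powr_minus_one_le[of "v / u" d] assms False by simp
  also have "\<dots> = v powr (- \<bar>d\<bar>) * u powr (\<bar>d\<bar> - 1) * \<bar>u - v\<bar>"
    using assms False by (simp add: powr_divide powr_diff powr_minus field_simps)
  finally show ?thesis using assms False by (simp add: schur_kernel_eq schur_kernel_commute[of _ u])
qed

lemma has_real_derivative_scaled_powr:
  fixes A B q y :: real
  assumes "0 < y" "q \<noteq> 0"
  shows "((\<lambda>y. (A * y powr q + B) / q) has_real_derivative A * y powr (q - 1)) (at y)"
proof -
  have "((\<lambda>y. (A * y powr q + B) / q) has_real_derivative (A * (q * y powr (q - 1)) + 0) / q) (at y)"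
    using assms by (intro DERIV_cdivide DERIV_add DERIV_cmult has_real_derivative_powr DERIV_const)
  then show ?thesis using assms by simp
qed

text \<open>An antiderivative in \<open>y\<close> of
  \<open>schur_kernel \<delta> y v * y powr (- 1 / 2)\<close>. Below \<open>v\<close> only the term
  with \<open>min\<close> varies, above \<open>v\<close> only the term with \<open>max\<close>; the
  constant \<open>v powr (- 1 / 2)\<close> makes the value at 0 equal to 0. Both pieces stay bounded
  because \<open>\<delta> < 1 / 2\<close>.\<close>

definition schur_primitive :: "real \<Rightarrow> real \<Rightarrow> real \<Rightarrow> real"
  where "schur_primitive \<delta> v y =
    (v powr (\<delta> - 1) * min y v powr (1 / 2 - \<delta>) + v powr (- 1 / 2) - v powr (- \<delta>) * max y v powr (\<delta> - 1 / 2)) / (1 / 2 - \<delta>)"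

context
  fixes \<delta> v :: real
  assumes \<delta>: "0 \<le> \<delta>" "\<delta> < 1 / 2" and v: "0 < v"
begin

lemma schur_primitive_0: "schur_primitive \<delta> v 0 = 0"
  using v by (simp add: schur_primitive_def flip: powr_add)

lemma schur_primitive_le:
  assumes "0 \<le> y"
  shows "schur_primitive \<delta> v y \<le> 2 * v powr (- 1 / 2) / (1 / 2 - \<delta>)"
proof -
  have "v powr (\<delta> - 1) * min y v powr (1 / 2 - \<delta>) \<le> v powr (\<delta> - 1) * v powr (1 / 2 - \<delta>)"
    using assms \<delta> v by (intro mult_left_mono powr_mono2) auto
  also have "\<dots> = v powr (- 1 / 2)" using v by (simp flip: powr_add)
  finally have "v powr (\<delta> - 1) * min y v powr (1 / 2 - \<delta>) \<le> v powr (- 1 / 2)" .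
  moreover have "0 \<le> v powr (- \<delta>) * max y v powr (\<delta> - 1 / 2)" by simp
  ultimately have "v powr (\<delta> - 1) * min y v powr (1 / 2 - \<delta>) + v powr (- 1 / 2) - v powr (- \<delta>) * max y v powr (\<delta> - 1 / 2)
      \<le> 2 * v powr (- 1 / 2)" by linarith
  then show ?thesis
    unfolding schur_primitive_def using \<delta> by (intro divide_right_mono) auto
qed

lemma has_integral_schur_kernel:
  assumes "0 \<le> a" "a \<le> b"
  shows "((\<lambda>y. schur_kernel \<delta> y v * y powr (- 1 / 2)) has_integral (schur_primitive \<delta> v b - schur_primitive \<delta> v a)) {a..b}"
proof (rule fundamental_theorem_of_calculus_strong[where S = "{0, v}"])
  fix y assume "y \<in> {a..b} - {0, v}"
  then have y: "0 < y" "y \<noteq> v" using assms by auto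
  show "(schur_primitive \<delta> v has_vector_derivative schur_kernel \<delta> y v * y powr (- 1 / 2)) (at y)"
  proof (cases "y < v")
    case True
    have "((\<lambda>y. (v powr (\<delta> - 1) * y powr (1 / 2 - \<delta>) + v powr (- 1 / 2) - v powr (- \<delta>) * v powr (\<delta> - 1 / 2)) / (1 / 2 - \<delta>))
       has_real_derivative v powr (\<delta> - 1) * y powr (1 / 2 - \<delta> - 1)) (at y)"
      using has_real_derivative_scaled_powr[of y "1 / 2 - \<delta>" "v powr (\<delta> - 1)"
          "v powr (- 1 / 2) - v powr (- \<delta>) * v powr (\<delta> - 1 / 2)"] y \<delta>
      by (simp only: add_diff_eq)
    also have "v powr (\<delta> - 1) * y powr (1 / 2 - \<delta> - 1) = schur_kernel \<delta> y v * y powr (- 1 / 2)"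
    proof -
      have "y powr (1 / 2 - \<delta> - 1) = y powr (- \<delta>) * y powr (- 1 / 2)"
        unfolding powr_add[symmetric] by (intro arg_cong[where f = "\<lambda>x. y powr x"]) simp
      then show ?thesis using y True \<delta> by (simp add: schur_kernel_eq mult_ac)
    qed
    finally have "(schur_primitive \<delta> v has_real_derivative schur_kernel \<delta> y v * y powr (- 1 / 2)) (at y)"
      by (rule has_field_derivative_transform_within_open[where S = "{0<..<v}"])
        (use y True in \<open>auto simp: schur_primitive_def\<close>)
    then show ?thesis by (simp add: has_real_derivative_iff_has_vector_derivative)
  next
    case False
    then have vy: "v < y" using y by simp
    have "((\<lambda>y. (v powr (\<delta> - 1) * v powr (1 / 2 - \<delta>) + v powr (- 1 / 2) - v powr (- \<delta>) * y powr (\<delta> - 1 / 2)) / (1 / 2 - \<delta>))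
       has_real_derivative v powr (- \<delta>) * y powr (\<delta> - 1 / 2 - 1)) (at y)"
    proof -
      have eq: "(a + b - c * z) / (1 / 2 - \<delta>) = (c * z + - (a + b)) / (\<delta> - 1 / 2)" for a b c z :: real
      proof -
        have "(a + b - c * z) / (1 / 2 - \<delta>) = (- (a + b - c * z)) / (- (1 / 2 - \<delta>))"
          by (simp only: minus_divide_divide)
        then show ?thesis by (simp add: algebra_simps)
      qed
      show ?thesis
        unfolding eq using y \<delta> by (intro has_real_derivative_scaled_powr) auto
    qed
    also have "v powr (- \<delta>) * y powr (\<delta> - 1 / 2 - 1) = schur_kernel \<delta> y v * y powr (- 1 / 2)"
      using y v vy \<delta> by (simp add: schur_kernel_eq schur_kernel_commute[of _ y] mult_ac flip: powr_add)
    finally have "(schur_primitive \<delta> v has_real_derivative schur_kernel \<delta> y v * y powr (- 1 / 2)) (at y)"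
      by (rule has_field_derivative_transform_within_open[where S = "{v<..}"])
        (use vy in \<open>auto simp: schur_primitive_def\<close>)
    then show ?thesis by (simp add: has_real_derivative_iff_has_vector_derivative)
  qed
next
  show "continuous_on {a..b} (schur_primitive \<delta> v)"
    unfolding schur_primitive_def[abs_def] divide_inverse
    by (intro continuous_intros continuous_on_powr') (use assms v \<delta> in \<open>auto simp: min_def max_def\<close>)
qed (use assms in auto)

lemma schur_kernel_antimono:
  assumes "0 < y" "y \<le> z"
  shows "schur_kernel \<delta> z v * z powr (- 1 / 2) \<le> schur_kernel \<delta> y v * y powr (- 1 / 2)"
proof (intro mult_mono)
  show "schur_kernel \<delta> z v \<le> schur_kernel \<delta> y v"
    unfolding schur_kernel_def using assms \<delta> by (intro min.mono mult_right_mono powr_mono2') auto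
  show "z powr (- 1 / 2) \<le> y powr (- 1 / 2)"
    using assms by (intro powr_mono2') auto
qed (auto simp: schur_kernel_nonneg)

text \<open>The integrand decreases, so a Riemann sum with right endpoints stays below the integral
  from 0. This gives Schur's test in the discrete variable, the Fourier frequencies, from the one in
  the continuous variable.\<close>

lemma sum_schur_kernel_le:
  assumes h: "0 < h"
  shows "h * (\<Sum>j=1..m. schur_kernel \<delta> (real j * h) v * (real j * h) powr (- 1 / 2)) \<le> 2 * v powr (- 1 / 2) / (1 / 2 - \<delta>)"
proof -
  define H where "H y = schur_kernel \<delta> y v * y powr (- 1 / 2)" for y
  have "h * (\<Sum>j=1..m. H (real j * h)) \<le> schur_primitive \<delta> v (real m * h)"
  proof (induction m)
    case 0
    then show ?case by (simp add: schur_primitive_0)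
  next
    case (Suc m)
    let ?a = "real m * h" and ?b = "real (Suc m) * h"
    have ab: "0 \<le> ?a" "?a \<le> ?b" "?b - ?a = h" using h by (auto simp: algebra_simps)
    have "((\<lambda>y. H ?b) has_integral (?b - ?a) *\<^sub>R H ?b) {?a..?b}"
      using has_integral_const_real[of "H ?b" ?a ?b] ab by simp
    \<comment> \<open>By convention \<open>0 powr (- 1 / 2) = 0\<close>, so \<open>H\<close>
      vanishes at 0 instead of being infinite there and the comparison would fail at that point;
      changing the constant at one point leaves its integral alone.\<close>
    then have "((\<lambda>y. if y = 0 then 0 else H ?b) has_integral (?b - ?a) *\<^sub>R H ?b) {?a..?b}"
      by (rule has_integral_spike_finite[of "{0}", rotated 2]) auto
    moreover have "(H has_integral (schur_primitive \<delta> v ?b - schur_primitive \<delta> v ?a)) {?a..?b}"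
      unfolding H_def by (rule has_integral_schur_kernel) (use ab in auto)
    ultimately have "(?b - ?a) *\<^sub>R H ?b \<le> schur_primitive \<delta> v ?b - schur_primitive \<delta> v ?a"
    proof (rule has_integral_le)
      fix y assume "y \<in> {?a..?b}"
      then have "y = 0 \<or> 0 < y" "y \<le> ?b" using ab(1) by auto
      then show "(if y = 0 then 0 else H ?b) \<le> H y"
        using schur_kernel_antimono[of y ?b] by (auto simp: H_def simp del: of_nat_Suc)
    qed
    then show ?case using Suc ab by (simp add: distrib_left)
  qed
  also have "\<dots> \<le> 2 * v powr (- 1 / 2) / (1 / 2 - \<delta>)" using h by (intro schur_primitive_le) auto
  finally show ?thesis by (simp add: H_def)
qed

end

text \<open>Folding of an even majorant. Nonnegativity turns the gauge integral supplied by the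
  fundamental theorem of calculus into an absolutely convergent one, hence into a Lebesgue
  integral.\<close>

lemma even_circle_integral:
  fixes F :: "real \<Rightarrow> real"
  assumes I: "(F has_integral I) {0..pi}" and nonneg: "\<And>y. y \<in> {0..pi} \<Longrightarrow> 0 \<le> F y"
  shows "integrable circle_measure (\<lambda>u. F \<bar>u\<bar>)" "(LINT u|circle_measure. F \<bar>u\<bar>) = 2 * I"
proof -
  have "((\<lambda>u. F \<bar>u\<bar>) has_integral I) {0..pi}"
    using I by (rule has_integral_eq[rotated]) auto
  moreover have "((\<lambda>u. F (- u)) has_integral I) {-pi..0}"
    using I has_integral_reflect_real[where f = F and a = 0 and b = pi] by simp
  then have "((\<lambda>u. F \<bar>u\<bar>) has_integral I) {-pi..0}"
    by (rule has_integral_eq[rotated]) auto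
  ultimately have has: "((\<lambda>u. F \<bar>u\<bar>) has_integral (I + I)) {-pi..pi}"
    by (intro has_integral_combine[where c = 0]) auto
  have "(\<lambda>u. F \<bar>u\<bar>) absolutely_integrable_on {-pi..pi}"
    using has nonneg by (intro nonnegative_absolutely_integrable_1) (auto simp: integrable_on_def)
  then show int: "integrable circle_measure (\<lambda>u. F \<bar>u\<bar>)"
    by (rule absolutely_integrable_imp_integrable) auto
  show "(LINT u|circle_measure. F \<bar>u\<bar>) = 2 * I"
    using lebesgue_integral_eq_integral[OF int] has by (simp add: integral_unique)
qed

lemma AE_circle_nonzero: "AE u in circle_measure. u \<noteq> 0"
proof -
  have "{0::real} \<in> null_sets lebesgue" by simp
  then have "AE u in lebesgue. u \<noteq> (0::real)" by (rule AE_I'[of "{0}"]) auto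
  then show ?thesis by (subst AE_restrict_space_iff) auto
qed

text \<open>The Hilbert-type part is handled by comparing with \<open>d = 0\<close>, where the kernels are
  orthonormal; the difference is dominated by a positive kernel that passes Schur's test with the
  weight \<open>\<bar>u\<bar> powr (- 1 / 2)\<close>. This is where \<open>\<bar>d\<bar> < 1/2\<close> is used.\<close>

lemma dft_kernel_weighted_bound:
  fixes c :: "nat \<Rightarrow> complex" and d :: real
  assumes d: "\<bar>d\<bar> < 1 / 2"
  defines "K \<equiv> 2 / (1 / 2 - \<bar>d\<bar>)"
  shows "integrable circle_measure (\<lambda>u. \<bar>u\<bar> powr (- 2 * d) * (cmod (\<Sum>j\<in>{1..nu n}. c j * dft_kernel n j u))\<^sup>2)"
    and "(LINT u|circle_measure. \<bar>u\<bar> powr (- 2 * d) * (cmod (\<Sum>j\<in>{1..nu n}. c j * dft_kernel n j u))\<^sup>2)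
      \<le> (2 + K\<^sup>2) * (\<Sum>j\<in>{1..nu n}. (cmod (c j))\<^sup>2 * fourier_freq n j powr (- 2 * d))"
proof -
  define J where "J = {1..nu n}"
  define v where "v = fourier_freq n"
  define \<delta> where "\<delta> = \<bar>d\<bar>"
  \<comment> \<open>The coefficients absorb the power at their own frequency. \<open>T\<close> is
    then the orthonormal sum of the case d = 0, whose squared norm is already the right-hand side,
    and \<open>R\<close> will majorize the squared error up to a constant.\<close>
  define y where "y j = c j * v j powr (- d)" for j
  define T where "T u = cmod (\<Sum>j\<in>J. y j * dft_kernel n j u)" for u
  define R where "R u = (\<Sum>j\<in>J. (cmod (y j))\<^sup>2 * sqrt (v j) * (schur_kernel \<delta> \<bar>u\<bar> (v j) * \<bar>u\<bar> powr (- 1 / 2)))" for u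
  have \<delta>: "0 \<le> \<delta>" "\<delta> < 1 / 2" using d by (auto simp: \<delta>_def)
  have K: "0 \<le> K" using d by (simp add: K_def)
  have vpos: "0 < v j" if "j \<in> J" for j using that fourier_freq_bounds(1) by (auto simp: v_def J_def)
  have y2: "(cmod (y j))\<^sup>2 = (cmod (c j))\<^sup>2 * v j powr (- 2 * d)" if "j \<in> J" for j
    using vpos[OF that] by (simp add: y_def norm_mult power_mult_distrib powr_power)
  have int_T: "integrable circle_measure (\<lambda>u. (T u)\<^sup>2)"
    unfolding T_def by (intro integrable_circle_continuous continuous_intros continuous_dft_kernel)
  have int_S: "integrable circle_measure (\<lambda>u. schur_kernel \<delta> \<bar>u\<bar> (v j) * \<bar>u\<bar> powr (- 1 / 2))"
    "(LINT u|circle_measure. schur_kernel \<delta> \<bar>u\<bar> (v j) * \<bar>u\<bar> powr (- 1 / 2)) \<le> 2 * (K * v j powr (- 1 / 2))"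
    if "j \<in> J" for j
  proof -
    note even = even_circle_integral[OF has_integral_schur_kernel[OF \<delta> vpos[OF that] order_refl pi_ge_zero]]
    show "integrable circle_measure (\<lambda>u. schur_kernel \<delta> \<bar>u\<bar> (v j) * \<bar>u\<bar> powr (- 1 / 2))"
      by (rule even) (simp add: schur_kernel_nonneg)
    show "(LINT u|circle_measure. schur_kernel \<delta> \<bar>u\<bar> (v j) * \<bar>u\<bar> powr (- 1 / 2)) \<le> 2 * (K * v j powr (- 1 / 2))"
      using schur_primitive_le[OF \<delta> vpos[OF that], of pi] schur_primitive_0[OF \<delta> vpos[OF that]]
      by (subst even(2)) (auto simp: schur_kernel_nonneg K_def \<delta>_def[symmetric])
  qed
  have int_R: "integrable circle_measure R"
    unfolding R_def by (intro Bochner_Integration.integrable_sum integrable_mult_right int_S)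
  have point: "\<bar>u\<bar> powr (- 2 * d) * (cmod (\<Sum>j\<in>J. c j * dft_kernel n j u))\<^sup>2 \<le> 2 * (T u)\<^sup>2 + K / 2 * R u"
    if u: "u \<noteq> 0" "u \<in> {-pi..pi}" for u
  proof (cases "n = 0")
    case True
    then show ?thesis by (simp add: J_def nu_def T_def R_def)
  next
    case n: False
    define x where "x = \<bar>u\<bar>"
    have x: "0 < x" "\<bar>u\<bar> \<le> pi" using u by (auto simp: x_def)
    define k where "k j = schur_kernel \<delta> x (v j)" for j
    have k: "0 \<le> k j" for j by (simp add: k_def schur_kernel_nonneg)
    have cterm: "cmod ((x powr (- d) * c j - y j) * dft_kernel n j u) \<le> cmod (y j) * (k j * sqrt (pi / (2 * n)))"
      if j: "j \<in> J" for j
    proof -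
      have "x powr (- d) * c j - y j = y j * ((x / v j) powr (- d) - 1)"
        using x vpos[OF j] by (simp add: y_def powr_divide algebra_simps)
      then have "cmod ((x powr (- d) * c j - y j) * dft_kernel n j u) =
        cmod (y j) * (\<bar>(x / v j) powr (- d) - 1\<bar> * cmod (dft_kernel n j u))"
        by (simp only: norm_mult norm_of_real mult_ac)
      also have "\<dots> \<le> cmod (y j) * ((k j * \<bar>x - v j\<bar>) * cmod (dft_kernel n j u))"
        using powr_quotient_minus_one_le[of x "v j" d] x vpos[OF j] d
        by (intro mult_left_mono mult_right_mono) (auto simp: k_def \<delta>_def)
      also have "\<dots> = cmod (y j) * (k j * (cmod (dft_kernel n j u) * \<bar>v j - \<bar>u\<bar>\<bar>))"
        by (simp add: x_def abs_minus_commute mult_ac)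
      also have "\<dots> \<le> cmod (y j) * (k j * sqrt (pi / (2 * n)))"
        using cmod_dft_kernel_mult_le[of j n u] j x k[of j] by (intro mult_left_mono) (auto simp: v_def J_def)
      finally show ?thesis .
    qed
    have "x powr (- 2 * d) * (cmod (\<Sum>j\<in>J. c j * dft_kernel n j u))\<^sup>2 = (cmod (\<Sum>j\<in>J. x powr (- d) * c j * dft_kernel n j u))\<^sup>2"
      using x by (simp add: norm_mult power_mult_distrib powr_power mult.assoc flip: sum_distrib_left)
    also have "(\<Sum>j\<in>J. x powr (- d) * c j * dft_kernel n j u) =
       (\<Sum>j\<in>J. y j * dft_kernel n j u) + (\<Sum>j\<in>J. (x powr (- d) * c j - y j) * dft_kernel n j u)"
      by (simp add: algebra_simps flip: sum.distrib)
    also have "(cmod \<dots>)\<^sup>2 \<le> 2 * (T u)\<^sup>2 + 2 * (cmod (\<Sum>j\<in>J. (x powr (- d) * c j - y j) * dft_kernel n j u))\<^sup>2"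
      unfolding T_def by (rule norm_add_power2_le)
    also have "(cmod (\<Sum>j\<in>J. (x powr (- d) * c j - y j) * dft_kernel n j u))\<^sup>2 \<le>
       (\<Sum>j\<in>J. cmod (y j) * (k j * sqrt (pi / (2 * n))))\<^sup>2"
      by (intro power_mono order_trans[OF norm_sum] sum_mono cterm) auto
    also have "(\<Sum>j\<in>J. cmod (y j) * (k j * sqrt (pi / (2 * n))))\<^sup>2 = pi / (2 * n) * (\<Sum>j\<in>J. cmod (y j) * k j)\<^sup>2"
      by (simp add: power_mult_distrib flip: sum_distrib_right mult.assoc)
    \<comment> \<open>Cauchy-Schwarz with the factors \<open>v j powr (- 1 / 4)\<close> and
      \<open>v j powr (1 / 4)\<close>: the first sum becomes the Schur sum with weight
      \<open>v j powr (- 1 / 2)\<close>, the second one is the sum that defines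
      \<open>R\<close>.\<close>
    also have "(\<Sum>j\<in>J. cmod (y j) * k j)\<^sup>2 =
      (\<Sum>j\<in>J. (sqrt (k j) * v j powr (- 1 / 4)) * (sqrt (k j) * v j powr (1 / 4) * cmod (y j)))\<^sup>2"
    proof -
      have eq: "cmod (y j) * k j = (sqrt (k j) * v j powr (- 1 / 4)) * (sqrt (k j) * v j powr (1 / 4) * cmod (y j))"
        if "j \<in> J" for j
      proof -
        have "(sqrt (k j) * v j powr (- 1 / 4)) * (sqrt (k j) * v j powr (1 / 4) * cmod (y j)) =
          (sqrt (k j) * sqrt (k j)) * (v j powr (- 1 / 4) * v j powr (1 / 4)) * cmod (y j)"
          by (simp only: mult_ac)
        also have "\<dots> = k j * cmod (y j)" using k[of j] vpos[OF that] by (simp flip: powr_add)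
        finally show ?thesis by (simp only: mult.commute[of "cmod (y j)"])
      qed
      show ?thesis by (intro arg_cong[where f = "\<lambda>x. x\<^sup>2"] sum.cong refl eq)
    qed
    also have "\<dots> \<le> (\<Sum>j\<in>J. (sqrt (k j) * v j powr (- 1 / 4))\<^sup>2) * (\<Sum>j\<in>J. (sqrt (k j) * v j powr (1 / 4) * cmod (y j))\<^sup>2)"
      by (rule Cauchy_Schwarz_ineq_sum)
    also have "(\<Sum>j\<in>J. (sqrt (k j) * v j powr (- 1 / 4))\<^sup>2) = (\<Sum>j\<in>J. schur_kernel \<delta> (v j) x * v j powr (- 1 / 2))"
      using k vpos by (intro sum.cong refl) (simp add: power_mult_distrib powr_square k_def schur_kernel_commute)
    also have "\<dots> = (\<Sum>j=1..nu n. schur_kernel \<delta> (real j * (2 * pi / n)) x * (real j * (2 * pi / n)) powr (- 1 / 2))"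
      by (simp add: J_def v_def fourier_freq_def mult_ac)
    \<comment> \<open>The mesh is 2 pi / n, so the sum is n / (2 pi) times a Riemann sum. This n
      cancels the 1 / n from the squared decay of the kernels, and the final constant does not
      depend on n.\<close>
    also have "\<dots> \<le> n / (2 * pi) * (K * x powr (- 1 / 2))"
    proof -
      define \<Sigma> where "\<Sigma> = (\<Sum>j=1..nu n. schur_kernel \<delta> (real j * (2 * pi / n)) x * (real j * (2 * pi / n)) powr (- 1 / 2))"
      have "2 * pi / n * \<Sigma> \<le> 2 * x powr (- 1 / 2) / (1 / 2 - \<delta>)"
        unfolding \<Sigma>_def using n by (intro sum_schur_kernel_le[OF \<delta> x(1)]) auto
      also have "\<dots> = K * x powr (- 1 / 2)" by (simp add: K_def \<delta>_def)
      finally have "n / (2 * pi) * (2 * pi / n * \<Sigma>) \<le> n / (2 * pi) * (K * x powr (- 1 / 2))"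
        by (intro mult_left_mono) auto
      moreover have "n / (2 * pi) * (2 * pi / n * \<Sigma>) = \<Sigma>" using n by simp
      ultimately show ?thesis by (simp only: \<Sigma>_def)
    qed
    also have "(\<Sum>j\<in>J. (sqrt (k j) * v j powr (1 / 4) * cmod (y j))\<^sup>2) = (\<Sum>j\<in>J. (cmod (y j))\<^sup>2 * sqrt (v j) * k j)"
      using k vpos by (intro sum.cong refl) (simp add: power_mult_distrib powr_square powr_half_sqrt less_imp_le)
    finally have "x powr (- 2 * d) * (cmod (\<Sum>j\<in>J. c j * dft_kernel n j u))\<^sup>2
       \<le> 2 * (T u)\<^sup>2 + 2 * (pi / (2 * n) * (n / (2 * pi) * (K * x powr (- 1 / 2)) * (\<Sum>j\<in>J. (cmod (y j))\<^sup>2 * sqrt (v j) * k j)))"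
      using k vpos by (auto simp: mult_left_mono mult_right_mono divide_right_mono sum_nonneg)
    also have "\<dots> = 2 * (T u)\<^sup>2 + K / 2 * R u"
      using n by (simp add: R_def k_def x_def sum_distrib_left sum_distrib_right field_simps)
    finally show ?thesis by (simp add: x_def)
  qed
  have ae: "AE u in circle_measure. \<bar>u\<bar> powr (- 2 * d) * (cmod (\<Sum>j\<in>J. c j * dft_kernel n j u))\<^sup>2 \<le> 2 * (T u)\<^sup>2 + K / 2 * R u"
    using AE_circle_nonzero AE_space by eventually_elim (rule point; simp)
  have meas: "(\<lambda>u. \<bar>u\<bar> powr (- 2 * d) * (cmod (\<Sum>j\<in>J. c j * dft_kernel n j u))\<^sup>2) \<in> borel_measurable circle_measure"
  proof (intro borel_measurable_times)
    show "(\<lambda>u. \<bar>u\<bar> powr (- 2 * d)) \<in> borel_measurable circle_measure"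
      by (intro measurable_completion measurable_restrict_space1) measurable
  qed measurable
  have int_bound: "integrable circle_measure (\<lambda>u. 2 * (T u)\<^sup>2 + K / 2 * R u)"
    using int_T int_R by simp
  show int: "integrable circle_measure (\<lambda>u. \<bar>u\<bar> powr (- 2 * d) * (cmod (\<Sum>j\<in>{1..nu n}. c j * dft_kernel n j u))\<^sup>2)"
    unfolding J_def[symmetric]
  proof (rule Bochner_Integration.integrable_bound[OF int_bound meas], use ae in eventually_elim)
    case (elim u)
    have "0 \<le> \<bar>u\<bar> powr (- 2 * d) * (cmod (\<Sum>j\<in>J. c j * dft_kernel n j u))\<^sup>2" by simp
    then show ?case using elim unfolding real_norm_def by linarith
  qed
  have "(LINT u|circle_measure. \<bar>u\<bar> powr (- 2 * d) * (cmod (\<Sum>j\<in>J. c j * dft_kernel n j u))\<^sup>2)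
    \<le> (LINT u|circle_measure. 2 * (T u)\<^sup>2 + K / 2 * R u)"
    using int int_bound ae by (intro integral_mono_AE) (auto simp: J_def)
  also have "\<dots> = 2 * (\<Sum>j\<in>J. (cmod (y j))\<^sup>2) + K / 2 * (\<Sum>j\<in>J. (cmod (y j))\<^sup>2 * sqrt (v j) *
       (LINT u|circle_measure. schur_kernel \<delta> \<bar>u\<bar> (v j) * \<bar>u\<bar> powr (- 1 / 2)))"
  proof -
    have "(LINT u|circle_measure. (T u)\<^sup>2) = (\<Sum>j\<in>J. (cmod (y j))\<^sup>2)"
      unfolding T_def J_def by (rule dft_kernel_orthonormal)
    moreover have "(LINT u|circle_measure. R u) = (\<Sum>j\<in>J. (cmod (y j))\<^sup>2 * sqrt (v j) *
       (LINT u|circle_measure. schur_kernel \<delta> \<bar>u\<bar> (v j) * \<bar>u\<bar> powr (- 1 / 2)))"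
      unfolding R_def by (subst Bochner_Integration.integral_sum, intro integrable_mult_right int_S, assumption, simp)
    ultimately show ?thesis using int_T int_R by simp
  qed
  \<comment> \<open>The second half of Schur's test. The sum over frequencies in
    \<open>point\<close> gave one factor \<open>K\<close>, the integral over \<open>u\<close> gives
    another; together they are the \<open>K\<^sup>2\<close> of the statement.\<close>
  also have "\<dots> \<le> 2 * (\<Sum>j\<in>J. (cmod (y j))\<^sup>2) + K / 2 * (\<Sum>j\<in>J. (cmod (y j))\<^sup>2 * sqrt (v j) * (2 * (K * v j powr (- 1 / 2))))"
    using K vpos int_S(2) by (intro add_left_mono mult_left_mono sum_mono) (auto intro!: mult_nonneg_nonneg simp: less_imp_le)
  also have "\<dots> = 2 * (\<Sum>j\<in>J. (cmod (y j))\<^sup>2) + K / 2 * (\<Sum>j\<in>J. 2 * K * (cmod (y j))\<^sup>2)"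
  proof -
    have "sqrt (v j) * v j powr (- 1 / 2) = 1" if "j \<in> J" for j
      using vpos[OF that] by (simp add: powr_half_sqrt[symmetric] flip: powr_add)
    moreover have "(cmod (y j))\<^sup>2 * sqrt (v j) * (2 * (K * v j powr (- 1 / 2))) =
        2 * K * (cmod (y j))\<^sup>2 * (sqrt (v j) * v j powr (- 1 / 2))" for j
      by (simp only: mult_ac)
    ultimately have eq: "(cmod (y j))\<^sup>2 * sqrt (v j) * (2 * (K * v j powr (- 1 / 2))) = 2 * K * (cmod (y j))\<^sup>2" if "j \<in> J" for j
      using that by (simp only: mult_1_right)
    show ?thesis by (intro arg_cong2[where f = "(+)"] arg_cong[where f = "\<lambda>x. K / 2 * x"] sum.cong refl eq)
  qed
  also have "\<dots> = (2 + K\<^sup>2) * (\<Sum>j\<in>J. (cmod (c j))\<^sup>2 * v j powr (- 2 * d))"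
  proof -
    have "(\<Sum>j\<in>J. (cmod (y j))\<^sup>2) = (\<Sum>j\<in>J. (cmod (c j))\<^sup>2 * v j powr (- 2 * d))"
      by (intro sum.cong refl y2)
    then show ?thesis
      unfolding sum_distrib_left[symmetric] by (simp only: power2_eq_square) (simp add: algebra_simps)
  qed
  finally show "(LINT u|circle_measure. \<bar>u\<bar> powr (- 2 * d) * (cmod (\<Sum>j\<in>{1..nu n}. c j * dft_kernel n j u))\<^sup>2)
      \<le> (2 + K\<^sup>2) * (\<Sum>j\<in>{1..nu n}. (cmod (c j))\<^sup>2 * fourier_freq n j powr (- 2 * d))"
    by (simp add: J_def v_def)
qed


section \<open>From the operator inequality to the Hilbert-Schmidt norm\<close>

lemma sum_delta_mult:
  fixes a :: "'i \<Rightarrow> 'b::comm_ring_1"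
  assumes "finite J" "k \<in> J"
  shows "(\<Sum>j\<in>J. (if j = k then 1 else 0) * a j) = a k"
proof -
  have "(\<Sum>j\<in>J. (if j = k then 1 else 0) * a j) = (\<Sum>j\<in>J. if j = k then a j else 0)"
    by (intro sum.cong refl) simp
  then show ?thesis using assms by simp
qed

text \<open>The operator inequality is applied, for each \<open>u\<close>, to the coefficients
  \<open>b\<^sub>j\<close> times the conjugate of \<open>\<phi>\<^sub>j(u)\<close> and then integrated against \<open>f\<close>.\<close>

lemma hilbert_schmidt_bound:
  fixes \<phi> :: "'i \<Rightarrow> 'x \<Rightarrow> complex" and f :: "'x \<Rightarrow> real" and b w :: "'i \<Rightarrow> real"
  assumes "finite J"
    and int: "\<And>j k. j \<in> J \<Longrightarrow> k \<in> J \<Longrightarrow> integrable M (\<lambda>u. of_real (f u) * (\<phi> j u * cnj (\<phi> k u)))"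
    and f: "\<And>u. 0 \<le> f u" and K: "0 \<le> K" and w: "\<And>j. j \<in> J \<Longrightarrow> 0 \<le> w j"
    and op: "\<And>c. (LINT u|M. f u * (cmod (\<Sum>j\<in>J. c j * \<phi> j u))\<^sup>2) \<le> K * (\<Sum>j\<in>J. (cmod (c j))\<^sup>2 * w j)"
  shows "(\<Sum>j\<in>J. \<Sum>k\<in>J. b j * b k * (cmod (LINT u|M. of_real (f u) * (\<phi> j u * cnj (\<phi> k u))))\<^sup>2)
    \<le> K\<^sup>2 * (\<Sum>j\<in>J. (b j * w j)\<^sup>2)"
proof -
  define S where "S j k = (LINT u|M. of_real (f u) * (\<phi> j u * cnj (\<phi> k u)))" for j k
  have S_cnj: "cnj (S j k) = S k j" for j k
    unfolding S_def Bochner_Integration.integral_cnj[symmetric] by (simp add: mult_ac)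
  have expand: "complex_of_real (f u * (cmod (\<Sum>j\<in>J. c j * \<phi> j u))\<^sup>2) =
      (\<Sum>j\<in>J. \<Sum>k\<in>J. (c j * cnj (c k)) * (of_real (f u) * (\<phi> j u * cnj (\<phi> k u))))" for c u
  proof -
    have "complex_of_real (f u * (cmod (\<Sum>j\<in>J. c j * \<phi> j u))\<^sup>2) =
        of_real (f u) * ((\<Sum>j\<in>J. c j * \<phi> j u) * cnj (\<Sum>j\<in>J. c j * \<phi> j u))"
      by (simp only: of_real_mult complex_norm_square)
    also have "\<dots> = of_real (f u) * (\<Sum>j\<in>J. \<Sum>k\<in>J. (c j * \<phi> j u) * cnj (c k * \<phi> k u))"
      by (simp only: cnj_sum sum_product)
    also have "\<dots> = (\<Sum>j\<in>J. \<Sum>k\<in>J. (c j * cnj (c k)) * (of_real (f u) * (\<phi> j u * cnj (\<phi> k u))))"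
      unfolding sum_distrib_left by (intro sum.cong refl) (simp add: mult_ac)
    finally show ?thesis .
  qed
  have form: "complex_of_real (LINT u|M. f u * (cmod (\<Sum>j\<in>J. c j * \<phi> j u))\<^sup>2) = (\<Sum>j\<in>J. \<Sum>k\<in>J. (c j * cnj (c k)) * S j k)" for c
  proof -
    have "complex_of_real (LINT u|M. f u * (cmod (\<Sum>j\<in>J. c j * \<phi> j u))\<^sup>2) =
      (LINT u|M. (\<Sum>j\<in>J. \<Sum>k\<in>J. (c j * cnj (c k)) * (of_real (f u) * (\<phi> j u * cnj (\<phi> k u)))))"
      unfolding expand[symmetric] by (rule integral_complex_of_real[symmetric])
    also have "\<dots> = (\<Sum>j\<in>J. \<Sum>k\<in>J. (c j * cnj (c k)) * S j k)"
      unfolding S_def using int by (simp add: Bochner_Integration.integral_sum)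
    finally show ?thesis .
  qed
  have diag: "integrable M (\<lambda>u. f u * (cmod (\<phi> j u))\<^sup>2)" "(LINT u|M. f u * (cmod (\<phi> j u))\<^sup>2) \<le> K * w j"
    if j: "j \<in> J" for j
  proof -
    have eq: "complex_of_real (f u * (cmod (\<phi> j u))\<^sup>2) = of_real (f u) * (\<phi> j u * cnj (\<phi> j u))" for u
      unfolding of_real_mult complex_norm_square ..
    have "integrable M (\<lambda>u. complex_of_real (f u * (cmod (\<phi> j u))\<^sup>2))"
      unfolding eq by (rule int[OF j j])
    then show "integrable M (\<lambda>u. f u * (cmod (\<phi> j u))\<^sup>2)"
      by (subst (asm) complex_of_real_integrable_eq)
    have "(\<Sum>i\<in>J. (cmod (if i = j then 1 else 0))\<^sup>2 * w i) = (\<Sum>i\<in>J. (if i = j then 1 else 0) * w i)"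
      by (intro sum.cong refl) simp
    then show "(LINT u|M. f u * (cmod (\<phi> j u))\<^sup>2) \<le> K * w j"
      using op[of "\<lambda>i. if i = j then 1 else 0"] by (simp add: sum_delta_mult[OF \<open>finite J\<close> j])
  qed
  define h where "h u = (LINT v|M. f v * (cmod (\<Sum>j\<in>J. (b j * cnj (\<phi> j u)) * \<phi> j v))\<^sup>2)" for u
  have h_le: "h u \<le> K * (\<Sum>j\<in>J. (b j)\<^sup>2 * w j * (cmod (\<phi> j u))\<^sup>2)" for u
  proof -
    have "h u \<le> K * (\<Sum>j\<in>J. (cmod (b j * cnj (\<phi> j u)))\<^sup>2 * w j)"
      unfolding h_def by (rule op)
    also have "\<dots> = K * (\<Sum>j\<in>J. (b j)\<^sup>2 * w j * (cmod (\<phi> j u))\<^sup>2)"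
      by (simp add: norm_mult power_mult_distrib mult_ac)
    finally show ?thesis .
  qed
  \<comment> \<open>The indices are swapped in the last factor: its integral is
    \<open>S k j\<close>, the conjugate of \<open>S j k\<close>, and the product of the two is the
    squared modulus.\<close>
  have h_eq: "complex_of_real (f u * h u) =
     (\<Sum>j\<in>J. \<Sum>k\<in>J. (b j * b k * S j k) * (of_real (f u) * (\<phi> k u * cnj (\<phi> j u))))" for u
    unfolding h_def of_real_mult form sum_distrib_left by (intro sum.cong refl) (simp add: mult_ac)
  have int_h: "integrable M (\<lambda>u. f u * h u)"
  proof -
    have "integrable M (\<lambda>u. complex_of_real (f u * h u))"
      unfolding h_eq using int by (intro Bochner_Integration.integrable_sum integrable_mult_right) auto
    then show ?thesis by (subst (asm) complex_of_real_integrable_eq)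
  qed
  have "complex_of_real (\<Sum>j\<in>J. \<Sum>k\<in>J. b j * b k * (cmod (S j k))\<^sup>2) = (\<Sum>j\<in>J. \<Sum>k\<in>J. (b j * b k * S j k) * S k j)"
    by (simp only: of_real_sum of_real_mult complex_norm_square S_cnj mult.assoc)
  also have "\<dots> = (LINT u|M. (\<Sum>j\<in>J. \<Sum>k\<in>J. (b j * b k * S j k) * (of_real (f u) * (\<phi> k u * cnj (\<phi> j u)))))"
    using int by (simp add: Bochner_Integration.integral_sum flip: S_def)
  also have "\<dots> = complex_of_real (LINT u|M. f u * h u)"
    unfolding h_eq[symmetric] by (rule integral_complex_of_real)
  finally have "(\<Sum>j\<in>J. \<Sum>k\<in>J. b j * b k * (cmod (S j k))\<^sup>2) = (LINT u|M. f u * h u)"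
    unfolding of_real_eq_iff .
  \<comment> \<open>Here \<open>h_le\<close> replaces the products of weights by squares, whatever
    their signs. The remaining diagonal integrals are estimated by \<open>diag\<close>, the operator
    inequality for a unit vector, which supplies the second factor \<open>K\<close>.\<close>
  also have "\<dots> \<le> (LINT u|M. (\<Sum>j\<in>J. (K * ((b j)\<^sup>2 * w j)) * (f u * (cmod (\<phi> j u))\<^sup>2)))"
  proof (rule integral_mono[OF int_h])
    show "integrable M (\<lambda>u. \<Sum>j\<in>J. (K * ((b j)\<^sup>2 * w j)) * (f u * (cmod (\<phi> j u))\<^sup>2))"
      using diag by (intro Bochner_Integration.integrable_sum integrable_mult_right) auto
    show "f u * h u \<le> (\<Sum>j\<in>J. (K * ((b j)\<^sup>2 * w j)) * (f u * (cmod (\<phi> j u))\<^sup>2))" for u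
      using mult_left_mono[OF h_le f, of u u] by (simp add: sum_distrib_left mult_ac)
  qed
  also have "\<dots> = (\<Sum>j\<in>J. (K * ((b j)\<^sup>2 * w j)) * (LINT u|M. f u * (cmod (\<phi> j u))\<^sup>2))"
    using diag by (subst Bochner_Integration.integral_sum) (auto intro!: integrable_mult_right)
  also have "\<dots> \<le> (\<Sum>j\<in>J. (K * ((b j)\<^sup>2 * w j)) * (K * w j))"
    using diag K w by (intro sum_mono mult_left_mono) auto
  also have "\<dots> = K\<^sup>2 * (\<Sum>j\<in>J. (b j * w j)\<^sup>2)"
    by (simp add: sum_distrib_left power2_eq_square mult_ac)
  finally show ?thesis by (simp add: S_def)
qed

section \<open>Bias of the periodogram\<close>

text \<open>The integrand is the Fejer decay of order -2 multiplied by a growth of order \<beta>.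
  Its antiderivative is explicit on each side of \<open>v\<close>; for \<open>\<beta> = 1\<close> it
  would be a logarithm, which is why exponents below 1 are used throughout.\<close>

lemma has_integral_fejer_majorant:
  fixes n v \<beta> :: real
  assumes n: "0 < n" and \<beta>: "\<beta> < 1" and v: "0 \<le> v" "v \<le> pi"
  obtains I where "((\<lambda>y. (1 + n * \<bar>y - v\<bar>) powr (\<beta> - 2)) has_integral I) {0..pi}" "I \<le> 2 / (n * (1 - \<beta>))"
proof -
  define P where "P z = z powr (\<beta> - 1) / (n * (1 - \<beta>))" for z :: real
  have nb: "0 < n * (1 - \<beta>)" using n \<beta> by simp
  have dP: "(P has_real_derivative - (z powr (\<beta> - 2) / n)) (at z)" if "0 < z" for z
  proof -
    have "(P has_real_derivative ((\<beta> - 1) * z powr (\<beta> - 1 - 1)) / (n * (1 - \<beta>))) (at z)"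
      unfolding P_def[abs_def] using that by (intro DERIV_cdivide has_real_derivative_powr)
    also have "((\<beta> - 1) * z powr (\<beta> - 1 - 1)) / (n * (1 - \<beta>)) = - (z powr (\<beta> - 2) / n)"
      using n \<beta> by (simp add: field_simps)
    finally show ?thesis .
  qed
  have left: "((\<lambda>y. (1 + n * \<bar>y - v\<bar>) powr (\<beta> - 2)) has_integral (P (1 + n * (v - v)) - P (1 + n * (v - 0)))) {0..v}"
  proof (rule fundamental_theorem_of_calculus[OF v(1)])
    fix y assume y: "y \<in> {0..v}"
    have pos: "0 < 1 + n * (v - y)" using n y by (intro add_pos_nonneg) auto
    have "((\<lambda>y. P (1 + n * (v - y))) has_real_derivative - ((1 + n * (v - y)) powr (\<beta> - 2) / n) * (n * (0 - 1))) (at y within {0..v})"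
      by (rule DERIV_chain2[where f = P and g = "\<lambda>y. 1 + n * (v - y)"], rule dP[OF pos]) (auto intro!: derivative_eq_intros)
    moreover have "- ((1 + n * (v - y)) powr (\<beta> - 2) / n) * (n * (0 - 1)) = (1 + n * \<bar>y - v\<bar>) powr (\<beta> - 2)"
    proof -
      have "\<bar>y - v\<bar> = v - y" using y by auto
      then show ?thesis using n by simp
    qed
    ultimately show "((\<lambda>y. P (1 + n * (v - y))) has_vector_derivative (1 + n * \<bar>y - v\<bar>) powr (\<beta> - 2)) (at y within {0..v})"
      by (simp only: has_real_derivative_iff_has_vector_derivative)
  qed
  have right: "((\<lambda>y. (1 + n * \<bar>y - v\<bar>) powr (\<beta> - 2)) has_integral (- P (1 + n * (pi - v)) - - P (1 + n * (v - v)))) {v..pi}"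
  proof (rule fundamental_theorem_of_calculus[OF v(2)])
    fix y assume y: "y \<in> {v..pi}"
    have pos: "0 < 1 + n * (y - v)" using n y by (intro add_pos_nonneg) auto
    have "((\<lambda>y. - P (1 + n * (y - v))) has_real_derivative - (- ((1 + n * (y - v)) powr (\<beta> - 2) / n) * (n * (1 - 0)))) (at y within {v..pi})"
      by (rule DERIV_minus, rule DERIV_chain2[where f = P and g = "\<lambda>y. 1 + n * (y - v)"], rule dP[OF pos]) (auto intro!: derivative_eq_intros)
    moreover have "- (- ((1 + n * (y - v)) powr (\<beta> - 2) / n) * (n * (1 - 0))) = (1 + n * \<bar>y - v\<bar>) powr (\<beta> - 2)"
      using n y by simp
    ultimately show "((\<lambda>y. - P (1 + n * (y - v))) has_vector_derivative (1 + n * \<bar>y - v\<bar>) powr (\<beta> - 2)) (at y within {v..pi})"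
      by (simp only: has_real_derivative_iff_has_vector_derivative)
  qed
  have P0: "0 \<le> P z" for z using nb by (simp add: P_def)
  have P1: "P 1 = 1 / (n * (1 - \<beta>))" by (simp add: P_def)
  show thesis
  proof
    show "((\<lambda>y. (1 + n * \<bar>y - v\<bar>) powr (\<beta> - 2)) has_integral
        ((P (1 + n * (v - v)) - P (1 + n * (v - 0))) + (- P (1 + n * (pi - v)) - - P (1 + n * (v - v))))) {0..pi}"
      by (rule has_integral_combine[OF v left right])
    show "(P (1 + n * (v - v)) - P (1 + n * (v - 0))) + (- P (1 + n * (pi - v)) - - P (1 + n * (v - v))) \<le> 2 / (n * (1 - \<beta>))"
      using P0[of "1 + n * (v - 0)"] P0[of "1 + n * (pi - v)"] P1 by simp
  qed
qed

lemma circle_measurable_even: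
  fixes F :: "real \<Rightarrow> real"
  assumes "F \<in> borel_measurable borel"
  shows "(\<lambda>u. F \<bar>u\<bar>) \<in> borel_measurable circle_measure"
  by (intro measurable_completion measurable_restrict_space1) (use assms in measurable)

text \<open>The squared kernel has mass 1 and width 1 / n, hence the order
  \<open>n powr (- \<beta>)\<close>. The constant 16 collects 4 from the pointwise bound and two
  factors 2, one from folding and one from the two sides of the peak.\<close>

lemma dft_kernel_moment:
  assumes j: "j \<in> {1..nu n}" and \<beta>: "0 \<le> \<beta>" "\<beta> < 1"
  shows "integrable circle_measure (\<lambda>u. \<bar>\<bar>u\<bar> - fourier_freq n j\<bar> powr \<beta> * (cmod (dft_kernel n j u))\<^sup>2)"
    "(LINT u|circle_measure. \<bar>\<bar>u\<bar> - fourier_freq n j\<bar> powr \<beta> * (cmod (dft_kernel n j u))\<^sup>2)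
      \<le> 16 / (1 - \<beta>) * n powr (- \<beta>)"
proof -
  define v where "v = fourier_freq n j"
  have n: "0 < real n" using nu_bound[OF j] by simp
  have v: "0 \<le> v" "v \<le> pi" using fourier_freq_bounds[OF j] by (auto simp: v_def)
  obtain I where I: "((\<lambda>y. (1 + n * \<bar>y - v\<bar>) powr (\<beta> - 2)) has_integral I) {0..pi}" "I \<le> 2 / (n * (1 - \<beta>))"
    using has_integral_fejer_majorant[OF n \<beta>(2) v] .
  define F where "F y = 4 * n powr (1 - \<beta>) * (1 + n * \<bar>y - v\<bar>) powr (\<beta> - 2)" for y
  have hF: "(F has_integral (4 * n powr (1 - \<beta>) * I)) {0..pi}"
    unfolding F_def by (rule has_integral_mult_right[OF I(1)])
  note even = even_circle_integral[OF hF]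
  have iF: "integrable circle_measure (\<lambda>u. F \<bar>u\<bar>)" and eF: "(LINT u|circle_measure. F \<bar>u\<bar>) = 2 * (4 * n powr (1 - \<beta>) * I)"
    by (rule even; simp add: F_def)+
  have le: "\<bar>\<bar>u\<bar> - v\<bar> powr \<beta> * (cmod (dft_kernel n j u))\<^sup>2 \<le> F \<bar>u\<bar>" if "u \<in> {-pi..pi}" for u
  proof -
    define w where "w = \<bar>\<bar>u\<bar> - v\<bar>"
    have w: "0 \<le> w" "0 < 1 + n * w" using n by (auto simp: w_def intro!: add_pos_nonneg)
    have "n powr \<beta> * w powr \<beta> \<le> (1 + n * w) powr \<beta>"
      using n w \<beta> by (subst powr_mult[symmetric]) (auto intro!: powr_mono2)
    then have "n powr (- \<beta>) * (n powr \<beta> * w powr \<beta>) \<le> n powr (- \<beta>) * (1 + n * w) powr \<beta>"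
      by (intro mult_left_mono) auto
    moreover have "n powr (- \<beta>) * (n powr \<beta> * w powr \<beta>) = w powr \<beta>"
      using n by (simp flip: powr_add mult.assoc)
    ultimately have "w powr \<beta> \<le> n powr (- \<beta>) * (1 + n * w) powr \<beta>" by simp
    moreover have "(cmod (dft_kernel n j u))\<^sup>2 \<le> 4 * real n / (1 + real n * w)\<^sup>2"
      unfolding w_def v_def using cmod_dft_kernel_power2_le[OF j, of u] that by (simp add: abs_le_iff)
    ultimately have "w powr \<beta> * (cmod (dft_kernel n j u))\<^sup>2 \<le> (n powr (- \<beta>) * (1 + n * w) powr \<beta>) * (4 * n / (1 + n * w)\<^sup>2)"
      by (intro mult_mono) auto
    also have "\<dots> = 4 * (n powr (- \<beta>) * n powr 1) * ((1 + n * w) powr \<beta> / (1 + n * w) powr 2)"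
      using n w by (simp add: powr_numeral)
    also have "\<dots> = F \<bar>u\<bar>"
      unfolding powr_add[symmetric] powr_diff[symmetric] by (simp add: F_def w_def)
    finally show ?thesis by (simp add: w_def)
  qed
  have meas: "(\<lambda>u. \<bar>\<bar>u\<bar> - v\<bar> powr \<beta> * (cmod (dft_kernel n j u))\<^sup>2) \<in> borel_measurable circle_measure"
    by (intro borel_measurable_times circle_measurable_even[where F = "\<lambda>y. \<bar>y - v\<bar> powr \<beta>"]) measurable
  show int: "integrable circle_measure (\<lambda>u. \<bar>\<bar>u\<bar> - fourier_freq n j\<bar> powr \<beta> * (cmod (dft_kernel n j u))\<^sup>2)"
    unfolding v_def[symmetric]
  proof (rule Bochner_Integration.integrable_bound[OF iF meas], intro AE_I2)
    fix u assume "u \<in> space circle_measure"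
    then show "norm (\<bar>\<bar>u\<bar> - v\<bar> powr \<beta> * (cmod (dft_kernel n j u))\<^sup>2) \<le> norm (F \<bar>u\<bar>)"
      using le[of u] by (auto simp: abs_mult)
  qed
  have "(LINT u|circle_measure. \<bar>\<bar>u\<bar> - v\<bar> powr \<beta> * (cmod (dft_kernel n j u))\<^sup>2) \<le> (LINT u|circle_measure. F \<bar>u\<bar>)"
    using int iF le by (intro integral_mono) (auto simp: v_def)
  also have "\<dots> = 8 * n powr (1 - \<beta>) * I" using eF by simp
  also have "\<dots> \<le> 8 * n powr (1 - \<beta>) * (2 / (n * (1 - \<beta>)))"
    using I(2) by (intro mult_left_mono) auto
  also have "\<dots> = 16 / (1 - \<beta>) * n powr (- \<beta>)"
    using n \<beta> by (simp add: powr_diff powr_minus field_simps)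
  finally show "(LINT u|circle_measure. \<bar>\<bar>u\<bar> - fourier_freq n j\<bar> powr \<beta> * (cmod (dft_kernel n j u))\<^sup>2)
      \<le> 16 / (1 - \<beta>) * n powr (- \<beta>)" by (simp add: v_def)
qed

text \<open>In this range the peak is at distance at least \<open>v / 2\<close>, so the squared
  kernel is at most \<open>c = 2 * pi / (n * v\<^sup>2)\<close>. The singular power is integrable
  since \<open>2 * \<delta> < 1\<close> and contributes the order
  \<open>v powr (1 - 2 * \<delta>)\<close>.\<close>

lemma dft_kernel_origin:
  assumes j: "j \<in> {1..nu n}" and \<delta>: "0 \<le> \<delta>" "\<delta> < 1 / 2"
  shows "integrable circle_measure (\<lambda>u. (if \<bar>u\<bar> \<le> fourier_freq n j / 2 then \<bar>u\<bar> powr (- 2 * \<delta>) else 0) * (cmod (dft_kernel n j u))\<^sup>2)"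
    "(LINT u|circle_measure. (if \<bar>u\<bar> \<le> fourier_freq n j / 2 then \<bar>u\<bar> powr (- 2 * \<delta>) else 0) * (cmod (dft_kernel n j u))\<^sup>2)
      \<le> 16 / (1 - 2 * \<delta>) * (fourier_freq n j powr (- 1 - 2 * \<delta>) / n)"
proof -
  define v where "v = fourier_freq n j"
  have n: "0 < real n" using nu_bound[OF j] by simp
  have v: "0 < v" "v < pi" using fourier_freq_bounds[OF j] by (auto simp: v_def)
  define I where "I = (v / 2) powr (1 - 2 * \<delta>) / (1 - 2 * \<delta>)"
  define h where "h y = (if y \<le> v / 2 then y powr (- 2 * \<delta>) else 0)" for y :: real
  define c where "c = 2 * pi / (n * v\<^sup>2)"
  have c: "0 \<le> c" by (simp add: c_def)
  have "((\<lambda>y. y powr (- 2 * \<delta>)) has_integral I) {0..v / 2}"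
    using has_integral_powr_from_0[of "- 2 * \<delta>" "v / 2"] v \<delta> by (simp add: I_def)
  then have "((\<lambda>y. if y \<in> {0..v / 2} then y powr (- 2 * \<delta>) else 0) has_integral I) {0..pi}"
    by (subst has_integral_restrict) (use v in auto)
  then have "(h has_integral I) {0..pi}"
    by (rule has_integral_eq[rotated]) (auto simp: h_def)
  then have hF: "((\<lambda>y. c * h y) has_integral (c * I)) {0..pi}"
    by (rule has_integral_mult_right)
  note even = even_circle_integral[OF hF]
  have h0: "0 \<le> h y" for y by (simp add: h_def)
  have iF: "integrable circle_measure (\<lambda>u. c * h \<bar>u\<bar>)" and eF: "(LINT u|circle_measure. c * h \<bar>u\<bar>) = 2 * (c * I)"
    by (rule even; simp add: h0 c)+
  have le: "h \<bar>u\<bar> * (cmod (dft_kernel n j u))\<^sup>2 \<le> c * h \<bar>u\<bar>" if u: "u \<in> {-pi..pi}" for u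
  proof (cases "\<bar>u\<bar> \<le> v / 2")
    case True
    have "cmod (dft_kernel n j u) * (v / 2) \<le> cmod (dft_kernel n j u) * \<bar>v - \<bar>u\<bar>\<bar>"
      using True by (intro mult_left_mono) auto
    also have "\<dots> \<le> sqrt (pi / (2 * n))"
      unfolding v_def using cmod_dft_kernel_mult_le[OF j, of u] u by (simp add: abs_le_iff)
    finally have "(cmod (dft_kernel n j u) * (v / 2))\<^sup>2 \<le> (sqrt (pi / (2 * n)))\<^sup>2"
      using v by (intro power_mono) auto
    then have "(cmod (dft_kernel n j u))\<^sup>2 \<le> c"
      using n v by (simp add: c_def power_mult_distrib power_divide field_simps)
    then have "h \<bar>u\<bar> * (cmod (dft_kernel n j u))\<^sup>2 \<le> h \<bar>u\<bar> * c"
      by (rule mult_left_mono) (rule h0)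
    then show ?thesis by (simp only: mult.commute)
  qed (simp add: h_def)
  have meas: "(\<lambda>u. h \<bar>u\<bar> * (cmod (dft_kernel n j u))\<^sup>2) \<in> borel_measurable circle_measure"
    by (intro borel_measurable_times circle_measurable_even) (auto simp: h_def[abs_def])
  have int: "integrable circle_measure (\<lambda>u. h \<bar>u\<bar> * (cmod (dft_kernel n j u))\<^sup>2)"
  proof (rule Bochner_Integration.integrable_bound[OF iF meas], intro AE_I2)
    fix u assume "u \<in> space circle_measure"
    then show "norm (h \<bar>u\<bar> * (cmod (dft_kernel n j u))\<^sup>2) \<le> norm (c * h \<bar>u\<bar>)"
      using le[of u] h0[of "\<bar>u\<bar>"] c by (auto simp: abs_mult)
  qed
  then show "integrable circle_measure (\<lambda>u. (if \<bar>u\<bar> \<le> fourier_freq n j / 2 then \<bar>u\<bar> powr (- 2 * \<delta>) else 0) * (cmod (dft_kernel n j u))\<^sup>2)"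
    by (simp add: h_def v_def)
  have "(LINT u|circle_measure. h \<bar>u\<bar> * (cmod (dft_kernel n j u))\<^sup>2) \<le> (LINT u|circle_measure. c * h \<bar>u\<bar>)"
    using int iF le by (intro integral_mono) auto
  also have "\<dots> = 2 * (c * I)" by (rule eF)
  also have "\<dots> \<le> 16 / (1 - 2 * \<delta>) * (v powr (- 1 - 2 * \<delta>) / n)"
  proof -
    have "(v / 2) powr (1 - 2 * \<delta>) \<le> v powr (1 - 2 * \<delta>)"
      using v \<delta> by (intro powr_mono2) auto
    then have "I \<le> v powr (1 - 2 * \<delta>) / (1 - 2 * \<delta>)"
      unfolding I_def using \<delta> by (intro divide_right_mono) auto
    then have "2 * (c * I) \<le> 2 * (c * (v powr (1 - 2 * \<delta>) / (1 - 2 * \<delta>)))"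
      using c by (intro mult_left_mono) auto
    also have "\<dots> = (4 * pi) * ((v powr (1 - 2 * \<delta>) / v powr 2) / n / (1 - 2 * \<delta>))"
      using v by (simp add: c_def powr_numeral mult_ac)
    also have "v powr (1 - 2 * \<delta>) / v powr 2 = v powr (- 1 - 2 * \<delta>)"
      by (simp flip: powr_diff)
    also have "(4 * pi) * (v powr (- 1 - 2 * \<delta>) / n / (1 - 2 * \<delta>)) \<le> 16 * (v powr (- 1 - 2 * \<delta>) / n / (1 - 2 * \<delta>))"
      using pi_less_4 \<delta> by (intro mult_right_mono) auto
    finally show ?thesis by (simp add: mult.commute)
  qed
  finally show "(LINT u|circle_measure. (if \<bar>u\<bar> \<le> fourier_freq n j / 2 then \<bar>u\<bar> powr (- 2 * \<delta>) else 0) * (cmod (dft_kernel n j u))\<^sup>2)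
      \<le> 16 / (1 - 2 * \<delta>) * (fourier_freq n j powr (- 1 - 2 * \<delta>) / n)"
    by (simp add: h_def v_def)
qed

lemma integrable_mult_dft_kernel:
  assumes "integrable circle_measure f"
  shows "integrable circle_measure (\<lambda>u. f u * (cmod (dft_kernel n j u))\<^sup>2)"
    and "integrable circle_measure (\<lambda>u. complex_of_real (f u) * (dft_kernel n j u * cnj (dft_kernel n k u)))"
proof -
  have [measurable]: "f \<in> borel_measurable circle_measure" using assms by auto
  have int: "integrable circle_measure (\<lambda>u. (n / (2 * pi)) * \<bar>f u\<bar>)" using assms by simp
  have prod: "cmod (dft_kernel n i u) * cmod (dft_kernel n l u) \<le> n / (2 * pi)" for i l u
  proof -
    have "cmod (dft_kernel n i u) * cmod (dft_kernel n l u) \<le> sqrt (n / (2 * pi)) * sqrt (n / (2 * pi))"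
      by (intro mult_mono cmod_dft_kernel_le) auto
    then show ?thesis by simp
  qed
  have bound: "\<bar>f u\<bar> * (cmod (dft_kernel n i u) * cmod (dft_kernel n l u)) \<le> (n / (2 * pi)) * \<bar>f u\<bar>" for i l u
    using mult_left_mono[OF prod[of i u l], of "\<bar>f u\<bar>"] by (simp add: mult.commute)
  show "integrable circle_measure (\<lambda>u. f u * (cmod (dft_kernel n j u))\<^sup>2)"
    by (rule Bochner_Integration.integrable_bound[OF int])
      (use bound[of _ j j] in \<open>auto simp: abs_mult power2_eq_square\<close>)
  have "(\<lambda>u. complex_of_real (f u) * (dft_kernel n j u * cnj (dft_kernel n k u))) \<in> borel_measurable circle_measure"
  proof (intro borel_measurable_times)
    show "(\<lambda>u. complex_of_real (f u)) \<in> borel_measurable circle_measure" by measurable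
    show "(\<lambda>u. cnj (dft_kernel n k u)) \<in> borel_measurable circle_measure"
      by (intro borel_measurable_integrable integrable_circle_continuous continuous_intros continuous_dft_kernel)
  qed measurable
  then show "integrable circle_measure (\<lambda>u. complex_of_real (f u) * (dft_kernel n j u * cnj (dft_kernel n k u)))"
    by (rule Bochner_Integration.integrable_bound[OF int])
      (use bound[of _ j k] in \<open>auto simp: norm_mult\<close>)
qed

text \<open>As the squared kernel has mass 1, the value of \<open>f\<close> at the frequency moves
  under the integral and only differences remain; evenness carries them from (0, pi] to negative
  \<open>u\<close>. Two Hoelder terms are allowed because \<open>g\<close> and the power of
  \<open>u\<close> come with different exponents; the third term admits the singularity at
  0.\<close>

lemma dft_kernel_bias:
  assumes j: "j \<in> {1..nu n}" and int_f: "integrable circle_measure f"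
    and even: "AE u in circle_measure. f (- u) = f u"
    and \<beta>: "0 \<le> \<beta>1" "\<beta>1 < 1" "0 \<le> \<beta>2" "\<beta>2 < 1" and \<delta>: "0 \<le> \<delta>" "\<delta> < 1 / 2"
    and L: "0 \<le> L1" "0 \<le> L2" "0 \<le> L3"
    and le: "\<And>u. u \<in> {0<..pi} \<Longrightarrow> \<bar>f u - f (fourier_freq n j)\<bar> \<le> L1 * \<bar>u - fourier_freq n j\<bar> powr \<beta>1
       + L2 * \<bar>u - fourier_freq n j\<bar> powr \<beta>2 + L3 * (if u \<le> fourier_freq n j / 2 then u powr (- 2 * \<delta>) else 0)"
  shows "\<bar>(LINT u|circle_measure. f u * (cmod (dft_kernel n j u))\<^sup>2) - f (fourier_freq n j)\<bar>
    \<le> 16 / (1 - \<beta>1) * (L1 * n powr (- \<beta>1)) + 16 / (1 - \<beta>2) * (L2 * n powr (- \<beta>2))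
      + 16 / (1 - 2 * \<delta>) * (L3 * fourier_freq n j powr (- 1 - 2 * \<delta>) / n)"
proof -
  define v where "v = fourier_freq n j"
  define \<Phi> where "\<Phi> u = (cmod (dft_kernel n j u))\<^sup>2" for u
  define m1 where "m1 u = \<bar>\<bar>u\<bar> - v\<bar> powr \<beta>1 * \<Phi> u" for u
  define m2 where "m2 u = \<bar>\<bar>u\<bar> - v\<bar> powr \<beta>2 * \<Phi> u" for u
  define m3 where "m3 u = (if \<bar>u\<bar> \<le> v / 2 then \<bar>u\<bar> powr (- 2 * \<delta>) else 0) * \<Phi> u" for u
  have ints: "integrable circle_measure m1" "integrable circle_measure m2" "integrable circle_measure m3"
    using dft_kernel_moment(1)[OF j \<beta>(1,2)] dft_kernel_moment(1)[OF j \<beta>(3,4)] dft_kernel_origin(1)[OF j \<delta>]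
    by (simp_all add: m1_def[abs_def] m2_def[abs_def] m3_def[abs_def] v_def \<Phi>_def)
  have vals: "(LINT u|circle_measure. m1 u) \<le> 16 / (1 - \<beta>1) * n powr (- \<beta>1)"
    "(LINT u|circle_measure. m2 u) \<le> 16 / (1 - \<beta>2) * n powr (- \<beta>2)"
    "(LINT u|circle_measure. m3 u) \<le> 16 / (1 - 2 * \<delta>) * (v powr (- 1 - 2 * \<delta>) / n)"
    using dft_kernel_moment(2)[OF j \<beta>(1,2)] dft_kernel_moment(2)[OF j \<beta>(3,4)] dft_kernel_origin(2)[OF j \<delta>]
    by (simp_all add: m1_def m2_def m3_def v_def \<Phi>_def)
  have i1: "integrable circle_measure (\<lambda>u. f u * \<Phi> u)" and i2: "integrable circle_measure (\<lambda>u. f v * \<Phi> u)"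
    unfolding \<Phi>_def using int_f finite_measure.integrable_const[OF finite_measure_circle]
    by (intro integrable_mult_dft_kernel(1); simp)+
  have "(LINT u|circle_measure. f u * \<Phi> u) - f v = (LINT u|circle_measure. f u * \<Phi> u) - (LINT u|circle_measure. f v * \<Phi> u)"
    using dft_kernel_norm[OF j] by (simp add: \<Phi>_def)
  also have "\<dots> = (LINT u|circle_measure. f u * \<Phi> u - f v * \<Phi> u)"
    using i1 i2 by simp
  finally have "\<bar>(LINT u|circle_measure. f u * \<Phi> u) - f v\<bar> \<le> (LINT u|circle_measure. \<bar>f u * \<Phi> u - f v * \<Phi> u\<bar>)"
    by (simp add: integral_abs_bound)
  also have "\<dots> \<le> (LINT u|circle_measure. L1 * m1 u + L2 * m2 u + L3 * m3 u)"
  proof (rule integral_mono_AE)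
    show "AE u in circle_measure. \<bar>f u * \<Phi> u - f v * \<Phi> u\<bar> \<le> L1 * m1 u + L2 * m2 u + L3 * m3 u"
      using even AE_circle_nonzero AE_space
    proof eventually_elim
      case (elim u)
      have "f u = f \<bar>u\<bar>" using elim(1) by (auto simp: abs_if)
      moreover have "\<bar>f \<bar>u\<bar> - f v\<bar> \<le> L1 * \<bar>\<bar>u\<bar> - v\<bar> powr \<beta>1 + L2 * \<bar>\<bar>u\<bar> - v\<bar> powr \<beta>2
          + L3 * (if \<bar>u\<bar> \<le> v / 2 then \<bar>u\<bar> powr (- 2 * \<delta>) else 0)"
        unfolding v_def using elim by (intro le) auto
      ultimately have "\<bar>f u - f v\<bar> * \<Phi> u \<le> (L1 * \<bar>\<bar>u\<bar> - v\<bar> powr \<beta>1 + L2 * \<bar>\<bar>u\<bar> - v\<bar> powr \<beta>2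
          + L3 * (if \<bar>u\<bar> \<le> v / 2 then \<bar>u\<bar> powr (- 2 * \<delta>) else 0)) * \<Phi> u"
        by (intro mult_right_mono) (auto simp: \<Phi>_def)
      moreover have "\<bar>f u * \<Phi> u - f v * \<Phi> u\<bar> = \<bar>f u - f v\<bar> * \<Phi> u"
        by (simp add: \<Phi>_def abs_mult flip: left_diff_distrib)
      ultimately show ?case
        unfolding m1_def m2_def m3_def by (simp only: distrib_right mult.assoc)
    qed
  qed (use i1 i2 ints in auto)
  also have "\<dots> = L1 * (LINT u|circle_measure. m1 u) + L2 * (LINT u|circle_measure. m2 u) + L3 * (LINT u|circle_measure. m3 u)"
    using ints by simp
  also have "\<dots> \<le> L1 * (16 / (1 - \<beta>1) * n powr (- \<beta>1)) + L2 * (16 / (1 - \<beta>2) * n powr (- \<beta>2))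
      + L3 * (16 / (1 - 2 * \<delta>) * (v powr (- 1 - 2 * \<delta>) / n))"
    using vals L by (intro add_mono mult_left_mono) auto
  finally show ?thesis by (simp add: \<Phi>_def v_def mult_ac)
qed


section \<open>Smoothness of the spectral density relative to its size\<close>

lemma powr_relative_diff_le:
  fixes u v d \<beta> :: real
  assumes uv: "0 < u" "0 < v" and d: "2 * \<bar>d\<bar> \<le> 1" and \<beta>: "2 * \<bar>d\<bar> \<le> \<beta>" "0 \<le> \<beta>" "\<beta> \<le> 1"
  shows "\<bar>(u / v) powr (- 2 * d) - 1\<bar> \<le> 2 * (\<bar>u - v\<bar> / v) powr \<beta> + (if u \<le> v / 2 then (u / v) powr (- 2 * \<bar>d\<bar>) else 0)"
    and "2 * v < u \<Longrightarrow> (u / v) powr (2 * \<bar>d\<bar>) \<le> 2 * (\<bar>u - v\<bar> / v) powr \<beta>"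
proof -
  \<comment> \<open>Everything depends on the ratio only. For \<open>x \<le> 1 / 2\<close> the power
    itself is the bound; for \<open>x\<close> between 1/2 and 2 the difference is Lipschitz in
    \<open>x\<close>; for \<open>x > 2\<close> the growth of order \<open>2 * \<bar>d\<bar>\<close>
    is dominated by \<open>\<bar>x - 1\<bar> powr \<beta>\<close>, which requires
    \<open>2 * \<bar>d\<bar> \<le> \<beta>\<close>.\<close>
  define x where "x = u / v"
  have x: "0 < x" using uv by (simp add: x_def)
  have y: "\<bar>u - v\<bar> / v = \<bar>x - 1\<bar>" using uv by (simp add: x_def abs_if field_simps)
  have half: "u \<le> v / 2 \<longleftrightarrow> x \<le> 1 / 2" using uv by (simp add: x_def field_simps)
  have large: "x powr (2 * \<bar>d\<bar>) \<le> 2 * \<bar>x - 1\<bar> powr \<beta>" if "2 < x"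
  proof -
    have "x powr (2 * \<bar>d\<bar>) \<le> (2 * (x - 1)) powr (2 * \<bar>d\<bar>)"
      using that by (intro powr_mono2) auto
    also have "\<dots> = 2 powr (2 * \<bar>d\<bar>) * (x - 1) powr (2 * \<bar>d\<bar>)"
      using that by (subst powr_mult) auto
    also have "\<dots> \<le> 2 powr 1 * (x - 1) powr \<beta>"
      using that d \<beta> by (intro mult_mono powr_mono) auto
    finally show ?thesis using that by simp
  qed
  show "2 * v < u \<Longrightarrow> (u / v) powr (2 * \<bar>d\<bar>) \<le> 2 * (\<bar>u - v\<bar> / v) powr \<beta>"
    using large uv unfolding y by (simp add: x_def field_simps)
  have small: "t \<le> t powr \<beta>" if "0 \<le> t" "t \<le> 1" for t :: real
    using powr_mono'[of \<beta> 1 t] that \<beta> by simp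
  have "\<bar>x powr (- 2 * d) - 1\<bar> \<le> 2 * \<bar>x - 1\<bar> powr \<beta> + (if x \<le> 1 / 2 then x powr (- 2 * \<bar>d\<bar>) else 0)"
  proof (cases "x \<le> 1")
    case True
    have *: "\<bar>x powr (- 2 * d) - 1\<bar> \<le> x powr (- 2 * \<bar>d\<bar>) * (1 - x)"
      using powr_minus_one_le[of x "- 2 * d"] True x d by (simp add: abs_mult)
    show ?thesis
    proof (cases "x \<le> 1 / 2")
      case xh: True
      have "x powr (- 2 * \<bar>d\<bar>) * (1 - x) \<le> x powr (- 2 * \<bar>d\<bar>) * 1"
        using x by (intro mult_left_mono) auto
      moreover have "0 \<le> 2 * \<bar>x - 1\<bar> powr \<beta>" by simp
      ultimately have "\<bar>x powr (- 2 * d) - 1\<bar> \<le> 2 * \<bar>x - 1\<bar> powr \<beta> + x powr (- 2 * \<bar>d\<bar>)"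
        using * by linarith
      then show ?thesis using xh by simp
    next
      case False
      have "x powr (- 2 * \<bar>d\<bar>) \<le> x powr (- 1)"
        using x True d by (intro powr_mono') auto
      also have "\<dots> \<le> 2" using False x by (simp add: powr_minus field_simps)
      finally have "x powr (- 2 * \<bar>d\<bar>) * (1 - x) \<le> 2 * (1 - x) powr \<beta>"
        using small[of "1 - x"] True x by (intro mult_mono) auto
      then show ?thesis using * False True by simp
    qed
  next
    case False
    have "x powr (- 2 * d) = (1 / x) powr (2 * d)"
      using x by (simp add: powr_divide powr_minus field_simps)
    then have "\<bar>x powr (- 2 * d) - 1\<bar> \<le> (1 / x) powr (- 2 * \<bar>d\<bar>) * (1 - 1 / x)"
      using powr_minus_one_le[of "1 / x" "2 * d"] False d by (simp add: abs_mult)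
    also have "(1 / x) powr (- 2 * \<bar>d\<bar>) = x powr (2 * \<bar>d\<bar>)"
      using x by (simp add: powr_divide powr_minus field_simps)
    finally have *: "\<bar>x powr (- 2 * d) - 1\<bar> \<le> x powr (2 * \<bar>d\<bar>) * (1 - 1 / x)" .
    show ?thesis
    proof (cases "x \<le> 2")
      case True
      have "x powr (2 * \<bar>d\<bar>) * (1 - 1 / x) \<le> x powr 1 * (1 - 1 / x)"
        using False d by (intro mult_right_mono powr_mono) auto
      also have "\<dots> = x - 1" using x by (simp add: field_simps)
      also have "\<dots> \<le> (x - 1) powr \<beta>" using small[of "x - 1"] True False by simp
      also have "\<dots> \<le> 2 * (x - 1) powr \<beta>" by simp
      finally show ?thesis using * False by simp
    next
      case x2: False
      have "x powr (2 * \<bar>d\<bar>) * (1 - 1 / x) \<le> x powr (2 * \<bar>d\<bar>) * 1"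
        using x by (intro mult_left_mono) auto
      then have "\<bar>x powr (- 2 * d) - 1\<bar> \<le> 2 * \<bar>x - 1\<bar> powr \<beta>"
        using * x2 large by linarith
      then show ?thesis using False by simp
    qed
  qed
  then show "\<bar>(u / v) powr (- 2 * d) - 1\<bar> \<le> 2 * (\<bar>u - v\<bar> / v) powr \<beta> + (if u \<le> v / 2 then (u / v) powr (- 2 * \<bar>d\<bar>) else 0)"
    unfolding y half by (simp only: x_def)
qed

text \<open>The common consequence of (c1), (c2) and (c3) from which the bias rate is derived. The
  error is measured relative to \<open>f v\<close> and in terms of the relative distance, which
  matches a power law. Exponents above 1/2 yield square summable rates; exponents below 1 are those
  covered by \<open>dft_kernel_moment\<close>.\<close>

definition relatively_regular :: "real \<Rightarrow> (real \<Rightarrow> real) \<Rightarrow> bool"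
  where "relatively_regular \<delta> f \<longleftrightarrow> (\<exists>C \<beta>1 \<beta>2. 0 \<le> C \<and> \<beta>1 \<in> {1/2<..<1} \<and> \<beta>2 \<in> {1/2<..<1} \<and>
    (\<forall>u\<in>{0<..pi}. \<forall>v\<in>{0<..pi}. \<bar>f u - f v\<bar> \<le> C * f v * ((\<bar>u - v\<bar> / v) powr \<beta>1 + (\<bar>u - v\<bar> / v) powr \<beta>2
      + (if u \<le> v / 2 then (u / v) powr (- 2 * \<delta>) else 0))))"

text \<open>Removes the exponent 1. On a bounded interval a smaller exponent is a weaker condition;
  the loss of at most 4 comes from \<open>\<bar>u - v\<bar> \<le> pi < 4\<close>.\<close>

lemma Lipschitz_class_lower_exponent:
  assumes "g \<in> Lipschitz_class \<beta>" "1 / 2 < \<beta>" "\<beta> \<le> 1"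
  obtains L \<beta>' where "0 \<le> L" "1 / 2 < \<beta>'" "\<beta>' < 1"
    "\<And>u v. u \<in> {0<..pi} \<Longrightarrow> v \<in> {0<..pi} \<Longrightarrow> \<bar>g u - g v\<bar> \<le> L * \<bar>u - v\<bar> powr \<beta>'"
proof -
  obtain C where C: "\<And>u v. u \<in> {-pi..pi} \<Longrightarrow> v \<in> {-pi..pi} \<Longrightarrow> \<bar>g u - g v\<bar> \<le> C * \<bar>u - v\<bar> powr \<beta>"
    using assms(1) unfolding Lipschitz_class_def by blast
  define \<beta>' where "\<beta>' = min \<beta> (3 / 4)"
  show thesis
  proof
    show "0 \<le> 4 * \<bar>C\<bar>" "1 / 2 < \<beta>'" "\<beta>' < 1" using assms by (auto simp: \<beta>'_def)
    fix u v :: real assume uv: "u \<in> {0<..pi}" "v \<in> {0<..pi}"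
    define t where "t = \<bar>u - v\<bar>"
    have t: "0 \<le> t" "t \<le> 4" using uv pi_less_4 by (auto simp: t_def)
    have "t powr (\<beta> - \<beta>') \<le> 4 powr (\<beta> - \<beta>')"
      using t assms by (intro powr_mono2) (auto simp: \<beta>'_def)
    also have "\<dots> \<le> 4 powr 1" using assms by (intro powr_mono) (auto simp: \<beta>'_def)
    finally have "t powr \<beta>' * t powr (\<beta> - \<beta>') \<le> t powr \<beta>' * 4" by (intro mult_left_mono) auto
    then have *: "t powr \<beta> \<le> 4 * t powr \<beta>'" by (simp flip: powr_add)
    have "\<bar>g u - g v\<bar> \<le> C * t powr \<beta>" unfolding t_def using uv by (intro C) auto
    also have "\<dots> \<le> \<bar>C\<bar> * t powr \<beta>" by (intro mult_right_mono) auto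
    also have "\<dots> \<le> \<bar>C\<bar> * (4 * t powr \<beta>')" using * by (intro mult_left_mono) auto
    finally show "\<bar>g u - g v\<bar> \<le> 4 * \<bar>C\<bar> * \<bar>u - v\<bar> powr \<beta>'" by (simp add: t_def)
  qed
qed

context
  fixes f g :: "real \<Rightarrow> real" and d C1 C2 :: real
  assumes d: "\<bar>d\<bar> < 1 / 2" and C1: "0 < C1"
    and fg: "\<And>u. \<bar>u\<bar> \<le> pi \<Longrightarrow> u \<noteq> 0 \<Longrightarrow> f u = \<bar>u\<bar> powr (- 2 * d) * g u"
    and g: "\<And>u. u \<in> {-pi..pi} \<Longrightarrow> C1 \<le> g u \<and> g u \<le> C2"
begin

lemma spectrum_bounds:
  assumes "u \<in> {0<..pi}"
  shows "C1 * u powr (- 2 * d) \<le> f u" "f u \<le> C2 * u powr (- 2 * d)" "0 < f u"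
proof -
  have f: "f u = u powr (- 2 * d) * g u" using fg[of u] assms by simp
  have gu: "C1 \<le> g u" "g u \<le> C2" using g[of u] assms by auto
  show "C1 * u powr (- 2 * d) \<le> f u" "f u \<le> C2 * u powr (- 2 * d)"
    unfolding f using gu by (simp_all add: mult.commute mult_right_mono)
  show "0 < f u" unfolding f using gu C1 assms by simp
qed

lemma spectrum_ratio_bounds: "C1 \<le> C2" "0 < C2"
  using g[of 0] C1 by auto

text \<open>The difference is split as for a product: the power varies against a bounded
  \<open>g\<close>, and \<open>g\<close> varies against the power at \<open>v\<close>. Both parts
  are multiples of \<open>V\<close>, and \<open>C1 * V \<le> f v\<close> makes the estimate
  relative.\<close>

lemma relatively_regular_Lipschitz:
  assumes "g \<in> Lipschitz_class \<beta>" "1 / 2 < \<beta>" "\<beta> \<le> 1"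
  shows "relatively_regular \<bar>d\<bar> f"
proof -
  obtain L \<beta>1 where L: "0 \<le> L" "1 / 2 < \<beta>1" "\<beta>1 < 1"
    "\<And>u v. u \<in> {0<..pi} \<Longrightarrow> v \<in> {0<..pi} \<Longrightarrow> \<bar>g u - g v\<bar> \<le> L * \<bar>u - v\<bar> powr \<beta>1"
    using Lipschitz_class_lower_exponent[OF assms] by blast
  \<comment> \<open>At least \<open>2 * \<bar>d\<bar>\<close> to control the power for
    \<open>u\<close> much larger than \<open>v\<close>, yet strictly between 1/2 and 1 because
    \<open>\<bar>d\<bar> < 1 / 2\<close>.\<close>
  define \<beta>2 where "\<beta>2 = max (2 * \<bar>d\<bar>) (3 / 4)"
  have \<beta>2: "2 * \<bar>d\<bar> \<le> \<beta>2" "1 / 2 < \<beta>2" "\<beta>2 < 1" using d by (auto simp: \<beta>2_def)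
  define C where "C = 2 * C2 / C1 + 4 * L / C1"
  have C: "2 * C2 / C1 \<le> C" "C2 / C1 \<le> C" "4 * L / C1 \<le> C" "0 \<le> C"
    using C1 L spectrum_ratio_bounds by (auto simp: C_def field_simps)
  have "\<bar>f u - f v\<bar> \<le> C * f v * ((\<bar>u - v\<bar> / v) powr \<beta>1 + (\<bar>u - v\<bar> / v) powr \<beta>2
      + (if u \<le> v / 2 then (u / v) powr (- 2 * \<bar>d\<bar>) else 0))" if uv: "u \<in> {0<..pi}" "v \<in> {0<..pi}" for u v
  proof -
    define y where "y = \<bar>u - v\<bar> / v"
    define s where "s = (if u \<le> v / 2 then (u / v) powr (- 2 * \<bar>d\<bar>) else 0)"
    define V where "V = v powr (- 2 * d)"
    have pos: "0 < u" "0 < v" "u \<le> pi" "v \<le> pi" using uv by auto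
    have V: "0 < V" "C1 * V \<le> f v" using pos spectrum_bounds[OF uv(2)] by (auto simp: V_def)
    have s: "0 \<le> s" by (simp add: s_def)
    have gu: "0 \<le> g u" "g u \<le> C2" using g[of u] uv C1 by auto
    have f: "f u = u powr (- 2 * d) * g u" "f v = V * g v" using fg[of u] fg[of v] pos by (auto simp: V_def)
    have "u powr (- 2 * d) = V * (u / v) powr (- 2 * d)"
      using pos by (simp add: V_def powr_divide)
    then have "f u - f v = V * (((u / v) powr (- 2 * d) - 1) * g u) + V * (g u - g v)"
      by (simp add: f algebra_simps)
    also have "\<bar>\<dots>\<bar> \<le> V * (\<bar>(u / v) powr (- 2 * d) - 1\<bar> * g u) + V * \<bar>g u - g v\<bar>"
      using V gu by (intro order_trans[OF abs_triangle_ineq]) (simp add: abs_mult)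
    also have "\<dots> \<le> V * ((2 * y powr \<beta>2 + s) * C2) + V * (4 * L * y powr \<beta>1)"
    proof (intro add_mono mult_left_mono mult_mono)
      show "\<bar>(u / v) powr (- 2 * d) - 1\<bar> \<le> 2 * y powr \<beta>2 + s"
        unfolding y_def s_def using pos d \<beta>2 by (intro powr_relative_diff_le) auto
      have "\<bar>u - v\<bar> powr \<beta>1 = v powr \<beta>1 * y powr \<beta>1"
        using pos by (simp add: y_def powr_divide)
      also have "v powr \<beta>1 \<le> 4 powr \<beta>1" using pos L pi_less_4 by (intro powr_mono2) auto
      also have "(4::real) powr \<beta>1 \<le> 4 powr 1" using L by (intro powr_mono) auto
      finally have "\<bar>u - v\<bar> powr \<beta>1 \<le> 4 * y powr \<beta>1" by (auto simp: mult_right_mono)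
      then have "L * \<bar>u - v\<bar> powr \<beta>1 \<le> L * (4 * y powr \<beta>1)" using L by (intro mult_left_mono) auto
      then show "\<bar>g u - g v\<bar> \<le> 4 * L * y powr \<beta>1"
        using L(4)[OF uv] by simp
    qed (use V gu s in auto)
    also have "\<dots> = (C1 * V) * (4 * L / C1 * y powr \<beta>1 + 2 * C2 / C1 * y powr \<beta>2 + C2 / C1 * s)"
      using C1 by (simp add: field_simps)
    also have "\<dots> \<le> f v * (C * y powr \<beta>1 + C * y powr \<beta>2 + C * s)"
      using V C C1 L s spectrum_ratio_bounds spectrum_bounds(3)[OF uv(2)] by (intro mult_mono add_mono mult_right_mono) auto
    finally show ?thesis by (simp add: y_def s_def algebra_simps)
  qed
  then show ?thesis
    unfolding relatively_regular_def using C(4) L \<beta>2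
    by (intro exI[of _ C] exI[of _ \<beta>1] exI[of _ \<beta>2]) auto
qed

text \<open>Only for \<open>v / 2 < u \<le> 2 * v\<close> is the derivative used. Outside this range
  the difference is at most \<open>f u + f v\<close>, and the two-sided power bounds suffice: small
  \<open>u\<close> falls under the singular term, large \<open>u\<close> under the Hoelder
  term.\<close>

lemma relatively_regular_derivative:
  assumes "derivative_condition d f"
  shows "relatively_regular \<bar>d\<bar> f"
proof -
  obtain f' D where D: "\<And>u. u \<in> {0<..pi} \<Longrightarrow> (f has_real_derivative f' u) (at u within {-pi..pi})"
    "\<And>u. u \<in> {0<..pi} \<Longrightarrow> \<bar>f' u\<bar> \<le> D * u powr (- 1 - 2 * d)"
    using assms unfolding derivative_condition_def by blast
  define \<beta> where "\<beta> = max (2 * \<bar>d\<bar>) (3 / 4)"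
  have \<beta>: "2 * \<bar>d\<bar> \<le> \<beta>" "1 / 2 < \<beta>" "\<beta> < 1" using d by (auto simp: \<beta>_def)
  define C where "C = 4 * \<bar>D\<bar> / C1 + 2 * (C2 / C1 + 1)"
  have q: "0 \<le> C2 / C1" using C1 spectrum_ratio_bounds by simp
  have q': "0 \<le> 4 * \<bar>D\<bar> / C1" using C1 by simp
  have C: "4 * \<bar>D\<bar> / C1 \<le> C" "2 * (C2 / C1 + 1) \<le> C" "C2 / C1 + 1 \<le> C" "0 \<le> C"
    using q q' by (auto simp: C_def)
  have "\<bar>f u - f v\<bar> \<le> C * f v * ((\<bar>u - v\<bar> / v) powr \<beta> + (\<bar>u - v\<bar> / v) powr \<beta>
      + (if u \<le> v / 2 then (u / v) powr (- 2 * \<bar>d\<bar>) else 0))" if uv: "u \<in> {0<..pi}" "v \<in> {0<..pi}" for u v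
  proof -
    define x where "x = u / v"
    define y where "y = \<bar>u - v\<bar> / v"
    define s where "s = (if u \<le> v / 2 then (u / v) powr (- 2 * \<bar>d\<bar>) else 0)"
    define V where "V = v powr (- 2 * d)"
    have pos: "0 < u" "0 < v" "u \<le> pi" "v \<le> pi" using uv by auto
    have x: "0 < x" using pos by (simp add: x_def)
    have V: "0 < V" "C1 * V \<le> f v" using pos spectrum_bounds[OF uv(2)] by (auto simp: V_def)
    have fv: "0 < f v" "0 < f u" using spectrum_bounds uv by auto
    have y0: "0 \<le> y" using pos by (simp add: y_def)
    have s0: "0 \<le> s" by (simp add: s_def)
    have "u powr (- 2 * d) = V * x powr (- 2 * d)"
      using pos by (simp add: V_def x_def powr_divide)
    then have fu: "f u \<le> f v * (C2 / C1 * x powr (- 2 * d))"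
    proof -
      have "f u \<le> C2 * (V * x powr (- 2 * d))" using spectrum_bounds(2)[OF uv(1)] \<open>u powr _ = _\<close> by simp
      also have "\<dots> = (C1 * V) * (C2 / C1 * x powr (- 2 * d))" using C1 by simp
      also have "\<dots> \<le> f v * (C2 / C1 * x powr (- 2 * d))"
        using V by (intro mult_right_mono mult_nonneg_nonneg[OF q]) auto
      finally show ?thesis .
    qed
    have sum: "\<bar>f u - f v\<bar> \<le> f v * ((C2 / C1 + 1) * m)" if "x powr (- 2 * d) \<le> m" "1 \<le> m" for m
    proof -
      have "\<bar>f u - f v\<bar> \<le> f u + f v" using fv by (simp add: abs_le_iff)
      also have "\<dots> \<le> f v * (C2 / C1 * m) + f v * m"
      proof (intro add_mono)
        show "f u \<le> f v * (C2 / C1 * m)"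
          using fu mult_left_mono[OF mult_left_mono[OF that(1) q], of "f v"] fv by linarith
        show "f v \<le> f v * m" using that fv by simp
      qed
      finally show ?thesis by (simp add: algebra_simps)
    qed
    have "\<bar>f u - f v\<bar> \<le> f v * (C * (y powr \<beta> + s))"
    proof (cases "u \<le> v / 2")
      case True
      have x1: "x \<le> 1" using True pos by (simp add: x_def field_simps)
      have "\<bar>f u - f v\<bar> \<le> f v * ((C2 / C1 + 1) * x powr (- 2 * \<bar>d\<bar>))"
      proof (rule sum)
        show "x powr (- 2 * d) \<le> x powr (- 2 * \<bar>d\<bar>)" using x x1 by (intro powr_mono') auto
        show "1 \<le> x powr (- 2 * \<bar>d\<bar>)" using powr_mono'[of "- 2 * \<bar>d\<bar>" 0 x] x x1 by simp
      qed
      also have "\<dots> \<le> f v * (C * (y powr \<beta> + s))"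
        using True C q fv by (intro mult_left_mono mult_mono) (auto simp: s_def x_def)
      finally show ?thesis .
    next
      case False
      show ?thesis
      proof (cases "u \<le> 2 * v")
        case True
        \<comment> \<open>Mean value estimate on [v / 2, pi]. The exponent
          \<open>- 1 - 2 * d\<close> is negative, so the bound for the derivative is largest at
          \<open>v / 2\<close>; this costs a factor
          \<open>2 powr (1 + 2 * d) \<le> 4\<close>.\<close>
        have "norm (f u - f v) \<le> (\<bar>D\<bar> * (v / 2) powr (- 1 - 2 * d)) * norm (u - v)"
        proof (rule field_differentiable_bound)
          fix z assume z: "z \<in> {v / 2..pi}"
          have zpi: "z \<in> {0<..pi}" using z pos by auto
          show "(f has_field_derivative f' z) (at z within {v / 2..pi})"
            by (rule has_field_derivative_subset[OF D(1)[OF zpi]]) (use pos in auto)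
          have "\<bar>f' z\<bar> \<le> D * z powr (- 1 - 2 * d)" by (rule D(2)[OF zpi])
          also have "\<dots> \<le> \<bar>D\<bar> * z powr (- 1 - 2 * d)" by (intro mult_right_mono) auto
          also have "\<dots> \<le> \<bar>D\<bar> * (v / 2) powr (- 1 - 2 * d)"
            using z pos d by (intro mult_left_mono powr_mono2') auto
          finally show "norm (f' z) \<le> \<bar>D\<bar> * (v / 2) powr (- 1 - 2 * d)" by simp
        qed (use pos False in auto)
        also have "(v / 2) powr (- 1 - 2 * d) = 2 powr (1 + 2 * d) * (V / v)"
          using pos by (simp add: V_def powr_divide powr_diff powr_add powr_minus field_simps)
        also have "\<bar>D\<bar> * (2 powr (1 + 2 * d) * (V / v)) * norm (u - v) \<le> \<bar>D\<bar> * (2 powr 2 * (V / v)) * norm (u - v)"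
          using d V pos by (intro mult_right_mono mult_left_mono powr_mono) auto
        also have "\<dots> = (C1 * V) * (4 * \<bar>D\<bar> / C1 * y)"
          using C1 pos by (simp add: y_def)
        also have "\<dots> \<le> f v * (C * (y powr \<beta> + s))"
        proof (intro mult_mono)
          have "y \<le> 1" using False True pos by (auto simp: y_def abs_le_iff field_simps)
          then have "y \<le> y powr \<beta>" using powr_mono'[of \<beta> 1 y] y0 \<beta> by simp
          then show "y \<le> y powr \<beta> + s" using s0 by simp
        qed (use V C fv y0 mult_nonneg_nonneg[OF q' y0] in auto)
        finally show ?thesis by simp
      next
        case u2: False
        then have x1: "1 \<le> x" using pos by (simp add: x_def field_simps)
        have "\<bar>f u - f v\<bar> \<le> f v * ((C2 / C1 + 1) * x powr (2 * \<bar>d\<bar>))"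
        proof (rule sum)
          show "x powr (- 2 * d) \<le> x powr (2 * \<bar>d\<bar>)" using x1 by (intro powr_mono) auto
          show "1 \<le> x powr (2 * \<bar>d\<bar>)" using x1 by (intro ge_one_powr_ge_zero) auto
        qed
        also have "x powr (2 * \<bar>d\<bar>) \<le> 2 * y powr \<beta>"
          unfolding x_def y_def using pos d \<beta> u2 by (intro powr_relative_diff_le(2)) auto
        also have "f v * ((C2 / C1 + 1) * (2 * y powr \<beta>)) = f v * (2 * (C2 / C1 + 1) * y powr \<beta>)" by simp
        also have "\<dots> \<le> f v * (C * (y powr \<beta> + s))"
          using C fv s0 by (intro mult_left_mono mult_mono) auto
        finally show ?thesis using fv q by (auto simp: mult_left_mono)
      qed
    qed
    also have "\<dots> \<le> f v * (C * (y powr \<beta> + y powr \<beta> + s))"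
      using fv C by (intro mult_left_mono) auto
    finally show ?thesis by (simp add: y_def s_def mult_ac)
  qed
  then show ?thesis
    unfolding relatively_regular_def using C(4) \<beta>
    by (intro exI[of _ C] exI[of _ \<beta>]) auto
qed

text \<open>Relative to the frequency \<open>v\<close> the kernel has width 1 / (n v), and
  \<open>v * n = 2 * pi * j\<close>; hence the relative error is a power of 1 / j. In the singular
  term the powers of \<open>v\<close> combine to 1 / (n v), which is the rate with exponent
  1.\<close>

lemma dft_kernel_bias_relative:
  assumes int_f: "integrable circle_measure f" and even: "AE u in circle_measure. f (- u) = f u"
    and reg: "relatively_regular \<bar>d\<bar> f"
  obtains C \<beta> where "0 \<le> C" "1 / 2 < \<beta>"
    "\<And>n j. j \<in> {1..nu n} \<Longrightarrow> \<bar>(LINT u|circle_measure. f u * (cmod (dft_kernel n j u))\<^sup>2) - f (fourier_freq n j)\<bar>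
      \<le> C * real j powr (- \<beta>) * f (fourier_freq n j)"
proof -
  obtain C \<beta>1 \<beta>2 where C: "0 \<le> C" and \<beta>: "\<beta>1 \<in> {1/2<..<1}" "\<beta>2 \<in> {1/2<..<1}"
    and le: "\<And>u v. u \<in> {0<..pi} \<Longrightarrow> v \<in> {0<..pi} \<Longrightarrow> \<bar>f u - f v\<bar> \<le> C * f v * ((\<bar>u - v\<bar> / v) powr \<beta>1 + (\<bar>u - v\<bar> / v) powr \<beta>2
      + (if u \<le> v / 2 then (u / v) powr (- 2 * \<bar>d\<bar>) else 0))"
    using reg unfolding relatively_regular_def by blast
  define \<beta> where "\<beta> = min \<beta>1 \<beta>2"
  define K where "K = (16 / (1 - \<beta>1) + 16 / (1 - \<beta>2) + 16 / (1 - 2 * \<bar>d\<bar>)) * C"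
  have k: "0 \<le> 16 / (1 - \<beta>1)" "0 \<le> 16 / (1 - \<beta>2)" "0 \<le> 16 / (1 - 2 * \<bar>d\<bar>)" using \<beta> d by auto
  show thesis
  proof
    show "0 \<le> K" unfolding K_def using k C by (intro mult_nonneg_nonneg add_nonneg_nonneg)
    show "1 / 2 < \<beta>" using \<beta> by (simp add: \<beta>_def)
    fix n j assume j: "j \<in> {1..nu n}"
    define v where "v = fourier_freq n j"
    have v: "0 < v" "v \<in> {0<..pi}" using fourier_freq_bounds[OF j] by (auto simp: v_def)
    have n: "0 < real n" using nu_bound[OF j] by simp
    have j1: "1 \<le> real j" using j by simp
    have fv: "0 < f v" using spectrum_bounds(3)[OF v(2)] .
    have vn: "v * n = 2 * pi * j" using n by (simp add: v_def fourier_freq_def)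
    have jvn: "real j \<le> v * n" using j1 pi_gt3 unfolding vn by (intro mult_right_mono[of 1 "2 * pi" "real j", simplified]) auto
    have rate: "v powr (- b) * n powr (- b) \<le> real j powr (- \<beta>)" if "\<beta> \<le> b" "0 \<le> b" for b
    proof -
      have "v powr (- b) * n powr (- b) = (v * n) powr (- b)" using v n by (simp add: powr_mult)
      also have "\<dots> \<le> real j powr (- b)" using jvn j1 that by (intro powr_mono2') auto
      also have "\<dots> \<le> real j powr (- \<beta>)" using j1 that by (intro powr_mono) auto
      finally show ?thesis .
    qed
    have split: "C * f v * ((\<bar>u - v\<bar> / v) powr \<beta>1 + (\<bar>u - v\<bar> / v) powr \<beta>2 + (if u \<le> v / 2 then (u / v) powr (- 2 * \<bar>d\<bar>) else 0))
      = (C * f v * v powr (- \<beta>1)) * \<bar>u - v\<bar> powr \<beta>1 + (C * f v * v powr (- \<beta>2)) * \<bar>u - v\<bar> powr \<beta>2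
        + (C * f v * v powr (2 * \<bar>d\<bar>)) * (if u \<le> v / 2 then u powr (- 2 * \<bar>d\<bar>) else 0)" if "0 < u" for u
      using that v by (simp add: powr_divide powr_minus field_simps)
    have "\<bar>(LINT u|circle_measure. f u * (cmod (dft_kernel n j u))\<^sup>2) - f v\<bar>
      \<le> 16 / (1 - \<beta>1) * ((C * f v * v powr (- \<beta>1)) * n powr (- \<beta>1)) + 16 / (1 - \<beta>2) * ((C * f v * v powr (- \<beta>2)) * n powr (- \<beta>2))
      + 16 / (1 - 2 * \<bar>d\<bar>) * ((C * f v * v powr (2 * \<bar>d\<bar>)) * v powr (- 1 - 2 * \<bar>d\<bar>) / n)"
      unfolding v_def
    proof (rule dft_kernel_bias[OF j int_f even])
      fix u assume u: "u \<in> {0<..pi}"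
      show "\<bar>f u - f (fourier_freq n j)\<bar> \<le> (C * f (fourier_freq n j) * fourier_freq n j powr (- \<beta>1)) * \<bar>u - fourier_freq n j\<bar> powr \<beta>1
       + (C * f (fourier_freq n j) * fourier_freq n j powr (- \<beta>2)) * \<bar>u - fourier_freq n j\<bar> powr \<beta>2
       + (C * f (fourier_freq n j) * fourier_freq n j powr (2 * \<bar>d\<bar>)) * (if u \<le> fourier_freq n j / 2 then u powr (- 2 * \<bar>d\<bar>) else 0)"
        using le[OF u v(2)] split[of u] u unfolding v_def by simp
    qed (use \<beta> d C fv in \<open>auto simp: v_def\<close>)
    also have "\<dots> = 16 / (1 - \<beta>1) * (C * f v * (v powr (- \<beta>1) * n powr (- \<beta>1))) + 16 / (1 - \<beta>2) * (C * f v * (v powr (- \<beta>2) * n powr (- \<beta>2)))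
      + 16 / (1 - 2 * \<bar>d\<bar>) * (C * f v * (v powr (- 1) * n powr (- 1)))"
    proof -
      have "v powr (2 * \<bar>d\<bar>) * v powr (- 1 - 2 * \<bar>d\<bar>) / n = v powr (- 1) * n powr (- 1)"
        using n by (simp add: powr_minus_divide flip: powr_add)
      then have "(C * f v * v powr (2 * \<bar>d\<bar>)) * v powr (- 1 - 2 * \<bar>d\<bar>) / n = C * f v * (v powr (- 1) * n powr (- 1))"
        by (simp only: mult.assoc times_divide_eq_right[symmetric])
      then show ?thesis by (simp only: mult.assoc)
    qed
    also have "\<dots> \<le> 16 / (1 - \<beta>1) * (C * f v * real j powr (- \<beta>)) + 16 / (1 - \<beta>2) * (C * f v * real j powr (- \<beta>))
      + 16 / (1 - 2 * \<bar>d\<bar>) * (C * f v * real j powr (- \<beta>))"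
      using k C fv \<beta> by (intro add_mono mult_left_mono rate) (auto simp: \<beta>_def)
    also have "\<dots> = K * real j powr (- \<beta>) * f v"
      by (simp only: K_def ring_distribs mult_ac)
    finally show "\<bar>(LINT u|circle_measure. f u * (cmod (dft_kernel n j u))\<^sup>2) - f (fourier_freq n j)\<bar>
      \<le> K * real j powr (- \<beta>) * f (fourier_freq n j)" by (simp add: v_def)
  qed
qed

text \<open>For \<open>d = 0\<close> the density equals \<open>g\<close> on (0, pi], so the width 1
  / n of the kernel counts absolutely and not relative to the frequency. The lower bound
  \<open>C1\<close> turns the absolute error into a relative one; the other two terms of
  \<open>dft_kernel_bias\<close> are taken with coefficient 0.\<close>

lemma dft_kernel_bias_uniform:
  assumes int_f: "integrable circle_measure f" and even: "AE u in circle_measure. f (- u) = f u"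
    and d0: "d = 0" and lip: "g \<in> Lipschitz_class \<beta>" "1 / 2 < \<beta>" "\<beta> \<le> 1"
  obtains C \<beta>' where "0 \<le> C" "1 / 2 < \<beta>'"
    "\<And>n j. j \<in> {1..nu n} \<Longrightarrow> \<bar>(LINT u|circle_measure. f u * (cmod (dft_kernel n j u))\<^sup>2) - f (fourier_freq n j)\<bar>
      \<le> C * real n powr (- \<beta>') * f (fourier_freq n j)"
proof -
  obtain L \<beta>1 where L: "0 \<le> L" "1 / 2 < \<beta>1" "\<beta>1 < 1"
    "\<And>u v. u \<in> {0<..pi} \<Longrightarrow> v \<in> {0<..pi} \<Longrightarrow> \<bar>g u - g v\<bar> \<le> L * \<bar>u - v\<bar> powr \<beta>1"
    using Lipschitz_class_lower_exponent[OF lip] by blast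
  have f: "f u = g u" if "u \<in> {0<..pi}" for u using fg[of u] that d0 by simp
  define K where "K = 16 / (1 - \<beta>1) * L / C1"
  show thesis
  proof
    show "0 \<le> K" unfolding K_def using L C1 by simp
    show "1 / 2 < \<beta>1" by (rule L(2))
    fix n j assume j: "j \<in> {1..nu n}"
    have v: "fourier_freq n j \<in> {0<..pi}" using fourier_freq_bounds[OF j] by auto
    have n: "0 < real n" using nu_bound[OF j] by simp
    have "C1 \<le> f (fourier_freq n j)" using spectrum_bounds(1)[OF v] d0 v by simp
    then have K: "16 / (1 - \<beta>1) * (L * n powr (- \<beta>1)) \<le> K * n powr (- \<beta>1) * f (fourier_freq n j)"
    proof -
      assume le: "C1 \<le> f (fourier_freq n j)"
      have "16 / (1 - \<beta>1) * (L * n powr (- \<beta>1)) = K * n powr (- \<beta>1) * C1"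
        using C1 by (simp add: K_def)
      also have "\<dots> \<le> K * n powr (- \<beta>1) * f (fourier_freq n j)"
        using le \<open>0 \<le> K\<close> by (intro mult_left_mono) auto
      finally show ?thesis .
    qed
    have "\<bar>(LINT u|circle_measure. f u * (cmod (dft_kernel n j u))\<^sup>2) - f (fourier_freq n j)\<bar>
      \<le> 16 / (1 - \<beta>1) * (L * n powr (- \<beta>1)) + 16 / (1 - 0) * (0 * n powr (- 0))
      + 16 / (1 - 2 * 0) * (0 * fourier_freq n j powr (- 1 - 2 * 0) / n)"
      by (rule dft_kernel_bias[OF j int_f even]) (use L f v in auto)
    then show "\<bar>(LINT u|circle_measure. f u * (cmod (dft_kernel n j u))\<^sup>2) - f (fourier_freq n j)\<bar>
      \<le> K * n powr (- \<beta>1) * f (fourier_freq n j)" using K by simp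
  qed
qed

end


section \<open>The operator inequality for the spectral density\<close>

lemma spectrum_operator_bound:
  fixes f g :: "real \<Rightarrow> real" and d C1 C2 :: real
  assumes d: "\<bar>d\<bar> < 1 / 2" and C1: "0 < C1"
    and fg: "\<And>u. \<bar>u\<bar> \<le> pi \<Longrightarrow> u \<noteq> 0 \<Longrightarrow> f u = \<bar>u\<bar> powr (- 2 * d) * g u"
    and g: "\<And>u. u \<in> {-pi..pi} \<Longrightarrow> C1 \<le> g u \<and> g u \<le> C2"
    and f: "\<And>u. 0 \<le> f u" "f \<in> borel_measurable circle_measure"
  obtains K where "0 \<le> K"
    "\<And>n c. (LINT u|circle_measure. f u * (cmod (\<Sum>j\<in>{1..nu n}. c j * dft_kernel n j u))\<^sup>2)
      \<le> K * (\<Sum>j\<in>{1..nu n}. (cmod (c j))\<^sup>2 * f (fourier_freq n j))"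
proof -
  define H where "H = 2 + (2 / (1 / 2 - \<bar>d\<bar>))\<^sup>2"
  have C2: "0 < C2" using g[of 0] C1 by auto
  have H: "0 \<le> H" by (simp add: H_def)
  show thesis
  proof
    \<comment> \<open>\<open>H\<close> is the constant for the pure power. \<open>C2\<close> bounds
      the density by the power under the integral, and 1 / \<open>C1\<close> leads back from the
      power to the density at the frequencies.\<close>
    show "0 \<le> C2 * H / C1" using C1 C2 H by simp
    fix n and c :: "nat \<Rightarrow> complex"
    define T where "T u = (cmod (\<Sum>j\<in>{1..nu n}. c j * dft_kernel n j u))\<^sup>2" for u
    have T: "0 \<le> T u" for u by (simp add: T_def)
    have intT: "integrable circle_measure (\<lambda>u. \<bar>u\<bar> powr (- 2 * d) * T u)"
      unfolding T_def by (rule dft_kernel_weighted_bound(1)[OF d])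
    have ae: "AE u in circle_measure. f u * T u \<le> C2 * (\<bar>u\<bar> powr (- 2 * d) * T u)"
      using AE_circle_nonzero AE_space
    proof eventually_elim
      case (elim u)
      then have u: "u \<in> {-pi..pi}" "\<bar>u\<bar> \<le> pi" by auto
      have "f u \<le> \<bar>u\<bar> powr (- 2 * d) * C2"
        unfolding fg[OF u(2) elim(1)] using g[OF u(1)] by (intro mult_left_mono) auto
      then have "f u * T u \<le> \<bar>u\<bar> powr (- 2 * d) * C2 * T u" using T by (rule mult_right_mono)
      then show ?case by (simp only: mult_ac)
    qed
    have [measurable]: "T \<in> borel_measurable circle_measure"
      unfolding T_def[abs_def] by measurable
    have intf: "integrable circle_measure (\<lambda>u. f u * T u)"
    proof (rule Bochner_Integration.integrable_bound[OF integrable_mult_right[OF intT, of C2]])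
      show "(\<lambda>u. f u * T u) \<in> borel_measurable circle_measure" using f(2) by measurable
      show "AE u in circle_measure. norm (f u * T u) \<le> norm (C2 * (\<bar>u\<bar> powr (- 2 * d) * T u))"
        using ae
      proof eventually_elim
        case (elim u)
        have "0 \<le> f u * T u" using f(1) T by simp
        then show ?case using elim unfolding real_norm_def by linarith
      qed
    qed
    have "(LINT u|circle_measure. f u * T u) \<le> (LINT u|circle_measure. C2 * (\<bar>u\<bar> powr (- 2 * d) * T u))"
      using intf intT ae by (intro integral_mono_AE) auto
    also have "\<dots> = C2 * (LINT u|circle_measure. \<bar>u\<bar> powr (- 2 * d) * T u)" by simp
    also have "\<dots> \<le> C2 * (H * (\<Sum>j\<in>{1..nu n}. (cmod (c j))\<^sup>2 * fourier_freq n j powr (- 2 * d)))"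
      unfolding T_def H_def using C2 by (intro mult_left_mono dft_kernel_weighted_bound(2)[OF d]) auto
    also have "\<dots> = C2 * H / C1 * (\<Sum>j\<in>{1..nu n}. (cmod (c j))\<^sup>2 * (C1 * fourier_freq n j powr (- 2 * d)))"
      using C1 by (simp add: sum_distrib_left)
    also have "\<dots> \<le> C2 * H / C1 * (\<Sum>j\<in>{1..nu n}. (cmod (c j))\<^sup>2 * f (fourier_freq n j))"
    proof (intro mult_left_mono sum_mono)
      fix j assume "j \<in> {1..nu n}"
      then have v: "fourier_freq n j \<in> {0<..pi}" using fourier_freq_bounds[of j n] by auto
      show "C1 * fourier_freq n j powr (- 2 * d) \<le> f (fourier_freq n j)"
        by (intro spectrum_bounds(1)[where g = g and ?C2.0 = C2]) (rule d C1 fg g v; assumption)+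
    qed (use C1 C2 H in auto)
    finally show "(LINT u|circle_measure. f u * (cmod (\<Sum>j\<in>{1..nu n}. c j * dft_kernel n j u))\<^sup>2)
      \<le> C2 * H / C1 * (\<Sum>j\<in>{1..nu n}. (cmod (c j))\<^sup>2 * f (fourier_freq n j))" by (simp add: T_def)
  qed
qed

section \<open>Weighted sums of squared moduli of linear forms\<close>

context standardized_noise
begin

text \<open>On real arguments only the real part \<open>c\<close> of the Hermitian matrix
  \<open>e\<close> acts, and \<open>variance_quadratic_form\<close> applies to it. Enlarging
  \<open>c\<close> to \<open>e\<close> gives a sum that can be evaluated exactly: reordering the
  fourfold sum expresses the squared Hilbert-Schmidt norm of \<open>e\<close> through the Gram
  matrix \<open>G\<close>.\<close>

lemma hermitian_form_moments:
  fixes \<alpha> :: "'j \<Rightarrow> 'i \<Rightarrow> complex" and b :: "'j \<Rightarrow> real"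
  assumes F: "finite F" and J: "finite J"
  defines "q \<equiv> \<lambda>\<omega>. \<Sum>j\<in>J. b j * (cmod (\<Sum>s\<in>F. \<alpha> j s * of_real (Z s \<omega>)))\<^sup>2"
    and "G \<equiv> \<lambda>j k. \<Sum>s\<in>F. \<alpha> j s * cnj (\<alpha> k s)"
  shows "square_integrable M q"
    and "expectation q = (\<Sum>j\<in>J. b j * Re (G j j))"
    and "expectation (\<lambda>\<omega>. (q \<omega> - expectation q)\<^sup>2) \<le> (m4 + 2) * (\<Sum>j\<in>J. \<Sum>k\<in>J. b j * b k * (cmod (G j k))\<^sup>2)"
proof -
  define e where "e s t = (\<Sum>j\<in>J. of_real (b j) * (\<alpha> j s * cnj (\<alpha> j t)))" for s t
  define c where "c s t = Re (e s t)" for s t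
  have e_cnj: "e t s = cnj (e s t)" for s t
    by (simp add: e_def mult.commute)
  have sym: "c s t = c t s" for s t
    by (simp add: c_def e_cnj[of s t])
  have q: "q \<omega> = (\<Sum>s\<in>F. \<Sum>t\<in>F. c s t * (Z s \<omega> * Z t \<omega>))" for \<omega>
  proof -
    have "(cmod (\<Sum>s\<in>F. \<alpha> j s * of_real (Z s \<omega>)))\<^sup>2 =
        (\<Sum>s\<in>F. \<Sum>t\<in>F. Re (\<alpha> j s * cnj (\<alpha> j t)) * (Z s \<omega> * Z t \<omega>))" for j
    proof -
      have "(cmod (\<Sum>s\<in>F. \<alpha> j s * of_real (Z s \<omega>)))\<^sup>2 =
          Re ((\<Sum>s\<in>F. \<alpha> j s * of_real (Z s \<omega>)) * cnj (\<Sum>s\<in>F. \<alpha> j s * of_real (Z s \<omega>)))"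
        by (simp only: complex_norm_square[symmetric] Re_complex_of_real)
      also have "\<dots> = (\<Sum>s\<in>F. \<Sum>t\<in>F. Re (\<alpha> j s * cnj (\<alpha> j t)) * (Z s \<omega> * Z t \<omega>))"
        unfolding cnj_sum sum_product Re_sum by (intro sum.cong refl) (simp add: algebra_simps)
      finally show ?thesis .
    qed
    then have "q \<omega> = (\<Sum>j\<in>J. \<Sum>s\<in>F. \<Sum>t\<in>F. b j * (Re (\<alpha> j s * cnj (\<alpha> j t)) * (Z s \<omega> * Z t \<omega>)))"
      by (simp add: q_def sum_distrib_left)
    also have "\<dots> = (\<Sum>s\<in>F. \<Sum>t\<in>F. \<Sum>j\<in>J. b j * (Re (\<alpha> j s * cnj (\<alpha> j t)) * (Z s \<omega> * Z t \<omega>)))"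
      by (rule sum_swap3)
    also have "\<dots> = (\<Sum>s\<in>F. \<Sum>t\<in>F. c s t * (Z s \<omega> * Z t \<omega>))"
      by (simp add: c_def e_def sum_distrib_right mult.assoc)
    finally show ?thesis .
  qed
  show "square_integrable M q"
    unfolding q by (rule square_integrable_quadratic_form)
  have Eq: "expectation q = (\<Sum>s\<in>F. c s s)"
    unfolding q by (rule expectation_quadratic_form[OF F])
  also have "\<dots> = (\<Sum>s\<in>F. \<Sum>j\<in>J. b j * Re (\<alpha> j s * cnj (\<alpha> j s)))"
    by (simp add: c_def e_def)
  also have "\<dots> = (\<Sum>j\<in>J. b j * Re (G j j))"
    by (subst sum.swap) (simp add: G_def sum_distrib_left)
  finally show "expectation q = (\<Sum>j\<in>J. b j * Re (G j j))" .
  have hs: "complex_of_real (\<Sum>s\<in>F. \<Sum>t\<in>F. (cmod (e s t))\<^sup>2) = complex_of_real (\<Sum>j\<in>J. \<Sum>k\<in>J. b j * b k * (cmod (G j k))\<^sup>2)"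
  proof -
    have "complex_of_real (\<Sum>s\<in>F. \<Sum>t\<in>F. (cmod (e s t))\<^sup>2) =
      (\<Sum>s\<in>F. \<Sum>t\<in>F. \<Sum>j\<in>J. \<Sum>k\<in>J. of_real (b j * b k) * ((\<alpha> j s * cnj (\<alpha> k s)) * cnj (\<alpha> j t * cnj (\<alpha> k t))))"
      unfolding of_real_sum complex_norm_square
      by (intro sum.cong refl) (simp add: e_def sum_product mult_ac)
    also have "\<dots> = (\<Sum>s\<in>F. \<Sum>j\<in>J. \<Sum>k\<in>J. \<Sum>t\<in>F. of_real (b j * b k) * ((\<alpha> j s * cnj (\<alpha> k s)) * cnj (\<alpha> j t * cnj (\<alpha> k t))))"
      by (intro sum.cong refl sum_swap3)
    also have "\<dots> = (\<Sum>j\<in>J. \<Sum>k\<in>J. \<Sum>s\<in>F. \<Sum>t\<in>F. of_real (b j * b k) * ((\<alpha> j s * cnj (\<alpha> k s)) * cnj (\<alpha> j t * cnj (\<alpha> k t))))"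
      by (rule sum_swap3)
    also have "\<dots> = (\<Sum>j\<in>J. \<Sum>k\<in>J. of_real (b j * b k) * (G j k * cnj (G j k)))"
      unfolding G_def cnj_sum sum_product by (simp only: sum_distrib_left)
    also have "\<dots> = complex_of_real (\<Sum>j\<in>J. \<Sum>k\<in>J. b j * b k * (cmod (G j k))\<^sup>2)"
      by (simp only: of_real_sum of_real_mult complex_norm_square)
    finally show ?thesis .
  qed
  have "expectation (\<lambda>\<omega>. (q \<omega> - expectation q)\<^sup>2) \<le> (m4 + 2) * (\<Sum>s\<in>F. \<Sum>t\<in>F. (c s t)\<^sup>2)"
    unfolding Eq unfolding q by (rule variance_quadratic_form[OF F sym])
  also have "\<dots> \<le> (m4 + 2) * (\<Sum>s\<in>F. \<Sum>t\<in>F. (cmod (e s t))\<^sup>2)"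
  proof (intro mult_left_mono sum_mono)
    fix s t
    show "(c s t)\<^sup>2 \<le> (cmod (e s t))\<^sup>2"
      unfolding c_def by (rule power2_le_iff_abs_le[THEN iffD2]) (auto simp: abs_Re_le_cmod)
  qed (use m4_nonneg in auto)
  finally show "expectation (\<lambda>\<omega>. (q \<omega> - expectation q)\<^sup>2) \<le> (m4 + 2) * (\<Sum>j\<in>J. \<Sum>k\<in>J. b j * b k * (cmod (G j k))\<^sup>2)"
    using hs unfolding of_real_eq_iff by simp
qed

end

section \<open>Truncation of the linear process\<close>

definition truncated_transfer :: "(nat \<Rightarrow> real) \<Rightarrow> nat \<Rightarrow> real \<Rightarrow> complex"
  where "truncated_transfer a N u = (\<Sum>k<N. of_real (a k) * cis (- (real k * u)))"

lemma continuous_truncated_transfer: "continuous_on S (truncated_transfer a N)"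
  unfolding truncated_transfer_def[abs_def] by (intro continuous_intros)

lemma square_integrable_truncated_transfer: "square_integrable circle_measure (truncated_transfer a N)"
  unfolding square_integrable_def
  by (intro conjI borel_measurable_integrable integrable_circle_continuous continuous_intros continuous_truncated_transfer)

lemma truncated_transfer_uminus: "truncated_transfer a N (- u) = cnj (truncated_transfer a N u)"
  by (simp add: truncated_transfer_def cis_cnj)

lemma transfer_function_tendsto:
  assumes "transfer_function a A"
  shows "tendsto_L2 circle_measure (truncated_transfer a) A"
proof -
  have "(\<Sum>k<N. exp (- \<i> * of_nat k * of_real u) * of_real (a k)) = truncated_transfer a N u" for N u
    unfolding truncated_transfer_def
    by (intro sum.cong refl) (simp add: cis_conv_exp mult_ac)
  then show ?thesis using assms unfolding transfer_function_def by simp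
qed

lemma spectral_density_limit:
  assumes "transfer_function a A"
  shows "integrable circle_measure (spectral_density A)"
    and "(\<lambda>N. LINT u|circle_measure. \<bar>(cmod (truncated_transfer a N u))\<^sup>2 / (2 * pi) - spectral_density A u\<bar>) \<longlonglongrightarrow> 0"
proof -
  note lim = transfer_function_tendsto[OF assms] and sq = square_integrable_truncated_transfer
  show "integrable circle_measure (spectral_density A)"
    using tendsto_L2_square_integrable_diff(1)[OF lim sq]
    by (simp add: square_integrable_def spectral_density_def[abs_def])
  have "(\<lambda>N. (LINT u|circle_measure. \<bar>(cmod (truncated_transfer a N u))\<^sup>2 - (cmod (A u))\<^sup>2\<bar>) / (2 * pi)) \<longlonglongrightarrow> 0 / (2 * pi)"
    by (intro tendsto_divide tendsto_L2_norm_power2[OF lim sq]) auto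
  moreover have "(LINT u|circle_measure. \<bar>(cmod (truncated_transfer a N u))\<^sup>2 / (2 * pi) - spectral_density A u\<bar>) =
      (LINT u|circle_measure. \<bar>(cmod (truncated_transfer a N u))\<^sup>2 - (cmod (A u))\<^sup>2\<bar>) / (2 * pi)" for N
    by (simp add: spectral_density_def abs_divide flip: diff_divide_distrib)
  ultimately show "(\<lambda>N. LINT u|circle_measure. \<bar>(cmod (truncated_transfer a N u))\<^sup>2 / (2 * pi) - spectral_density A u\<bar>) \<longlonglongrightarrow> 0"
    by simp
qed

text \<open>\<open>A\<close> is any version of a mean-square limit, so evenness is inherited from
  the truncations, which are even because the coefficients are real. Reflection preserves the
  integral, hence \<open>f\<close> and its reflection are L1 limits of the same sequence and agree
  almost everywhere.\<close>

lemma spectral_density_even: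
  assumes "transfer_function a A"
  shows "AE u in circle_measure. spectral_density A (- u) = spectral_density A u"
proof -
  define f where "f = spectral_density A"
  define fN where "fN N u = (cmod (truncated_transfer a N u))\<^sup>2 / (2 * pi)" for N u
  note lim = spectral_density_limit[OF assms]
  have int: "integrable circle_measure f" using lim(1) by (simp add: f_def)
  have intN: "integrable circle_measure (fN N)" for N
    unfolding fN_def[abs_def] divide_inverse
    by (intro integrable_circle_continuous continuous_intros continuous_truncated_transfer)
  have int': "integrable circle_measure (\<lambda>u. f (- u))"
    using Equivalence_Lebesgue_Henstock_Integration.integrable_reflect_real[where f = f and a = "- pi" and b = pi] int by simp
  define D where "D N = (LINT u|circle_measure. \<bar>fN N u - f u\<bar>)" for N
  have D: "D \<longlonglongrightarrow> 0" using lim(2) unfolding D_def[abs_def] fN_def f_def .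
  have even: "fN N (- u) = fN N u" for N u
    by (simp add: fN_def truncated_transfer_uminus)
  have refl: "(LINT u|circle_measure. \<bar>fN N u - f (- u)\<bar>) = D N" for N
    using Equivalence_Lebesgue_Henstock_Integration.integral_reflect_real[where f = "\<lambda>u. \<bar>fN N u - f u\<bar>" and a = "- pi" and b = pi]
    by (simp add: D_def even)
  have le: "(LINT u|circle_measure. \<bar>f (- u) - f u\<bar>) \<le> 2 * D N" for N
  proof -
    have "(LINT u|circle_measure. \<bar>f (- u) - f u\<bar>) \<le> (LINT u|circle_measure. \<bar>fN N u - f (- u)\<bar> + \<bar>fN N u - f u\<bar>)"
      using int int' intN[of N] by (intro integral_mono) auto
    also have "\<dots> = 2 * D N"
      using int int' intN[of N] refl[of N] by (simp add: D_def)
    finally show ?thesis .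
  qed
  have "(LINT u|circle_measure. \<bar>f (- u) - f u\<bar>) \<le> 0"
  proof (rule LIMSEQ_le_const)
    show "(\<lambda>N. 2 * D N) \<longlonglongrightarrow> 0" using tendsto_mult_left[OF D, of 2] by simp
  qed (use le in auto)
  then have "(LINT u|circle_measure. \<bar>f (- u) - f u\<bar>) = 0"
    by (intro antisym) auto
  then have "AE u in circle_measure. \<bar>f (- u) - f u\<bar> = 0"
    using int int' by (subst (asm) integral_nonneg_eq_0_iff_AE) auto
  then show ?thesis unfolding f_def by eventually_elim simp
qed

section \<open>Gram integrals and their limits under truncation\<close>

definition spectral_gram :: "(real \<Rightarrow> real) \<Rightarrow> nat \<Rightarrow> nat \<Rightarrow> nat \<Rightarrow> complex"
  where "spectral_gram f n j k = (LINT u|circle_measure. of_real (f u) * (dft_kernel n j u * cnj (dft_kernel n k u)))"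

lemma spectral_gram_diag: "spectral_gram f n j j = of_real (LINT u|circle_measure. f u * (cmod (dft_kernel n j u))\<^sup>2)"
  unfolding spectral_gram_def
  by (simp only: complex_norm_square[symmetric] of_real_mult[symmetric] integral_complex_of_real)

text \<open>A product of two kernels is bounded by n / (2 pi), so L1 convergence of the densities
  suffices. The dependence on n is harmless, as the limit is taken in \<open>N\<close> with n
  fixed.\<close>

lemma spectral_gram_tendsto:
  assumes "\<And>N. integrable circle_measure (fN N)" "integrable circle_measure f"
    and lim: "(\<lambda>N. LINT u|circle_measure. \<bar>fN N u - f u\<bar>) \<longlonglongrightarrow> 0"
  shows "(\<lambda>N. spectral_gram (fN N) n j k) \<longlonglongrightarrow> spectral_gram f n j k"
proof (rule Lim_null[THEN iffD2], rule Lim_null_comparison[OF always_eventually tendsto_mult_right_zero[OF lim, of "n / (2 * pi)"]], rule allI)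
  fix N
  have "spectral_gram (fN N) n j k - spectral_gram f n j k =
     (LINT u|circle_measure. of_real (fN N u) * (dft_kernel n j u * cnj (dft_kernel n k u)) - of_real (f u) * (dft_kernel n j u * cnj (dft_kernel n k u)))"
    unfolding spectral_gram_def using assms(1,2) by (intro Bochner_Integration.integral_diff[symmetric] integrable_mult_dft_kernel(2))
  also have "\<dots> = (LINT u|circle_measure. of_real (fN N u - f u) * (dft_kernel n j u * cnj (dft_kernel n k u)))"
    by (simp add: left_diff_distrib)
  also have "norm \<dots> \<le> (LINT u|circle_measure. norm (of_real (fN N u - f u) * (dft_kernel n j u * cnj (dft_kernel n k u))))"
    by (rule integral_norm_bound)
  also have "\<dots> \<le> (LINT u|circle_measure. n / (2 * pi) * \<bar>fN N u - f u\<bar>)"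
  proof (rule integral_mono)
    show "integrable circle_measure (\<lambda>u. norm (complex_of_real (fN N u - f u) * (dft_kernel n j u * cnj (dft_kernel n k u))))"
      using assms(1,2) by (intro integrable_norm integrable_mult_dft_kernel(2)) auto
    show "integrable circle_measure (\<lambda>u. n / (2 * pi) * \<bar>fN N u - f u\<bar>)" using assms(1,2) by auto
    fix u
    have "cmod (dft_kernel n j u) * cmod (dft_kernel n k u) \<le> sqrt (n / (2 * pi)) * sqrt (n / (2 * pi))"
      by (intro mult_mono cmod_dft_kernel_le) auto
    then have "\<bar>fN N u - f u\<bar> * (cmod (dft_kernel n j u) * cmod (dft_kernel n k u)) \<le> \<bar>fN N u - f u\<bar> * (n / (2 * pi))"
      by (intro mult_left_mono) auto
    then show "norm (complex_of_real (fN N u - f u) * (dft_kernel n j u * cnj (dft_kernel n k u))) \<le> n / (2 * pi) * \<bar>fN N u - f u\<bar>"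
      by (simp only: norm_mult norm_of_real complex_mod_cnj mult.commute)
  qed
  also have "\<dots> = n / (2 * pi) * (LINT u|circle_measure. \<bar>fN N u - f u\<bar>)" by simp
  finally show "norm (spectral_gram (fN N) n j k - spectral_gram f n j k) \<le> n / (2 * pi) * (LINT u|circle_measure. \<bar>fN N u - f u\<bar>)" .
qed

text \<open>The coefficient of the innovation \<open>\<zeta>\<^sub>s\<close> in the normalized discrete Fourier transform of
  the truncated process.\<close>

definition dft_coeff :: "(nat \<Rightarrow> real) \<Rightarrow> nat \<Rightarrow> nat \<Rightarrow> nat \<Rightarrow> int \<Rightarrow> complex"
  where "dft_coeff a N n j s = (\<Sum>t=1..n. \<Sum>k<N. if int t - int k = s then cis (real t * fourier_freq n j) * of_real (a k) / sqrt (2 * pi * real n) else 0)"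

text \<open>The window from \<open>- N\<close> to \<open>n\<close> contains every
  \<open>t - k\<close> that occurs, so the indicator in \<open>dft_coeff\<close> selects exactly one
  \<open>s\<close> for each pair.\<close>

lemma sum_dft_coeff:
  "(\<Sum>s\<in>{- int N..int n}. dft_coeff a N n j s * h s) =
    (\<Sum>t=1..n. \<Sum>k<N. cis (real t * fourier_freq n j) * of_real (a k) / sqrt (2 * pi * real n) * h (int t - int k))"
proof -
  have "(\<Sum>s\<in>{- int N..int n}. dft_coeff a N n j s * h s) =
    (\<Sum>s\<in>{- int N..int n}. \<Sum>t=1..n. \<Sum>k<N. if int t - int k = s then cis (real t * fourier_freq n j) * of_real (a k) / sqrt (2 * pi * real n) * h s else 0)"
    unfolding dft_coeff_def sum_distrib_right by (intro sum.cong refl) auto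
  also have "\<dots> = (\<Sum>t=1..n. \<Sum>k<N. \<Sum>s\<in>{- int N..int n}. if int t - int k = s then cis (real t * fourier_freq n j) * of_real (a k) / sqrt (2 * pi * real n) * h s else 0)"
    by (rule sum_swap3)
  also have "\<dots> = (\<Sum>t=1..n. \<Sum>k<N. cis (real t * fourier_freq n j) * of_real (a k) / sqrt (2 * pi * real n) * h (int t - int k))"
    by (intro sum.cong refl) (auto simp: sum.delta')
  finally show ?thesis .
qed

text \<open>\<open>dft_coeff\<close> is a convolution, so its Fourier series is the product of the
  kernel and the truncated transfer function; Parseval then turns the inner product into the Gram
  integral.\<close>

lemma gram_dft_coeff:
  "(\<Sum>s\<in>{- int N..int n}. dft_coeff a N n j s * cnj (dft_coeff a N n k s)) =
    spectral_gram (\<lambda>u. (cmod (truncated_transfer a N u))\<^sup>2 / (2 * pi)) n j k"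
proof -
  have prod: "(\<Sum>s\<in>{- int N..int n}. dft_coeff a N n j s * cis (of_int s * u)) = dft_kernel n j u * truncated_transfer a N u" for j u
  proof -
    have "dft_kernel n j u * truncated_transfer a N u =
      (\<Sum>t=1..n. \<Sum>k<N. (cis (real t * (fourier_freq n j + u)) / sqrt (2 * pi * real n)) * (of_real (a k) * cis (- (real k * u))))"
      unfolding dft_kernel_def truncated_transfer_def sum_divide_distrib sum_product ..
    also have "\<dots> = (\<Sum>t=1..n. \<Sum>k<N. cis (real t * fourier_freq n j) * of_real (a k) / sqrt (2 * pi * real n) * cis (of_int (int t - int k) * u))"
    proof (intro sum.cong refl)
      fix t k
      have "cis (real t * (fourier_freq n j + u)) * cis (- (real k * u)) = cis (real t * fourier_freq n j) * cis (of_int (int t - int k) * u)"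
        unfolding cis_mult by (simp add: algebra_simps)
      then show "(cis (real t * (fourier_freq n j + u)) / sqrt (2 * pi * real n)) * (of_real (a k) * cis (- (real k * u))) =
        cis (real t * fourier_freq n j) * of_real (a k) / sqrt (2 * pi * real n) * cis (of_int (int t - int k) * u)"
        by (simp add: divide_inverse mult_ac)
    qed
    also have "\<dots> = (\<Sum>s\<in>{- int N..int n}. dft_coeff a N n j s * cis (of_int s * u))"
      by (rule sum_dft_coeff[symmetric])
    finally show ?thesis by simp
  qed
  have "2 * pi * (\<Sum>s\<in>{- int N..int n}. dft_coeff a N n j s * cnj (dft_coeff a N n k s)) =
    (LINT u|circle_measure. (dft_kernel n j u * truncated_transfer a N u) * cnj (dft_kernel n k u * truncated_transfer a N u))"
    unfolding prod[symmetric] by (rule parseval_trig[symmetric]) simp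
  also have "\<dots> = (LINT u|circle_measure. 2 * pi * (of_real ((cmod (truncated_transfer a N u))\<^sup>2 / (2 * pi)) * (dft_kernel n j u * cnj (dft_kernel n k u))))"
  proof (intro Bochner_Integration.integral_cong refl)
    fix u
    have "complex_of_real ((cmod (truncated_transfer a N u))\<^sup>2 / (2 * pi)) = truncated_transfer a N u * cnj (truncated_transfer a N u) / (2 * pi)"
      unfolding of_real_divide complex_norm_square by simp
    then show "(dft_kernel n j u * truncated_transfer a N u) * cnj (dft_kernel n k u * truncated_transfer a N u) =
      2 * pi * (of_real ((cmod (truncated_transfer a N u))\<^sup>2 / (2 * pi)) * (dft_kernel n j u * cnj (dft_kernel n k u)))"
      by simp
  qed
  also have "\<dots> = 2 * pi * spectral_gram (\<lambda>u. (cmod (truncated_transfer a N u))\<^sup>2 / (2 * pi)) n j k"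
    unfolding spectral_gram_def by (rule integral_mult_right_zero)
  finally show ?thesis by simp
qed


section \<open>Mean and variance of the weighted periodogram\<close>

lemma iid_standardized_noise:
  assumes "prob_space M" "iid_sequence M \<zeta>"
    and "prob_space.expectation M (\<zeta> 0) = 0"
    and "prob_space.expectation M (\<lambda>\<omega>. (\<zeta> 0 \<omega>)\<^sup>2) = 1"
    and "integrable M (\<lambda>\<omega>. (\<zeta> 0 \<omega>) ^ 4)"
  shows "standardized_noise M \<zeta> (prob_space.expectation M (\<lambda>\<omega>. \<zeta> 0 \<omega> ^ 4))"
proof -
  interpret prob_space M by fact
  have indep: "indep_vars (\<lambda>_. borel) \<zeta> UNIV" and eq: "distr M borel (\<zeta> j) = distr M borel (\<zeta> 0)" for j
    using assms(2) by (auto simp: iid_sequence_def)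
  have [measurable]: "\<zeta> j \<in> borel_measurable M" for j
    using indep by (auto simp: indep_vars_def)
  have E: "expectation (\<lambda>\<omega>. h (\<zeta> j \<omega>)) = expectation (\<lambda>\<omega>. h (\<zeta> 0 \<omega>))" if "h \<in> borel_measurable borel" for h :: "real \<Rightarrow> real" and j
    using that eq[of j] integral_distr[of "\<zeta> j" M borel h] integral_distr[of "\<zeta> 0" M borel h] by simp
  have I: "integrable M (\<lambda>\<omega>. h (\<zeta> j \<omega>)) \<longleftrightarrow> integrable M (\<lambda>\<omega>. h (\<zeta> 0 \<omega>))" if "h \<in> borel_measurable borel" for h :: "real \<Rightarrow> real" and j
    using that eq[of j] integrable_distr_eq[of "\<zeta> j" M borel h] integrable_distr_eq[of "\<zeta> 0" M borel h] by simp
  show ?thesis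
  proof (unfold_locales)
    show "indep_vars (\<lambda>_. borel) \<zeta> UNIV" by (rule indep)
    fix i
    show "expectation (\<zeta> i) = 0" using E[of "\<lambda>x. x" i] assms by simp
    show "expectation (\<lambda>\<omega>. (\<zeta> i \<omega>)\<^sup>2) = 1" using E[of "\<lambda>x. x\<^sup>2" i] assms by simp
    show "integrable M (\<lambda>\<omega>. \<zeta> i \<omega> ^ 4)" using I[of "\<lambda>x. x ^ 4" i] assms by simp
    show "expectation (\<lambda>\<omega>. \<zeta> i \<omega> ^ 4) = expectation (\<lambda>\<omega>. \<zeta> 0 \<omega> ^ 4)"
      using E[of "\<lambda>x. x ^ 4" i] by simp
  qed
qed

lemma periodogram_eq:
  "periodogram X n (fourier_freq n j) \<omega> =
    (cmod (\<Sum>t=1..n. cis (real t * fourier_freq n j) / sqrt (2 * pi * real n) * of_real (X (int t) \<omega>)))\<^sup>2"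
proof -
  have "(\<Sum>t=1..n. cis (real t * fourier_freq n j) / sqrt (2 * pi * real n) * of_real (X (int t) \<omega>)) =
    (\<Sum>t=1..n. exp (\<i> * of_nat t * of_real (fourier_freq n j)) * of_real (X (int t) \<omega>)) / sqrt (2 * pi * real n)"
    unfolding sum_divide_distrib by (intro sum.cong refl) (simp add: cis_conv_exp mult.assoc)
  then show ?thesis
    by (simp add: periodogram_def norm_divide power_divide)
qed

text \<open>For the truncated process the sum is a finite form to which
  \<open>hermitian_form_moments\<close> applies. As \<open>N\<close> grows the forms converge in L1,
  hence their means converge; the variance is bounded through \<open>L1_limit_second_moment\<close>,
  which also provides the very existence of the second moment of the limit.\<close>

lemma weighted_periodogram_moments:
  fixes M :: "'a measure" and \<zeta> X :: "int \<Rightarrow> 'a \<Rightarrow> real" and b :: "nat \<Rightarrow> nat \<Rightarrow> real" and n :: nat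
  assumes noise: "standardized_noise M \<zeta> m4" and lin: "linear_process M a \<zeta> X" and tf: "transfer_function a A"
  defines "f \<equiv> spectral_density A" and "q \<equiv> weighted_periodogram X b n"
  shows "square_integrable M (\<lambda>\<omega>. q \<omega> - prob_space.expectation M q)"
    and "integrable M q"
    and "prob_space.expectation M q = (\<Sum>j\<in>{1..nu n}. b n j * (LINT u|circle_measure. f u * (cmod (dft_kernel n j u))\<^sup>2))"
    and "prob_space.expectation M (\<lambda>\<omega>. (q \<omega> - prob_space.expectation M q)\<^sup>2)
      \<le> (m4 + 2) * (\<Sum>j\<in>{1..nu n}. \<Sum>k\<in>{1..nu n}. b n j * b n k * (cmod (spectral_gram f n j k))\<^sup>2)"
proof -
  interpret standardized_noise M \<zeta> m4 by (rule noise)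
  define J where "J = {1..nu n}"
  define w where "w j \<omega> = (\<Sum>t=1..n. cis (real t * fourier_freq n j) / sqrt (2 * pi * real n) * of_real (X (int t) \<omega>))" for j \<omega>
  define wN where "wN j N \<omega> = (\<Sum>s\<in>{- int N..int n}. dft_coeff a N n j s * of_real (\<zeta> s \<omega>))" for j N \<omega>
  define qN where "qN N \<omega> = (\<Sum>j\<in>J. b n j * (cmod (wN j N \<omega>))\<^sup>2)" for N \<omega>
  define fN where "fN N u = (cmod (truncated_transfer a N u))\<^sup>2 / (2 * pi)" for N u
  have q: "q \<omega> = (\<Sum>j\<in>J. b n j * (cmod (w j \<omega>))\<^sup>2)" for \<omega>
    by (simp add: q_def weighted_periodogram_def periodogram_eq w_def J_def)
  have wN_eq: "wN j N \<omega> = (\<Sum>t=1..n. cis (real t * fourier_freq n j) / sqrt (2 * pi * real n) *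
      of_real (\<Sum>k<N. a k * \<zeta> (int t - int k) \<omega>))" for j N \<omega>
    unfolding wN_def sum_dft_coeff of_real_sum sum_distrib_left by (intro sum.cong refl) simp
  have lim_w: "tendsto_L2 M (wN j) (w j)" for j
    unfolding wN_eq[abs_def] w_def[abs_def]
    by (intro tendsto_L2_sum tendsto_L2_mult_of_real) (use lin in \<open>simp add: linear_process_def\<close>)
  have sq_wN: "square_integrable M (wN j N)" for j N
    unfolding wN_def[abs_def]
  proof (intro square_integrable_sum square_integrable_mult_left)
    show "square_integrable M (\<lambda>\<omega>. complex_of_real (\<zeta> s \<omega>))" for s
      using square_integrable_noise[of s] by (auto simp: square_integrable_def)
  qed
  note lim_sq = tendsto_L2_norm_power2[OF lim_w sq_wN]
  have int_w: "integrable M (\<lambda>\<omega>. (cmod (w j \<omega>))\<^sup>2)" and int_wN: "integrable M (\<lambda>\<omega>. (cmod (wN j N \<omega>))\<^sup>2)" for j N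
    using tendsto_L2_square_integrable_diff(1)[OF lim_w sq_wN] sq_wN by (auto simp: square_integrable_def)
  have int_q: "integrable M q" unfolding q using int_w by auto
  have int_qN: "integrable M (qN N)" for N unfolding qN_def using int_wN by auto
  show "integrable M q" by (rule int_q)
  have L1: "(\<lambda>N. LINT \<omega>|M. \<bar>qN N \<omega> - q \<omega>\<bar>) \<longlonglongrightarrow> 0"
  proof (rule tendsto_sandwich[OF _ _ tendsto_const])
    show "(\<lambda>N. \<Sum>j\<in>J. \<bar>b n j\<bar> * (LINT \<omega>|M. \<bar>(cmod (wN j N \<omega>))\<^sup>2 - (cmod (w j \<omega>))\<^sup>2\<bar>)) \<longlonglongrightarrow> 0"
      by (intro tendsto_null_sum tendsto_mult_right_zero lim_sq)
    show "\<forall>\<^sub>F N in sequentially. (LINT \<omega>|M. \<bar>qN N \<omega> - q \<omega>\<bar>) \<le>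
        (\<Sum>j\<in>J. \<bar>b n j\<bar> * (LINT \<omega>|M. \<bar>(cmod (wN j N \<omega>))\<^sup>2 - (cmod (w j \<omega>))\<^sup>2\<bar>))"
    proof (intro always_eventually allI)
      fix N
      have "(LINT \<omega>|M. \<bar>qN N \<omega> - q \<omega>\<bar>) \<le> (LINT \<omega>|M. (\<Sum>j\<in>J. \<bar>b n j\<bar> * \<bar>(cmod (wN j N \<omega>))\<^sup>2 - (cmod (w j \<omega>))\<^sup>2\<bar>))"
      proof (rule integral_mono)
        show "integrable M (\<lambda>\<omega>. \<bar>qN N \<omega> - q \<omega>\<bar>)" using int_q int_qN by auto
        show "integrable M (\<lambda>\<omega>. \<Sum>j\<in>J. \<bar>b n j\<bar> * \<bar>(cmod (wN j N \<omega>))\<^sup>2 - (cmod (w j \<omega>))\<^sup>2\<bar>)"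
          using int_w int_wN by auto
        fix \<omega>
        have "qN N \<omega> - q \<omega> = (\<Sum>j\<in>J. b n j * ((cmod (wN j N \<omega>))\<^sup>2 - (cmod (w j \<omega>))\<^sup>2))"
          by (simp add: qN_def q right_diff_distrib sum_subtractf)
        then show "\<bar>qN N \<omega> - q \<omega>\<bar> \<le> (\<Sum>j\<in>J. \<bar>b n j\<bar> * \<bar>(cmod (wN j N \<omega>))\<^sup>2 - (cmod (w j \<omega>))\<^sup>2\<bar>)"
          using sum_abs[of "\<lambda>j. b n j * ((cmod (wN j N \<omega>))\<^sup>2 - (cmod (w j \<omega>))\<^sup>2)" J] by (simp add: abs_mult)
      qed
      also have "\<dots> = (\<Sum>j\<in>J. \<bar>b n j\<bar> * (LINT \<omega>|M. \<bar>(cmod (wN j N \<omega>))\<^sup>2 - (cmod (w j \<omega>))\<^sup>2\<bar>))"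
        using int_w int_wN by (simp add: Bochner_Integration.integral_sum)
      finally show "(LINT \<omega>|M. \<bar>qN N \<omega> - q \<omega>\<bar>) \<le>
        (\<Sum>j\<in>J. \<bar>b n j\<bar> * (LINT \<omega>|M. \<bar>(cmod (wN j N \<omega>))\<^sup>2 - (cmod (w j \<omega>))\<^sup>2\<bar>))" .
    qed
  qed auto
  have lim_E: "(\<lambda>N. expectation (qN N)) \<longlonglongrightarrow> expectation q"
    by (rule tendsto_integral_L1[OF int_qN int_q L1])
  have gram: "(\<Sum>s\<in>{- int N..int n}. dft_coeff a N n j s * cnj (dft_coeff a N n k s)) = spectral_gram (fN N) n j k" for N j k
    unfolding fN_def[abs_def] by (rule gram_dft_coeff)
  have int_fN: "integrable circle_measure (fN N)" for N
    unfolding fN_def[abs_def] divide_inverse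
    by (intro integrable_circle_continuous continuous_intros continuous_truncated_transfer)
  have lim_gram: "(\<lambda>N. spectral_gram (fN N) n j k) \<longlonglongrightarrow> spectral_gram f n j k" for j k
    using spectral_density_limit[OF tf] unfolding f_def fN_def[symmetric]
    by (intro spectral_gram_tendsto int_fN)
  have sq_qN: "square_integrable M (qN N)" for N
    using hermitian_form_moments(1)[of "{- int N..int n}" J "b n" "\<lambda>j. dft_coeff a N n j"]
    by (simp add: qN_def[abs_def] wN_def J_def)
  have E_qN: "expectation (qN N) = (\<Sum>j\<in>J. b n j * Re (spectral_gram (fN N) n j j))" for N
    using hermitian_form_moments(2)[of "{- int N..int n}" J "b n" "\<lambda>j. dft_coeff a N n j"]
    by (simp add: qN_def[abs_def] wN_def J_def gram)
  have V_qN: "expectation (\<lambda>\<omega>. (qN N \<omega> - expectation (qN N))\<^sup>2) \<le>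
      (m4 + 2) * (\<Sum>j\<in>J. \<Sum>k\<in>J. b n j * b n k * (cmod (spectral_gram (fN N) n j k))\<^sup>2)" for N
    using hermitian_form_moments(3)[of "{- int N..int n}" J "b n" "\<lambda>j. dft_coeff a N n j"]
    by (simp add: qN_def[abs_def] wN_def J_def gram)
  have "(\<lambda>N. expectation (qN N)) \<longlonglongrightarrow> (\<Sum>j\<in>J. b n j * Re (spectral_gram f n j j))"
    unfolding E_qN by (intro tendsto_sum tendsto_mult tendsto_const tendsto_Re lim_gram)
  then have "expectation q = (\<Sum>j\<in>J. b n j * Re (spectral_gram f n j j))"
    using lim_E by (rule LIMSEQ_unique[rotated])
  then show "expectation q = (\<Sum>j\<in>{1..nu n}. b n j * (LINT u|circle_measure. f u * (cmod (dft_kernel n j u))\<^sup>2))"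
    by (simp add: spectral_gram_diag J_def)
  define Y where "Y N \<omega> = qN N \<omega> - expectation (qN N)" for N \<omega>
  define y where "y \<omega> = q \<omega> - expectation q" for \<omega>
  have sq_Y: "square_integrable M (Y N)" for N
    unfolding Y_def[abs_def] diff_conv_add_uminus
    by (intro square_integrable_add sq_qN square_integrable_const)
  have int_Y: "integrable M (Y N)" and int_y: "integrable M y" for N
    unfolding Y_def[abs_def] y_def[abs_def] using int_q int_qN by auto
  \<comment> \<open>The centring constants vary with \<open>N\<close> as well; their error is the
    second summand of the bound and vanishes by \<open>lim_E\<close>.\<close>
  have lim_Y: "(\<lambda>N. LINT \<omega>|M. \<bar>Y N \<omega> - y \<omega>\<bar>) \<longlonglongrightarrow> 0"
  proof (rule tendsto_sandwich[OF _ _ tendsto_const])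
    show "(\<lambda>N. (LINT \<omega>|M. \<bar>qN N \<omega> - q \<omega>\<bar>) + \<bar>expectation (qN N) - expectation q\<bar>) \<longlonglongrightarrow> 0"
      using tendsto_add[OF L1 tendsto_rabs[OF Lim_null[THEN iffD1, OF lim_E]]] by simp
    show "\<forall>\<^sub>F N in sequentially. (LINT \<omega>|M. \<bar>Y N \<omega> - y \<omega>\<bar>) \<le> (LINT \<omega>|M. \<bar>qN N \<omega> - q \<omega>\<bar>) + \<bar>expectation (qN N) - expectation q\<bar>"
    proof (intro always_eventually allI)
      fix N
      have "(LINT \<omega>|M. \<bar>Y N \<omega> - y \<omega>\<bar>) \<le> (LINT \<omega>|M. \<bar>qN N \<omega> - q \<omega>\<bar> + \<bar>expectation (qN N) - expectation q\<bar>)"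
        using int_Y int_y int_q int_qN by (intro integral_mono) (auto simp: Y_def y_def)
      also have "\<dots> = (LINT \<omega>|M. \<bar>qN N \<omega> - q \<omega>\<bar>) + \<bar>expectation (qN N) - expectation q\<bar>"
        using int_q int_qN by (simp add: prob_space)
      finally show "(LINT \<omega>|M. \<bar>Y N \<omega> - y \<omega>\<bar>) \<le> (LINT \<omega>|M. \<bar>qN N \<omega> - q \<omega>\<bar>) + \<bar>expectation (qN N) - expectation q\<bar>" .
    qed
  qed auto
  have int_Y2: "integrable M (\<lambda>\<omega>. (Y N \<omega>)\<^sup>2)" for N
    using sq_Y[of N] by (simp add: square_integrable_def)
  have V_Y: "(LINT \<omega>|M. (Y N \<omega>)\<^sup>2) \<le> (m4 + 2) * (\<Sum>j\<in>J. \<Sum>k\<in>J. b n j * b n k * (cmod (spectral_gram (fN N) n j k))\<^sup>2)" for N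
    using V_qN[of N] by (simp add: Y_def)
  have lim_V: "(\<lambda>N. (m4 + 2) * (\<Sum>j\<in>J. \<Sum>k\<in>J. b n j * b n k * (cmod (spectral_gram (fN N) n j k))\<^sup>2)) \<longlonglongrightarrow>
    (m4 + 2) * (\<Sum>j\<in>J. \<Sum>k\<in>J. b n j * b n k * (cmod (spectral_gram f n j k))\<^sup>2)"
    by (intro tendsto_mult tendsto_const tendsto_sum tendsto_power tendsto_norm lim_gram)
  note second = L1_limit_second_moment[OF int_Y int_y lim_Y int_Y2 V_Y lim_V]
  show "square_integrable M (\<lambda>\<omega>. q \<omega> - expectation q)"
    using second(1) int_y by (simp add: square_integrable_def y_def[abs_def])
  show "expectation (\<lambda>\<omega>. (q \<omega> - expectation q)\<^sup>2)
      \<le> (m4 + 2) * (\<Sum>j\<in>{1..nu n}. \<Sum>k\<in>{1..nu n}. b n j * b n k * (cmod (spectral_gram f n j k))\<^sup>2)"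
    using second(2) by (simp add: y_def J_def)
qed

section \<open>Square summable rates and the theorem\<close>

text \<open>Cauchy-Schwarz. The sum on the left may run over a part \<open>I\<close> of
  \<open>J\<close>, so that a tail with a small rate is compared with the norm over all
  frequencies.\<close>

lemma sum_mult_rate_le:
  fixes x r :: "nat \<Rightarrow> real"
  assumes "\<And>j. j \<in> I \<Longrightarrow> 0 \<le> x j" "finite J" "I \<subseteq> J" "(\<Sum>j\<in>I. (r j)\<^sup>2) \<le> e\<^sup>2" "0 \<le> e"
  shows "(\<Sum>j\<in>I. x j * r j) \<le> e * sqrt (\<Sum>j\<in>J. (x j)\<^sup>2)"
proof -
  have "(\<Sum>j\<in>I. x j * r j)\<^sup>2 \<le> (\<Sum>j\<in>I. (x j)\<^sup>2) * (\<Sum>j\<in>I. (r j)\<^sup>2)"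
    by (rule Cauchy_Schwarz_ineq_sum)
  also have "\<dots> \<le> (\<Sum>j\<in>J. (x j)\<^sup>2) * e\<^sup>2"
    using assms by (intro mult_mono sum_mono2) (auto intro: sum_nonneg)
  also have "\<dots> = (e * sqrt (\<Sum>j\<in>J. (x j)\<^sup>2))\<^sup>2"
    by (simp add: power_mult_distrib sum_nonneg)
  finally show ?thesis
    by (rule power2_le_imp_le) (use assms(5) in \<open>simp add: sum_nonneg\<close>)
qed

lemma summable_square_rate:
  fixes C \<beta> :: real
  assumes "1 / 2 < \<beta>"
  shows "summable (\<lambda>j. (C * real j powr (- \<beta>))\<^sup>2)"
proof -
  have "summable (\<lambda>j. C\<^sup>2 * real j powr (- 2 * \<beta>))"
    using assms by (intro summable_mult) (simp add: summable_real_powr_iff)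
  then show ?thesis by (simp add: power_mult_distrib powr_square)
qed

lemma sum_rate_bounded:
  fixes x :: "nat \<Rightarrow> nat \<Rightarrow> real"
  assumes "1 / 2 < \<beta>"
  obtains Z where "0 \<le> Z" "\<And>n m. (\<And>j. 0 \<le> x n j) \<Longrightarrow>
    (\<Sum>j\<in>{1..m}. x n j * (C * real j powr (- \<beta>))) \<le> Z * sqrt (\<Sum>j\<in>{1..m}. (x n j)\<^sup>2)"
proof -
  note summ = summable_square_rate[OF assms, of C]
  define Z where "Z = sqrt (\<Sum>j. (C * real j powr (- \<beta>))\<^sup>2)"
  have nonneg: "0 \<le> (\<Sum>j. (C * real j powr (- \<beta>))\<^sup>2)" using summ by (intro suminf_nonneg) auto
  show thesis
  proof
    show "0 \<le> Z" using nonneg by (simp add: Z_def)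
    fix n m assume x: "\<And>j. 0 \<le> x n j"
    have "(\<Sum>j\<in>{1..m}. (C * real j powr (- \<beta>))\<^sup>2) \<le> Z\<^sup>2"
      using sum_le_suminf[OF summ, of "{1..m}"] nonneg by (simp add: Z_def)
    then show "(\<Sum>j\<in>{1..m}. x n j * (C * real j powr (- \<beta>))) \<le> Z * sqrt (\<Sum>j\<in>{1..m}. (x n j)\<^sup>2)"
      using nonneg by (intro sum_mult_rate_le) (auto simp: x Z_def)
  qed
qed

text \<open>Finitely many low frequencies are negligible by the condition on the maximum; the tail is
  small because the rates are square summable.\<close>

lemma smallo_from_max:
  fixes x :: "nat \<Rightarrow> nat \<Rightarrow> real" and B D :: "nat \<Rightarrow> real" and m :: "nat \<Rightarrow> nat"
  assumes C: "0 \<le> C" and \<beta>: "1 / 2 < \<beta>"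
    and D: "\<And>n. \<bar>D n\<bar> \<le> (\<Sum>j\<in>{1..m n}. x n j * (C * real j powr (- \<beta>)))"
    and x: "\<And>n j. 0 \<le> x n j" and B: "\<And>n. B n = sqrt (\<Sum>j\<in>{1..m n}. (x n j)\<^sup>2)"
    and max: "(\<lambda>n. (MAX j\<in>{1..m n}. x n j) / B n) \<longlonglongrightarrow> 0"
  shows "D \<in> o(B)"
proof (rule landau_o.smallI)
  fix e :: real assume e: "0 < e"
  define r where "r j = C * real j powr (- \<beta>)" for j :: nat
  have r: "0 \<le> r j" for j using C by (simp add: r_def)
  have rC: "r j \<le> C" if "1 \<le> j" for j
  proof -
    have "real j powr (- \<beta>) \<le> real j powr 0" using that \<beta> by (intro powr_mono) auto
    then show ?thesis using C that by (simp add: r_def mult_left_le)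
  qed
  have "summable (\<lambda>j. (r j)\<^sup>2)" unfolding r_def by (rule summable_square_rate[OF \<beta>])
  then have "\<exists>N. \<forall>k\<ge>N. \<forall>l. norm (\<Sum>j=k..<l. (r j)\<^sup>2) < (e / 2)\<^sup>2"
    unfolding summable_Cauchy by (rule allE[of _ "(e / 2)\<^sup>2"]) (use e in auto)
  then obtain K0 where K0: "\<And>k l. k \<ge> K0 \<Longrightarrow> norm (\<Sum>j=k..<l. (r j)\<^sup>2) < (e / 2)\<^sup>2" by blast
  \<comment> \<open>At least 1, so that the part of the index set from \<open>K\<close> on is the
    plain interval \<open>{K..<Suc (m n)}\<close> of the Cauchy criterion.\<close>
  define K where "K = max 1 K0"
  have K: "1 \<le> K" "(\<Sum>j=K..<l. (r j)\<^sup>2) \<le> (e / 2)\<^sup>2" for l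
    using K0[of K l] by (auto simp: K_def)
  \<comment> \<open>Chosen so that at most \<open>K\<close> low frequencies, each contributing at
    most \<open>\<eta> * B n * C\<close>, amount to at most \<open>e / 2 * B n\<close>. The added 1
    covers \<open>C = 0\<close>.\<close>
  define \<eta> where "\<eta> = e / (2 * (real K * C + 1))"
  have KC: "0 \<le> real K * C" using C by simp
  have \<eta>: "0 < \<eta>" using e KC by (simp add: \<eta>_def)
  have "real K * C * \<eta> \<le> (real K * C + 1) * \<eta>" using \<eta> by simp
  also have "\<dots> = e / 2"
  proof -
    have cancel: "k * (e / (2 * k)) = e / 2" if "0 < k" for k using that by simp
    show ?thesis unfolding \<eta>_def by (rule cancel) (use KC in linarith)
  qed
  finally have K\<eta>: "real K * C * \<eta> \<le> e / 2" .
  have "\<forall>\<^sub>F n in sequentially. (MAX j\<in>{1..m n}. x n j) / B n < \<eta>"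
    using max \<eta> by (rule order_tendstoD)
  then show "\<forall>\<^sub>F n in sequentially. norm (D n) \<le> e * norm (B n)"
  proof eventually_elim
    case (elim n)
    have B0: "0 \<le> B n" unfolding B by (simp add: sum_nonneg)
    have x_le: "x n j \<le> \<eta> * B n" if j: "j \<in> {1..m n}" for j
    proof (cases "B n = 0")
      \<comment> \<open>Division by 0 makes the quotient 0 here, so the condition on the maximum
        says nothing; but then every \<open>x n j\<close> vanishes.\<close>
      case True
      then have "(\<Sum>j\<in>{1..m n}. (x n j)\<^sup>2) = 0" unfolding B by simp
      then have "(x n j)\<^sup>2 = 0" using j by (subst (asm) sum_nonneg_eq_0_iff) auto
      then show ?thesis using True by simp
    next
      case False
      then have pos: "0 < B n" using B0 by simp
      have "x n j \<le> (MAX j\<in>{1..m n}. x n j)" using j by (intro Max_ge) auto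
      also have "\<dots> \<le> \<eta> * B n" using elim pos by (simp add: pos_divide_less_eq less_imp_le)
      finally show ?thesis .
    qed
    have split: "{1..m n} = ({1..m n} \<inter> {..<K}) \<union> ({1..m n} \<inter> {K..})" by auto
    have "\<bar>D n\<bar> \<le> (\<Sum>j\<in>{1..m n}. x n j * r j)" unfolding r_def by (rule D)
    also have "\<dots> = (\<Sum>j\<in>{1..m n} \<inter> {..<K}. x n j * r j) + (\<Sum>j\<in>{1..m n} \<inter> {K..}. x n j * r j)"
      by (subst split, rule sum.union_disjoint) auto
    also have "\<dots> \<le> e / 2 * B n + e / 2 * B n"
    proof (rule add_mono)
      have "(\<Sum>j\<in>{1..m n} \<inter> {..<K}. x n j * r j) \<le> (\<Sum>j\<in>{1..m n} \<inter> {..<K}. \<eta> * B n * C)"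
        using x_le rC r x \<eta> B0 by (intro sum_mono mult_mono) auto
      also have "\<dots> = real (card ({1..m n} \<inter> {..<K})) * (\<eta> * B n * C)" by simp
      also have "\<dots> \<le> real K * (\<eta> * B n * C)"
      proof (intro mult_right_mono)
        have "card ({1..m n} \<inter> {..<K}) \<le> card {..<K}" by (intro card_mono) auto
        then show "real (card ({1..m n} \<inter> {..<K})) \<le> real K" by simp
      qed (use \<eta> B0 C in auto)
      also have "\<dots> = real K * C * \<eta> * B n" by simp
      also have "\<dots> \<le> e / 2 * B n" using K\<eta> B0 by (rule mult_right_mono)
      finally show "(\<Sum>j\<in>{1..m n} \<inter> {..<K}. x n j * r j) \<le> e / 2 * B n" .
      show "(\<Sum>j\<in>{1..m n} \<inter> {K..}. x n j * r j) \<le> e / 2 * B n"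
        unfolding B
      proof (rule sum_mult_rate_le)
        have eq: "{1..m n} \<inter> {K..} = {K..<Suc (m n)}" using K(1) by auto
        show "(\<Sum>j\<in>{1..m n} \<inter> {K..}. (r j)\<^sup>2) \<le> (e / 2)\<^sup>2" unfolding eq by (rule K(2))
      qed (use x e in auto)
    qed
    finally show ?case using B0 by simp
  qed
qed

theorem theorem3p3:
  fixes M :: "'a measure"
    and a :: "nat \<Rightarrow> real"
    and \<zeta> X :: "int \<Rightarrow> 'a \<Rightarrow> real"
    and A :: "real \<Rightarrow> complex"
    and f g :: "real \<Rightarrow> real"
    and d C1 C2 :: real
    and b :: "nat \<Rightarrow> nat \<Rightarrow> real"
    and Q :: "nat \<Rightarrow> 'a \<Rightarrow> real"
    and S B :: "nat \<Rightarrow> real"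
    and c1 c2 c3 :: bool
  assumes "prob_space M"
    and "summable (\<lambda>k. (a k)\<^sup>2)"
    and "iid_sequence M \<zeta>"
    and "prob_space.expectation M (\<zeta> 0) = 0"
    and "prob_space.expectation M (\<lambda>\<omega>. (\<zeta> 0 \<omega>)\<^sup>2) = 1"
    and "integrable M (\<lambda>\<omega>. (\<zeta> 0 \<omega>) ^ 4)"
    and "linear_process M a \<zeta> X"
    and "transfer_function a A"
    and f_def: "f = spectral_density A"
    and "\<bar>d\<bar> < 1 / 2"
    and "\<And>u. \<bar>u\<bar> \<le> pi \<Longrightarrow> u \<noteq> 0 \<Longrightarrow> f u = \<bar>u\<bar> powr (- 2 * d) * g u"
    and "continuous_on {-pi..pi} g"
    and "0 < C1"
    and "\<And>u. u \<in> {-pi..pi} \<Longrightarrow> C1 \<le> g u \<and> g u \<le> C2"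
    and Q_def: "Q = weighted_periodogram X b"
    and S_def: "S = weighted_spectrum f b"
    and B_def: "B = B_norm f b"
    and c1_def: "c1 \<longleftrightarrow> d = 0 \<and> (\<exists>\<beta>. 1 / 2 < \<beta> \<and> \<beta> \<le> 1 \<and> g \<in> Lipschitz_class \<beta>)"
    and c2_def: "c2 \<longleftrightarrow> d \<noteq> 0 \<and> (\<exists>\<beta>. 1 / 2 < \<beta> \<and> \<beta> \<le> 1 \<and> g \<in> Lipschitz_class \<beta>)"
    and c3_def: "c3 \<longleftrightarrow> derivative_condition d f"
  shows
    "(\<exists>C. \<forall>n\<ge>1.
        integrable M (Q n) \<and>
        integrable M (\<lambda>\<omega>. (Q n \<omega> - prob_space.expectation M (Q n))\<^sup>2) \<and>
        prob_space.expectation M (\<lambda>\<omega>. (Q n \<omega> - prob_space.expectation M (Q n))\<^sup>2)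
          \<le> C * (B n)\<^sup>2)
     \<and> (c1 \<or> c2 \<or> c3 \<longrightarrow>
        (\<exists>C. \<forall>n\<ge>1.
          integrable M (\<lambda>\<omega>. (Q n \<omega> - S n)\<^sup>2) \<and>
          prob_space.expectation M (\<lambda>\<omega>. (Q n \<omega> - S n)\<^sup>2) \<le> C * (B n)\<^sup>2))
     \<and> (c1 \<longrightarrow> (\<lambda>n. prob_space.expectation M (Q n) - S n) \<in> o(B))
     \<and> ((\<lambda>n. (MAX j\<in>{1..nu n}. \<bar>b n j * f (fourier_freq n j)\<bar>) / B n) \<longlonglongrightarrow> 0 \<longrightarrow>
        c2 \<or> c3 \<longrightarrow>
        (\<lambda>n. prob_space.expectation M (Q n) - S n) \<in> o(B))"
proof -
  interpret prob_space M by fact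
  note d = assms(10) and fg = assms(11) and C1 = assms(13) and g = assms(14)
  define m4 where "m4 = expectation (\<lambda>\<omega>. \<zeta> 0 \<omega> ^ 4)"
  have noise: "standardized_noise M \<zeta> m4"
    unfolding m4_def by (rule iid_standardized_noise) fact+
  note m4 = standardized_noise.m4_nonneg[OF noise]
  have int_f: "integrable circle_measure f" and even: "AE u in circle_measure. f (- u) = f u"
    unfolding f_def by (rule spectral_density_limit spectral_density_even, fact)+
  have f0: "0 \<le> f u" for u by (simp add: f_def spectral_density_def)
  note moments = weighted_periodogram_moments[OF noise assms(7,8), where b = b, folded f_def Q_def]
  define e where "e n j = (LINT u|circle_measure. f u * (cmod (dft_kernel n j u))\<^sup>2)" for n j
  define x where "x n j = \<bar>b n j * f (fourier_freq n j)\<bar>" for n j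
  have x0: "0 \<le> x n j" for n j by (simp add: x_def)
  have B: "B n = sqrt (\<Sum>j\<in>{1..nu n}. (x n j)\<^sup>2)" for n
    by (simp add: B_def B_norm_def x_def)
  have B0: "0 \<le> B n" for n unfolding B by (simp add: sum_nonneg)
  obtain K where K: "0 \<le> K"
    "\<And>n c. (LINT u|circle_measure. f u * (cmod (\<Sum>j\<in>{1..nu n}. c j * dft_kernel n j u))\<^sup>2)
      \<le> K * (\<Sum>j\<in>{1..nu n}. (cmod (c j))\<^sup>2 * f (fourier_freq n j))"
    using spectrum_operator_bound[where f = f and g = g, OF d C1 fg g f0 borel_measurable_integrable[OF int_f]] by blast
  \<comment> \<open>The factor \<open>m4 + 2\<close> comes from the variance of quadratic forms in
    the noise, the square of \<open>K\<close> from the Hilbert-Schmidt bound; neither depends on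
    n.\<close>
  define V where "V = (m4 + 2) * K\<^sup>2"
  have V: "expectation (\<lambda>\<omega>. (Q n \<omega> - expectation (Q n))\<^sup>2) \<le> V * (B n)\<^sup>2" for n
  proof -
    have "(\<Sum>j\<in>{1..nu n}. \<Sum>k\<in>{1..nu n}. b n j * b n k * (cmod (spectral_gram f n j k))\<^sup>2)
      \<le> K\<^sup>2 * (\<Sum>j\<in>{1..nu n}. (b n j * f (fourier_freq n j))\<^sup>2)"
      unfolding spectral_gram_def
      by (rule hilbert_schmidt_bound) (use K f0 integrable_mult_dft_kernel(2)[OF int_f] in auto)
    also have "\<dots> = K\<^sup>2 * (B n)\<^sup>2"
      by (simp add: B_def B_norm_def sum_nonneg)
    finally have "(m4 + 2) * (\<Sum>j\<in>{1..nu n}. \<Sum>k\<in>{1..nu n}. b n j * b n k * (cmod (spectral_gram f n j k))\<^sup>2)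
      \<le> (m4 + 2) * (K\<^sup>2 * (B n)\<^sup>2)"
      using m4 by (intro mult_left_mono) auto
    then show ?thesis using moments(4)[of n] by (simp add: V_def)
  qed
  have bias_sum: "\<bar>expectation (Q n) - S n\<bar> \<le> (\<Sum>j\<in>{1..nu n}. x n j * r j)"
    if "\<And>j. j \<in> {1..nu n} \<Longrightarrow> \<bar>e n j - f (fourier_freq n j)\<bar> \<le> r j * f (fourier_freq n j)" for n r
  proof -
    have "expectation (Q n) - S n = (\<Sum>j\<in>{1..nu n}. b n j * (e n j - f (fourier_freq n j)))"
      unfolding moments(3) by (simp add: S_def weighted_spectrum_def e_def right_diff_distrib sum_subtractf)
    also have "\<bar>\<dots>\<bar> \<le> (\<Sum>j\<in>{1..nu n}. \<bar>b n j * (e n j - f (fourier_freq n j))\<bar>)" by (rule sum_abs)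
    also have "\<dots> \<le> (\<Sum>j\<in>{1..nu n}. x n j * r j)"
    proof (rule sum_mono)
      fix j assume j: "j \<in> {1..nu n}"
      have "\<bar>b n j\<bar> * \<bar>e n j - f (fourier_freq n j)\<bar> \<le> \<bar>b n j\<bar> * (r j * f (fourier_freq n j))"
        by (intro mult_left_mono that j) auto
      then show "\<bar>b n j * (e n j - f (fourier_freq n j))\<bar> \<le> x n j * r j"
        using f0[of "fourier_freq n j"] by (simp add: x_def abs_mult mult_ac)
    qed
    finally show ?thesis .
  qed
  have regular: "relatively_regular \<bar>d\<bar> f" if "c1 \<or> c2 \<or> c3"
  proof (cases c3)
    case True
    show ?thesis
      by (rule relatively_regular_derivative[where f = f and g = g, OF d C1 fg g]) (use True c3_def in auto)
  next
    case False
    then have "c1 \<or> c2" using that by blast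
    then obtain \<beta> where "1 / 2 < \<beta>" "\<beta> \<le> 1" "g \<in> Lipschitz_class \<beta>"
      unfolding c1_def c2_def by blast
    then show ?thesis
      by (intro relatively_regular_Lipschitz[where f = f and g = g, OF d C1 fg g]) auto
  qed
  have rate: "\<exists>C \<beta>. 0 \<le> C \<and> 1 / 2 < \<beta> \<and> (\<forall>n. \<bar>expectation (Q n) - S n\<bar> \<le> (\<Sum>j\<in>{1..nu n}. x n j * (C * real j powr (- \<beta>))))"
    if c: "c1 \<or> c2 \<or> c3"
  proof -
    obtain C \<beta> where C: "0 \<le> C" "1 / 2 < \<beta>"
      "\<And>n j. j \<in> {1..nu n} \<Longrightarrow> \<bar>e n j - f (fourier_freq n j)\<bar> \<le> C * real j powr (- \<beta>) * f (fourier_freq n j)"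
      unfolding e_def
      using dft_kernel_bias_relative[where f = f and g = g, OF d C1 fg g int_f even regular[OF c]] by blast
    show ?thesis by (intro exI[of _ C] exI[of _ \<beta>] conjI allI bias_sum C)
  qed
  have part1: "\<exists>C. \<forall>n\<ge>1. integrable M (Q n) \<and> integrable M (\<lambda>\<omega>. (Q n \<omega> - expectation (Q n))\<^sup>2) \<and>
        expectation (\<lambda>\<omega>. (Q n \<omega> - expectation (Q n))\<^sup>2) \<le> C * (B n)\<^sup>2"
    using moments(1,2) V by (intro exI[of _ V]) (auto simp: square_integrable_def)
  have part2: "\<exists>C. \<forall>n\<ge>1. integrable M (\<lambda>\<omega>. (Q n \<omega> - S n)\<^sup>2) \<and> expectation (\<lambda>\<omega>. (Q n \<omega> - S n)\<^sup>2) \<le> C * (B n)\<^sup>2"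
    if c: "c1 \<or> c2 \<or> c3"
  proof -
    obtain C \<beta> where \<beta>: "1 / 2 < \<beta>"
      and D: "\<And>n. \<bar>expectation (Q n) - S n\<bar> \<le> (\<Sum>j\<in>{1..nu n}. x n j * (C * real j powr (- \<beta>)))"
      using rate[OF c] by blast
    obtain Z where Z: "0 \<le> Z" "\<And>n m. (\<And>j. 0 \<le> x n j) \<Longrightarrow>
      (\<Sum>j\<in>{1..m}. x n j * (C * real j powr (- \<beta>))) \<le> Z * sqrt (\<Sum>j\<in>{1..m}. (x n j)\<^sup>2)"
      using sum_rate_bounded[OF \<beta>, where x = x and C = C] by blast
    \<comment> \<open>The error is the centred variable \<open>y\<close> plus the deterministic bias
      \<open>c\<close>. The crude bound 2 y^2 + 2 c^2 explains both factors 2: \<open>V\<close>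
      stands for the variance, \<open>Z\<close> for the l2 norm of the bias rate.\<close>
    have "integrable M (\<lambda>\<omega>. (Q n \<omega> - S n)\<^sup>2) \<and> expectation (\<lambda>\<omega>. (Q n \<omega> - S n)\<^sup>2) \<le> (2 * V + 2 * Z\<^sup>2) * (B n)\<^sup>2" for n
    proof
      define y where "y \<omega> = Q n \<omega> - expectation (Q n)" for \<omega>
      define c where "c = expectation (Q n) - S n"
      have Qy: "Q n \<omega> - S n = y \<omega> + c" for \<omega> by (simp add: y_def c_def)
      have sq: "square_integrable M y" using moments(1)[of n] by (simp add: y_def[abs_def])
      show int: "integrable M (\<lambda>\<omega>. (Q n \<omega> - S n)\<^sup>2)"
        unfolding Qy using square_integrable_add[OF sq square_integrable_const[of c]] by (simp add: square_integrable_def)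
      have int_y: "integrable M (\<lambda>\<omega>. (y \<omega>)\<^sup>2)" using sq by (simp add: square_integrable_def)
      have "\<bar>c\<bar> \<le> Z * B n"
        using D[of n] Z(2)[of n "nu n"] x0 unfolding c_def B by (meson order_trans)
      then have "\<bar>c\<bar>\<^sup>2 \<le> (Z * B n)\<^sup>2" by (intro power_mono) auto
      then have c2: "c\<^sup>2 \<le> Z\<^sup>2 * (B n)\<^sup>2" by (simp add: power_mult_distrib)
      have "expectation (\<lambda>\<omega>. (Q n \<omega> - S n)\<^sup>2) \<le> expectation (\<lambda>\<omega>. 2 * (y \<omega>)\<^sup>2 + 2 * c\<^sup>2)"
        using int int_y norm_add_power2_le[of "y \<omega>" c for \<omega>] unfolding Qy by (intro integral_mono) auto
      also have "\<dots> = 2 * expectation (\<lambda>\<omega>. (y \<omega>)\<^sup>2) + 2 * c\<^sup>2"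
        using int_y by (simp add: prob_space)
      also have "\<dots> \<le> 2 * (V * (B n)\<^sup>2) + 2 * (Z\<^sup>2 * (B n)\<^sup>2)"
        using V[of n] c2 unfolding y_def by (intro add_mono mult_left_mono) auto
      finally show "expectation (\<lambda>\<omega>. (Q n \<omega> - S n)\<^sup>2) \<le> (2 * V + 2 * Z\<^sup>2) * (B n)\<^sup>2"
        by (simp add: algebra_simps)
    qed
    then show ?thesis by blast
  qed
  have part3: "(\<lambda>n. expectation (Q n) - S n) \<in> o(B)" if c1
  proof -
    obtain \<beta> where \<beta>: "1 / 2 < \<beta>" "\<beta> \<le> 1" "g \<in> Lipschitz_class \<beta>" and d0: "d = 0"
      using \<open>c1\<close> c1_def by blast
    obtain C \<beta>' where C: "0 \<le> C" "1 / 2 < \<beta>'"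
      "\<And>n j. j \<in> {1..nu n} \<Longrightarrow> \<bar>e n j - f (fourier_freq n j)\<bar> \<le> C * real n powr (- \<beta>') * f (fourier_freq n j)"
      unfolding e_def
      using dft_kernel_bias_uniform[where f = f and g = g, OF d C1 fg g int_f even d0 \<beta>(3,1,2)] by blast
    \<comment> \<open>A constant rate over fewer than n frequencies has l2 norm at most sqrt n times
      the rate. As \<beta>' exceeds 1/2 this tends to 0, which upgrades the bound by a multiple of
      \<open>B n\<close> to little-o.\<close>
    have le: "\<bar>expectation (Q n) - S n\<bar> \<le> (C * real n powr (1 / 2 - \<beta>')) * B n" for n
    proof -
      define r where "r = C * real n powr (- \<beta>')"
      have r: "0 \<le> r" using C by (simp add: r_def)
      have "\<bar>expectation (Q n) - S n\<bar> \<le> (\<Sum>j\<in>{1..nu n}. x n j * r)"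
        using C(3) unfolding r_def by (intro bias_sum) auto
      also have "\<dots> \<le> (C * real n powr (1 / 2 - \<beta>')) * sqrt (\<Sum>j\<in>{1..nu n}. (x n j)\<^sup>2)"
      proof (rule sum_mult_rate_le)
        have "(\<Sum>j\<in>{1..nu n}. r\<^sup>2) = real (nu n) * r\<^sup>2" by simp
        also have "\<dots> \<le> real n * r\<^sup>2" by (intro mult_right_mono) (auto simp: nu_def)
        also have "\<dots> = (C * real n powr (1 / 2 - \<beta>'))\<^sup>2"
        proof (cases "n = 0")
          case False
          then have "real n * real n powr (- 2 * \<beta>') = real n powr (1 - 2 * \<beta>')"
            using powr_add[of "real n" 1 "- 2 * \<beta>'"] by simp
          then show ?thesis by (simp add: r_def power_mult_distrib powr_square algebra_simps)
        qed simp
        finally show "(\<Sum>j\<in>{1..nu n}. r\<^sup>2) \<le> (C * real n powr (1 / 2 - \<beta>'))\<^sup>2" .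
      qed (use x0 C in auto)
      finally show ?thesis by (simp add: B)
    qed
    have "(\<lambda>n. C * real n powr (1 / 2 - \<beta>')) \<longlonglongrightarrow> C * 0"
      using C by (intro tendsto_mult tendsto_const tendsto_neg_powr filterlim_real_sequentially) auto
    then have lim: "(\<lambda>n. C * real n powr (1 / 2 - \<beta>')) \<longlonglongrightarrow> 0" by simp
    show ?thesis
    proof (rule landau_o.smallI)
      fix \<epsilon> :: real assume "0 < \<epsilon>"
      with lim have "\<forall>\<^sub>F n in sequentially. C * real n powr (1 / 2 - \<beta>') < \<epsilon>"
        by (rule order_tendstoD)
      then show "\<forall>\<^sub>F n in sequentially. norm (expectation (Q n) - S n) \<le> \<epsilon> * norm (B n)"
      proof eventually_elim
        case (elim n)
        have "(C * real n powr (1 / 2 - \<beta>')) * B n \<le> \<epsilon> * B n"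
          using elim B0 by (intro mult_right_mono) auto
        then show ?case using le[of n] B0[of n] by simp
      qed
    qed
  qed
  have part4: "(\<lambda>n. expectation (Q n) - S n) \<in> o(B)"
    if max: "(\<lambda>n. (MAX j\<in>{1..nu n}. \<bar>b n j * f (fourier_freq n j)\<bar>) / B n) \<longlonglongrightarrow> 0" and "c2 \<or> c3"
  proof -
    have "c1 \<or> c2 \<or> c3" using that by blast
    then obtain C \<beta> where C: "0 \<le> C" "1 / 2 < \<beta>"
      and D: "\<And>n. \<bar>expectation (Q n) - S n\<bar> \<le> (\<Sum>j\<in>{1..nu n}. x n j * (C * real j powr (- \<beta>)))"
      using rate by blast
    show ?thesis
      by (rule smallo_from_max[OF C D x0 B max[folded x_def]])
  qed
  show ?thesis using part1 part2 part3 part4 by blast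
qed

end
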